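(* Let $\bullet$ denote any one of the four versions (regular, causal $c$, anticausal $ac$, bicausal $bc$). Let $p\in[1,\infty)$, $\mu\in\mathcal P_p(\mathcal X)$ and $\nu\in\mathcal P_p(\mathcal Y)$. Let $c:\mathcal X\times\mathcal Y\to\mathbb R$ be continuous with growth of order at most $p$. Assume that there exist discrete (i.e. finitely supported) measures $\mu^n\in\mathcal P(\mathcal X)$, $\nu^n\in\mathcal P(\mathcal Y)$ such that $$\lim_{n\to\infty}W_{p,bc}(\mu^n,\mu)=\lim_{n\to\infty}W_{p,bc}(\nu^n,\nu)=0.$$ Then $$\lim_{\varepsilon\to0}E^\varepsilon_\bullet(\mu,\nu,c)=V_\bullet(\mu,\nu,c)$$ and accumulation points (with respect to weak convergence) of optimizers of $E^\varepsilon_\bullet(\mu,\nu,c)$ for $\varepsilon\searrow0$ are optimizers of $V_\bullet(\mu,\nu,c)$.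
   Context: $N\in\mathbb N$ is the number of time steps; $\mathcal X=\mathcal X_1\times\dots\times\mathcal X_N$ and $\mathcal Y=\mathcal Y_1\times\dots\times\mathcal Y_N$ are products of Polish spaces, with metrics $d_{\mathcal X},d_{\mathcal Y}$ inducing their topologies. $\mathcal P_p(\mathcal X)$ is the set of Borel probability measures with $\int d_{\mathcal X}(\hat x,x)^p\,\mu(dx)<\infty$ for some $\hat x$. The function $c$ has growth of order at most $p$ if $c/(1+d_{\mathcal X}(\hat x,\cdot)^p+d_{\mathcal Y}(\hat y,\cdot)^p)$ is bounded for some $(\hat x,\hat y)$. $X_t,Y_t$ are coordinate projections, $X_{1:t}=(X_1,\dots,X_t)$, etc. $\Pi(\mu,\nu)$ is the set of couplings of $\mu$ and $\nu$. A measure $\pi\in\mathcal P(\mathcal X\times\mathcal Y)$ is causal if under $\pi$, for all $t=1,\dots,N-1$, $X_{t+1}$ is conditionally independent of $Y_{1:t}$ given $X_{1:t}$; anticausal if for all such $t$, $Y_{t+1}$ is conditionally independent of $X_{1:t}$ given $Y_{1:t}$; bicausal if both. $\Pi_c,\Pi_{ac},\Pi_{bc}$ are the corresponding subsets of $\Pi(\mu,\nu)$; $\Pi_\bullet$ stands for any of $\Pi,\Pi_c,\Pi_{ac},\Pi_{bc}$. $V_\bullet(\mu,\nu,c)=\inf_{\pi\in\Pi_\bullet(\mu,\nu)}\int c\,d\pi$ and, for $\varepsilon>0$, $E^\varepsilon_\bullet(\mu,\nu,c)=\inf_{\pi\in\Pi_\bullet(\mu,\nu)}\int c\,d\pi+\varepsilon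 D_{\rm KL}(\pi,\mu\otimes\nu)$, where $D_{\rm KL}(\pi,\tilde\pi)=\int\log\frac{d\pi}{d\tilde\pi}\,d\pi$ if $\pi\ll\tilde\pi$ and $+\infty$ otherwise. $W_{p,bc}(\mu,\tilde\mu)^p=\inf_{\pi\in\Pi_{bc}(\mu,\tilde\mu)}\int d_{\mathcal X}^p\,d\pi$ (similarly on $\mathcal Y$). *)

theory Defs
  imports "HOL-Probability.Probability"
begin

text \<open>
  The spaces \<open>X 1, \<dots>, X N\<close> are topologies on possibly different carriers inside one common type.
  This is no restriction: finitely many spaces always embed in their disjoint sum.
\<close>

definition polish :: "'a topology \<Rightarrow> bool" where
  "polish T \<longleftrightarrow> completely_metrizable_space T \<and> separable_space T"

definition path_space :: "nat \<Rightarrow> (nat \<Rightarrow> 'a topology) \<Rightarrow> (nat \<Rightarrow> 'a) topology" where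
  "path_space N X = product_topology X {1..N}"

definition metric_inducing :: "'a topology \<Rightarrow> ('a \<Rightarrow> 'a \<Rightarrow> real) \<Rightarrow> bool" where
  "metric_inducing T d \<longleftrightarrow> Metric_space (topspace T) d \<and> Metric_space.mtopology (topspace T) d = T"

definition borel_of :: "'a topology \<Rightarrow> 'a measure" where
  "borel_of T = sigma (topspace T) {U. openin T U}"

definition prob_measures :: "'a topology \<Rightarrow> 'a measure set" where
  "prob_measures T = {M. prob_space M \<and> sets M = sets (borel_of T)}"

definition prob_measures_p :: "'a topology \<Rightarrow> ('a \<Rightarrow> 'a \<Rightarrow> real) \<Rightarrow> real \<Rightarrow> 'a measure set" where
  "prob_measures_p T d p =
     {M \<in> prob_measures T. \<exists>a\<in>topspace T. (\<integral>\<^sup>+x. ennreal (d a x powr p) \<partial>M) < \<infinity>}"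

definition finitely_supported :: "'a measure \<Rightarrow> bool" where
  "finitely_supported M \<longleftrightarrow> (\<exists>A\<in>sets M. finite A \<and> emeasure M (space M - A) = 0)"

definition growth_order ::
    "'a topology \<Rightarrow> 'b topology \<Rightarrow> ('a \<Rightarrow> 'a \<Rightarrow> real) \<Rightarrow> ('b \<Rightarrow> 'b \<Rightarrow> real) \<Rightarrow> real \<Rightarrow> ('a \<times> 'b \<Rightarrow> real) \<Rightarrow> bool"
  where
  "growth_order S T dS dT p c \<longleftrightarrow> (\<exists>a\<in>topspace S. \<exists>b\<in>topspace T.
     bounded ((\<lambda>(x, y). c (x, y) / (1 + dS a x powr p + dT b y powr p)) ` (topspace S \<times> topspace T)))"

text \<open>
  Under \<open>M\<close>, the random variables \<open>A\<close> (with values in \<open>S\<close>) and \<open>B\<close> (with values in \<open>T\<close>) are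
  conditionally independent given \<open>C\<close> (with values in \<open>U\<close>):
  \<open>M(A \<in> E, B \<in> F | C) = M(A \<in> E | C) M(B \<in> F | C)\<close> almost surely, for all measurable \<open>E\<close>, \<open>F\<close>.
\<close>

definition cond_indep_var ::
    "'w measure \<Rightarrow> 'a measure \<Rightarrow> ('w \<Rightarrow> 'a) \<Rightarrow> 'b measure \<Rightarrow> ('w \<Rightarrow> 'b) \<Rightarrow> 'c measure \<Rightarrow> ('w \<Rightarrow> 'c) \<Rightarrow> bool"
  where
  "cond_indep_var M S A T B U C \<longleftrightarrow>
     (let G = vimage_algebra (space M) C U in
      \<forall>E\<in>sets S. \<forall>F\<in>sets T. AE w in M.
        real_cond_exp M G (indicator ((A -` E \<inter> space M) \<inter> (B -` F \<inter> space M))) w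
        = real_cond_exp M G (indicator (A -` E \<inter> space M)) w
          * real_cond_exp M G (indicator (B -` F \<inter> space M)) w)"

definition causal ::
    "nat \<Rightarrow> (nat \<Rightarrow> 'a topology) \<Rightarrow> (nat \<Rightarrow> 'b topology) \<Rightarrow> ((nat \<Rightarrow> 'a) \<times> (nat \<Rightarrow> 'b)) measure \<Rightarrow> bool"
  where
  "causal N X Y P \<longleftrightarrow> (\<forall>t\<in>{1..<N}. cond_indep_var P
     (borel_of (X (Suc t))) (\<lambda>w. fst w (Suc t))
     (borel_of (path_space t Y)) (\<lambda>w. restrict (snd w) {1..t})
     (borel_of (path_space t X)) (\<lambda>w. restrict (fst w) {1..t}))"

definition anticausal ::
    "nat \<Rightarrow> (nat \<Rightarrow> 'a topology) \<Rightarrow> (nat \<Rightarrow> 'b topology) \<Rightarrow> ((nat \<Rightarrow> 'a) \<times> (nat \<Rightarrow> 'b)) measure \<Rightarrow> bool"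
  where
  "anticausal N X Y P \<longleftrightarrow> (\<forall>t\<in>{1..<N}. cond_indep_var P
     (borel_of (Y (Suc t))) (\<lambda>w. snd w (Suc t))
     (borel_of (path_space t X)) (\<lambda>w. restrict (fst w) {1..t})
     (borel_of (path_space t Y)) (\<lambda>w. restrict (snd w) {1..t}))"

definition couplings ::
    "'a topology \<Rightarrow> 'b topology \<Rightarrow> 'a measure \<Rightarrow> 'b measure \<Rightarrow> ('a \<times> 'b) measure set" where
  "couplings S T M M' = {P \<in> prob_measures (prod_topology S T).
     distr P (borel_of S) fst = M \<and> distr P (borel_of T) snd = M'}"

datatype version = Regular | Causal | Anticausal | Bicausal

fun admissible ::
    "version \<Rightarrow> nat \<Rightarrow> (nat \<Rightarrow> 'a topology) \<Rightarrow> (nat \<Rightarrow> 'b topology) \<Rightarrow>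
     ((nat \<Rightarrow> 'a) \<times> (nat \<Rightarrow> 'b)) measure \<Rightarrow> bool"
  where
  "admissible Regular N X Y P \<longleftrightarrow> True"
| "admissible Causal N X Y P \<longleftrightarrow> causal N X Y P"
| "admissible Anticausal N X Y P \<longleftrightarrow> anticausal N X Y P"
| "admissible Bicausal N X Y P \<longleftrightarrow> causal N X Y P \<and> anticausal N X Y P"

definition version_couplings ::
    "version \<Rightarrow> nat \<Rightarrow> (nat \<Rightarrow> 'a topology) \<Rightarrow> (nat \<Rightarrow> 'b topology) \<Rightarrow>
     (nat \<Rightarrow> 'a) measure \<Rightarrow> (nat \<Rightarrow> 'b) measure \<Rightarrow> ((nat \<Rightarrow> 'a) \<times> (nat \<Rightarrow> 'b)) measure set"
  where
  "version_couplings v N X Y M M' =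
     {P \<in> couplings (path_space N X) (path_space N Y) M M'. admissible v N X Y P}"

text \<open>
  Extended-real-valued integral: unlike the Bochner integral it does not default to 0 for
  non-integrable functions (if both parts are infinite, its value is \<open>\<infinity>\<close>).
\<close>

definition ext_integral :: "'a measure \<Rightarrow> ('a \<Rightarrow> real) \<Rightarrow> ereal" where
  "ext_integral M f =
     enn2ereal (\<integral>\<^sup>+x. ennreal (f x) \<partial>M) - enn2ereal (\<integral>\<^sup>+x. ennreal (- f x) \<partial>M)"

definition KL :: "'a measure \<Rightarrow> 'a measure \<Rightarrow> ereal" where
  "KL P Q = (if absolutely_continuous Q P
             then ext_integral P (\<lambda>x. ln (enn2real (RN_deriv Q P x))) else \<infinity>)"

definition transport_cost :: "('a \<times> 'b \<Rightarrow> real) \<Rightarrow> ('a \<times> 'b) measure \<Rightarrow> ereal" where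
  "transport_cost c P = ext_integral P c"

definition entropic_cost ::
    "real \<Rightarrow> 'a measure \<Rightarrow> 'b measure \<Rightarrow> ('a \<times> 'b \<Rightarrow> real) \<Rightarrow> ('a \<times> 'b) measure \<Rightarrow> ereal" where
  "entropic_cost e M M' c P = ext_integral P c + ereal e * KL P (M \<Otimes>\<^sub>M M')"

definition V ::
    "version \<Rightarrow> nat \<Rightarrow> (nat \<Rightarrow> 'a topology) \<Rightarrow> (nat \<Rightarrow> 'b topology) \<Rightarrow>
     (nat \<Rightarrow> 'a) measure \<Rightarrow> (nat \<Rightarrow> 'b) measure \<Rightarrow> ((nat \<Rightarrow> 'a) \<times> (nat \<Rightarrow> 'b) \<Rightarrow> real) \<Rightarrow> ereal"
  where
  "V v N X Y M M' c = (INF P\<in>version_couplings v N X Y M M'. transport_cost c P)"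

definition E ::
    "version \<Rightarrow> real \<Rightarrow> nat \<Rightarrow> (nat \<Rightarrow> 'a topology) \<Rightarrow> (nat \<Rightarrow> 'b topology) \<Rightarrow>
     (nat \<Rightarrow> 'a) measure \<Rightarrow> (nat \<Rightarrow> 'b) measure \<Rightarrow> ((nat \<Rightarrow> 'a) \<times> (nat \<Rightarrow> 'b) \<Rightarrow> real) \<Rightarrow> ereal"
  where
  "E v e N X Y M M' c = (INF P\<in>version_couplings v N X Y M M'. entropic_cost e M M' c P)"

definition V_optimizers ::
    "version \<Rightarrow> nat \<Rightarrow> (nat \<Rightarrow> 'a topology) \<Rightarrow> (nat \<Rightarrow> 'b topology) \<Rightarrow>
     (nat \<Rightarrow> 'a) measure \<Rightarrow> (nat \<Rightarrow> 'b) measure \<Rightarrow> ((nat \<Rightarrow> 'a) \<times> (nat \<Rightarrow> 'b) \<Rightarrow> real) \<Rightarrow>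
     ((nat \<Rightarrow> 'a) \<times> (nat \<Rightarrow> 'b)) measure set"
  where
  "V_optimizers v N X Y M M' c =
     {P \<in> version_couplings v N X Y M M'. transport_cost c P = V v N X Y M M' c}"

definition E_optimizers ::
    "version \<Rightarrow> real \<Rightarrow> nat \<Rightarrow> (nat \<Rightarrow> 'a topology) \<Rightarrow> (nat \<Rightarrow> 'b topology) \<Rightarrow>
     (nat \<Rightarrow> 'a) measure \<Rightarrow> (nat \<Rightarrow> 'b) measure \<Rightarrow> ((nat \<Rightarrow> 'a) \<times> (nat \<Rightarrow> 'b) \<Rightarrow> real) \<Rightarrow>
     ((nat \<Rightarrow> 'a) \<times> (nat \<Rightarrow> 'b)) measure set"
  where
  "E_optimizers v e N X Y M M' c =
     {P \<in> version_couplings v N X Y M M'. entropic_cost e M M' c P = E v e N X Y M M' c}"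

text \<open>Adapted Wasserstein distance; the case distinction is the \<open>p\<close>-th root on \<open>[0, \<infinity>]\<close>.\<close>

definition W_bc ::
    "nat \<Rightarrow> (nat \<Rightarrow> 'a topology) \<Rightarrow> ((nat \<Rightarrow> 'a) \<Rightarrow> (nat \<Rightarrow> 'a) \<Rightarrow> real) \<Rightarrow> real \<Rightarrow>
     (nat \<Rightarrow> 'a) measure \<Rightarrow> (nat \<Rightarrow> 'a) measure \<Rightarrow> ennreal"
  where
  "W_bc N X d p M M' =
     (let I = (INF P\<in>version_couplings Bicausal N X X M M'. \<integral>\<^sup>+w. ennreal (d (fst w) (snd w) powr p) \<partial>P)
      in if I = \<infinity> then \<infinity> else ennreal (enn2real I powr (1 / p)))"

definition weakly_converges :: "'a topology \<Rightarrow> (nat \<Rightarrow> 'a measure) \<Rightarrow> 'a measure \<Rightarrow> bool" where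
  "weakly_converges T Ms M \<longleftrightarrow>
     (\<forall>f. continuous_map T euclideanreal f \<and> bounded (f ` topspace T) \<longrightarrow>
          (\<lambda>n. integral\<^sup>L (Ms n) f) \<longlonglongrightarrow> integral\<^sup>L M f)"

text \<open>
  \<open>P\<close> is an accumulation point, as \<open>\<epsilon>\<close> decreases to 0, of elements of the sets \<open>Opt \<epsilon>\<close>.
  Sequences suffice because weak convergence on a Polish space is metrizable.
\<close>

definition weak_accumulation_point_at_0 ::
    "'a topology \<Rightarrow> (real \<Rightarrow> 'a measure set) \<Rightarrow> 'a measure \<Rightarrow> bool" where
  "weak_accumulation_point_at_0 T Opt P \<longleftrightarrow> P \<in> prob_measures T \<and>
     (\<exists>(e :: nat \<Rightarrow> real) Ps. (\<forall>n. e n > 0) \<and> e \<longlonglongrightarrow> 0 \<and> (\<forall>n. Ps n \<in> Opt (e n)) \<and>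
        weakly_converges T Ps P)"

end

theory Submission
  imports Defs
begin

text \<open>
  Write \<open>F\<^sub>t\<close> for the \<open>\<sigma>\<close>-algebra of the first \<open>t\<close> coordinates. A coupling is causal iff for all \<open>t\<close>, all
  \<open>f(x)\<close> orthogonal to \<open>F\<^sub>t\<close> under \<open>\<mu>\<close> and all \<open>F\<^sub>t\<close>-measurable \<open>b(y)\<close> have \<open>\<integral> f(x) b(y) d\<pi> = 0\<close>. This condition
  involves only product integrands and the fixed marginals, so it passes to weak limits.

  A bicausal coupling of \<open>\<mu>\<close> with a measure supported on finitely many points \<open>x\<^sub>i\<close> disintegrates \<open>\<mu>\<close> into
  densities \<open>f\<^sub>i\<close> with \<open>\<Sum>\<^sub>i f\<^sub>i = 1\<close>, and bicausality says that the self-adjoint Markov operator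
  \<open>S a = \<Sum>\<^sub>i f\<^sub>i (\<integral> f\<^sub>i a d\<mu>) / (\<integral> f\<^sub>i d\<mu>)\<close> preserves \<open>F\<^sub>t\<close>-measurability. With densities \<open>g\<^sub>j\<close> and an operator \<open>S'\<close> for
  \<open>\<nu>\<close>, the measure \<open>\<pi>'\<close> defined by \<open>\<integral> a(x) b(y) d\<pi>' = \<integral> (S a)(x) (S' b)(y) d\<pi>\<close> is again a coupling of the
  same causality type, it has a bounded density with respect to \<open>\<mu> \<otimes> \<nu>\<close>, hence finite entropy, and it is
  close to \<open>\<pi>\<close> on Lipschitz functions when the points \<open>x\<^sub>i\<close>, \<open>y\<^sub>j\<close> approximate well. Both claims then follow from
  lower semicontinuity of the transport cost among couplings with fixed marginals.
\<close>

section \<open>Borel sets of Polish path spaces\<close>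

text \<open>Conditional independence is not visibly stable under weak limits, since the conditional
  laws change with the coupling. Testing against functions with vanishing conditional expectation
  removes them: the condition becomes linear in \<pi>, and the test functions depend on the
  marginals alone, so they can be approximated in L1 uniformly over all couplings. The operator
  \<open>S\<close> is a round trip: from \<mu> to the finitely supported measure along the bicausal
  coupling, and back. Being self-adjoint, it preserves past-measurable functions exactly when it
  preserves their orthogonal complement. Both properties are used, one in each variable, since
  causality pairs an orthogonal function of one path with a past-measurable function of the other.
  The density of \<open>\<pi>'\<close> is bounded because only finitely many cells of positive mass
  occur. The bound may blow up as the approximation improves, but the approximation is fixed first,
  and only then \<epsilon> tends to 0. As c is merely continuous with p-growth, closeness on
  Lipschitz functions is turned into a bound on the cost through Lipschitz minorants.\<close>

lemma space_borel_of [simp]: "space (borel_of T) = topspace T"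
  unfolding borel_of_def by (intro space_measure_of) (auto dest: openin_subset)

lemma sets_borel_of: "sets (borel_of T) = sigma_sets (topspace T) {U. openin T U}"
  unfolding borel_of_def by (intro sets_measure_of) (auto dest: openin_subset)

lemma openin_sets_borel_of: "openin T U \<Longrightarrow> U \<in> sets (borel_of T)"
  unfolding sets_borel_of by auto

lemma closedin_sets_borel_of: "closedin T U \<Longrightarrow> U \<in> sets (borel_of T)"
  using sets.compl_sets[of "topspace T - U" "borel_of T"] openin_sets_borel_of[of T "topspace T - U"]
  by (auto simp: closedin_def Diff_Diff_Int inf.absorb2)

lemma measurable_borel_ofI:
  assumes "f \<in> space M \<rightarrow> topspace T" "\<And>U. openin T U \<Longrightarrow> f -` U \<inter> space M \<in> sets M"
  shows "f \<in> M \<rightarrow>\<^sub>M borel_of T"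
  unfolding borel_of_def using assms by (intro measurable_measure_of) (auto dest: openin_subset)

lemma continuous_map_measurable:
  assumes "continuous_map S T f"
  shows "f \<in> borel_of S \<rightarrow>\<^sub>M borel_of T"
proof (rule measurable_borel_ofI)
  show "f \<in> space (borel_of S) \<rightarrow> topspace T"
    using assms by (auto simp: continuous_map_def)
  fix U assume "openin T U"
  then have "openin S {x \<in> topspace S. f x \<in> U}"
    using assms by (auto simp: continuous_map_def)
  moreover have "{x \<in> topspace S. f x \<in> U} = f -` U \<inter> space (borel_of S)"
    by auto
  ultimately show "f -` U \<inter> space (borel_of S) \<in> sets (borel_of S)"
    using openin_sets_borel_of by metis
qed

lemma sets_borel_of_euclidean: "sets (borel_of euclidean) = sets borel"
  unfolding sets_borel_of borel_def by (simp add: open_openin)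

lemma continuous_map_borel_measurable:
  "continuous_map S euclidean f \<Longrightarrow> f \<in> borel_measurable (borel_of S)"
  using continuous_map_measurable[of S euclidean f]
    measurable_cong_sets[OF refl sets_borel_of_euclidean] by blast

lemma polish_imp_second_countable:
  assumes "polish T"
  shows "second_countable T"
proof -
  from assms have "metrizable_space T" "separable_space T"
    by (auto simp: polish_def completely_metrizable_imp_metrizable_space)
  then obtain M d C where M: "Metric_space M d" "T = Metric_space.mtopology M d"
    and C: "countable C" "C \<subseteq> topspace T" "T closure_of C = topspace T"
    unfolding metrizable_space_def separable_space_def by auto
  interpret Metric_space M d by fact
  have T: "topspace T = M" using M by simp
  define B where "B = (\<lambda>(c, n). mball c (1 / Suc n)) ` (C \<times> (UNIV :: nat set))"
  have "countable B" unfolding B_def using C by auto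
  moreover have "\<forall>V\<in>B. openin T V" unfolding B_def M by auto
  moreover have "\<exists>V\<in>B. x \<in> V \<and> V \<subseteq> U" if U: "openin T U" "x \<in> U" for U x
  proof -
    from U have "U \<subseteq> M" "\<exists>r>0. mball x r \<subseteq> U"
      unfolding M openin_mtopology by blast+
    with U(2) obtain r where r: "r > 0" "mball x r \<subseteq> U" "x \<in> M" by blast
    obtain n where n: "2 / r < real n" using reals_Archimedean2 by blast
    then have n': "1 / Suc n < r / 2" using r by (simp add: field_simps)
    have "x \<in> T closure_of C" using C T r by auto
    moreover have "openin T (mball x (1 / Suc n))" unfolding M by auto
    moreover have "x \<in> mball x (1 / Suc n)" using r by auto
    ultimately obtain c where c: "c \<in> C" "c \<in> mball x (1 / Suc n)"
      unfolding in_closure_of by blast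
    have "mball c (1 / Suc n) \<subseteq> mball x r"
    proof
      fix y assume "y \<in> mball c (1 / Suc n)"
      then show "y \<in> mball x r" using c triangle[of x c y] n' r by auto
    qed
    moreover have "x \<in> mball c (1 / Suc n)" using c by (auto simp: commute)
    ultimately show ?thesis using c r unfolding B_def by (intro bexI[of _ "mball c (1 / Suc n)"]) auto
  qed
  ultimately show ?thesis unfolding second_countable_def by blast
qed

text \<open>Countability of the base makes the union of the base sets inside \<open>U\<close> a
  countable one, hence a member of the generated \<sigma>-algebra.\<close>

lemma openin_in_sigma_sets_base:
  assumes "countable B" "openin T U" "\<And>x. x \<in> U \<Longrightarrow> \<exists>V\<in>B. x \<in> V \<and> V \<subseteq> U"
  shows "U \<in> sigma_sets S B"
proof -
  have "U = \<Union>{V \<in> B. V \<subseteq> U}" using assms by blast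
  moreover have "\<Union>{V \<in> B. V \<subseteq> U} \<in> sigma_sets S B"
    using assms(1) by (intro sigma_sets_UNION) (auto intro: countable_subset)
  ultimately show ?thesis by simp
qed

text \<open>The base is recorded as consisting of boxes because \<open>measurable_path_SucI\<close>
  has to split each basic set into its first coordinates and its last one. Finiteness of
  \<open>I\<close> keeps the choices of one basic set per factor countable.\<close>

lemma product_topology_countable_base:
  assumes "finite I" "\<And>i. i \<in> I \<Longrightarrow> second_countable (X i)"
  obtains B where "countable B" "\<And>V. V \<in> B \<Longrightarrow> \<exists>U. V = Pi\<^sub>E I U \<and> (\<forall>i\<in>I. openin (X i) (U i))"
    "\<And>U x. openin (product_topology X I) U \<Longrightarrow> x \<in> U \<Longrightarrow> \<exists>V\<in>B. x \<in> V \<and> V \<subseteq> U"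
proof -
  from assms(2) have "\<forall>i\<in>I. \<exists>B. countable B \<and> (\<forall>V\<in>B. openin (X i) V) \<and>
    (\<forall>U x. openin (X i) U \<and> x \<in> U \<longrightarrow> (\<exists>V\<in>B. x \<in> V \<and> V \<subseteq> U))"
    unfolding second_countable_def by blast
  then obtain B where B: "\<And>i. i \<in> I \<Longrightarrow> countable (B i)"
    "\<And>i V. i \<in> I \<Longrightarrow> V \<in> B i \<Longrightarrow> openin (X i) V"
    "\<And>i U x. i \<in> I \<Longrightarrow> openin (X i) U \<Longrightarrow> x \<in> U \<Longrightarrow> \<exists>V\<in>B i. x \<in> V \<and> V \<subseteq> U"
    by metis
  show ?thesis
  proof (rule that[of "Pi\<^sub>E I ` Pi\<^sub>E I B"])
    show "countable (Pi\<^sub>E I ` Pi\<^sub>E I B)"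
      using B assms(1) by (intro countable_image countable_PiE) auto
    show "\<exists>U. V = Pi\<^sub>E I U \<and> (\<forall>i\<in>I. openin (X i) (U i))" if "V \<in> Pi\<^sub>E I ` Pi\<^sub>E I B" for V
    proof -
      from that obtain U where "U \<in> Pi\<^sub>E I B" "V = Pi\<^sub>E I U" by blast
      then show ?thesis using B(2) PiE_mem by metis
    qed
    fix U x assume "openin (product_topology X I) U" "x \<in> U"
    then obtain W where W: "\<And>i. i \<in> I \<Longrightarrow> openin (X i) (W i)" "x \<in> Pi\<^sub>E I W" "Pi\<^sub>E I W \<subseteq> U"
      unfolding openin_product_topology_alt by meson
    then have "\<forall>i\<in>I. \<exists>V\<in>B i. x i \<in> V \<and> V \<subseteq> W i"
      using B(3) by (metis PiE_mem)
    then obtain V where V: "\<And>i. i \<in> I \<Longrightarrow> V i \<in> B i" "\<And>i. i \<in> I \<Longrightarrow> x i \<in> V i"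
      "\<And>i. i \<in> I \<Longrightarrow> V i \<subseteq> W i"
      by metis
    \<comment> \<open>\<open>V\<close> is arbitrary outside \<open>I\<close>; restricting it makes
      it a member of the extensional product \<open>Pi\<^sub>E I B\<close>.\<close>
    have "x \<in> Pi\<^sub>E I (restrict V I)" "Pi\<^sub>E I (restrict V I) \<subseteq> Pi\<^sub>E I W"
      using V(2,3) W(2) by (auto simp: PiE_iff subset_eq)
    moreover have "restrict V I \<in> Pi\<^sub>E I B" using V(1) by simp
    ultimately show "\<exists>V\<in>Pi\<^sub>E I ` Pi\<^sub>E I B. x \<in> V \<and> V \<subseteq> U"
      using W(3) by (metis imageI order_trans)
  qed
qed

lemma second_countable_product_topology:
  assumes "finite I" "\<And>i. i \<in> I \<Longrightarrow> second_countable (X i)"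
  shows "second_countable (product_topology X I)"
proof -
  obtain B where B: "countable B" "\<And>V. V \<in> B \<Longrightarrow> \<exists>U. V = Pi\<^sub>E I U \<and> (\<forall>i\<in>I. openin (X i) (U i))"
    "\<And>U x. openin (product_topology X I) U \<Longrightarrow> x \<in> U \<Longrightarrow> \<exists>V\<in>B. x \<in> V \<and> V \<subseteq> U"
    using product_topology_countable_base[of I X, OF assms] by metis
  have "openin (product_topology X I) V" if V: "V \<in> B" for V
  proof -
    obtain U where "V = Pi\<^sub>E I U" "\<forall>i\<in>I. openin (X i) (U i)" using B(2)[OF V] by metis
    then show ?thesis using assms(1) by (simp add: openin_PiE_gen)
  qed
  then show ?thesis
    unfolding second_countable_def using B(1,3) by metis
qed

text \<open>Couplings are defined on the Borel sets of the product topology, while the reference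
  measure of the entropy lives on the product \<sigma>-algebra. Second countability makes the two
  agree, so that couplings can have densities with respect to the product measure.\<close>

lemma sets_borel_of_prod_topology:
  assumes "second_countable S" "second_countable T"
  shows "sets (borel_of (prod_topology S T)) = sets (borel_of S \<Otimes>\<^sub>M borel_of T)"
proof
  have "fst \<in> borel_of (prod_topology S T) \<rightarrow>\<^sub>M borel_of S"
    "snd \<in> borel_of (prod_topology S T) \<rightarrow>\<^sub>M borel_of T"
    by (intro continuous_map_measurable continuous_map_fst continuous_map_snd)+
  then have "id \<in> borel_of (prod_topology S T) \<rightarrow>\<^sub>M (borel_of S \<Otimes>\<^sub>M borel_of T)"
    by (subst measurable_pair_iff) (auto simp: comp_def id_def)
  then show "sets (borel_of S \<Otimes>\<^sub>M borel_of T) \<subseteq> sets (borel_of (prod_topology S T))"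
    using sets.sets_into_space[of _ "borel_of S \<Otimes>\<^sub>M borel_of T"]
    by (auto simp: measurable_def space_pair_measure Int_absorb2)
  obtain B where B: "countable B" "\<And>V. V \<in> B \<Longrightarrow> openin S V"
    "\<And>U x. openin S U \<Longrightarrow> x \<in> U \<Longrightarrow> \<exists>V\<in>B. x \<in> V \<and> V \<subseteq> U"
    using assms(1) unfolding second_countable_def by metis
  obtain C where C: "countable C" "\<And>V. V \<in> C \<Longrightarrow> openin T V"
    "\<And>U x. openin T U \<Longrightarrow> x \<in> U \<Longrightarrow> \<exists>V\<in>C. x \<in> V \<and> V \<subseteq> U"
    using assms(2) unfolding second_countable_def by metis
  let ?R = "(\<lambda>(U, V). U \<times> V) ` (B \<times> C)"
  have R: "?R \<subseteq> sets (borel_of S \<Otimes>\<^sub>M borel_of T)"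
    using B(2) C(2) by (auto intro!: pair_measureI openin_sets_borel_of)
  have "W \<in> sets (borel_of S \<Otimes>\<^sub>M borel_of T)" if W: "openin (prod_topology S T) W" for W
  proof -
    have "W \<in> sigma_sets (topspace S \<times> topspace T) ?R"
    proof (rule openin_in_sigma_sets_base[OF _ W])
      show "countable ?R" using B(1) C(1) by auto
      fix z assume "z \<in> W"
      then obtain U V where "openin S U" "openin T V" "fst z \<in> U" "snd z \<in> V" "U \<times> V \<subseteq> W"
        using W unfolding openin_prod_topology_alt by (metis prod.collapse)
      moreover from this obtain U' V' where "U' \<in> B" "fst z \<in> U'" "U' \<subseteq> U" "V' \<in> C" "snd z \<in> V'" "V' \<subseteq> V"
        using B(3)[of U "fst z"] C(3)[of V "snd z"] by blast
      ultimately show "\<exists>V\<in>?R. z \<in> V \<and> V \<subseteq> W"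
        by (intro bexI[of _ "U' \<times> V'"]) (auto simp: mem_Times_iff)
    qed
    then show ?thesis
      using sets.sigma_sets_subset[OF R] by (auto simp: space_pair_measure)
  qed
  then show "sets (borel_of (prod_topology S T)) \<subseteq> sets (borel_of S \<Otimes>\<^sub>M borel_of T)"
    unfolding sets_borel_of[of "prod_topology S T"]
    using sets.sigma_sets_subset[of "{U. openin (prod_topology S T) U}" "borel_of S \<Otimes>\<^sub>M borel_of T"]
    by (auto simp: space_pair_measure)
qed

section \<open>Path spaces and their coordinates\<close>

lemma topspace_path_space: "topspace (path_space N X) = (\<Pi>\<^sub>E i\<in>{1..N}. topspace (X i))"
  by (simp add: path_space_def)

lemma path_space_second_countable:
  "(\<And>t. t \<in> {1..N} \<Longrightarrow> polish (X t)) \<Longrightarrow> second_countable (path_space N X)"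
  unfolding path_space_def by (intro second_countable_product_topology polish_imp_second_countable) auto

lemma path_space_metrizable:
  "(\<And>t. t \<in> {1..N} \<Longrightarrow> polish (X t)) \<Longrightarrow> metrizable_space (path_space N X)"
  unfolding path_space_def metrizable_space_product_topology
  by (auto simp: polish_def completely_metrizable_imp_metrizable_space)

lemma continuous_map_path_restrict:
  "t \<le> n \<Longrightarrow> continuous_map (path_space n X) (path_space t X) (\<lambda>x. restrict x {1..t})"
  unfolding path_space_def
  by (auto simp: continuous_map_componentwise intro!: continuous_map_product_projection cong: if_cong)

lemma continuous_map_path_coordinate:
  "t \<in> {1..n} \<Longrightarrow> continuous_map (path_space n X) (X t) (\<lambda>x. x t)"
  unfolding path_space_def by (rule continuous_map_product_projection)

text \<open>A basic box over \<open>{1..Suc t}\<close> is a box over \<open>{1..t}\<close> together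
  with a condition on the last coordinate. Past and next coordinate thus generate the path up to
  \<open>Suc t\<close>, which connects one-step conditional independence with the \<sigma>-algebra
  at the next time.\<close>

lemma measurable_path_SucI:
  assumes X: "\<And>i. i \<in> {1..Suc t} \<Longrightarrow> polish (X i)"
    and f: "f \<in> space M \<rightarrow> topspace (path_space (Suc t) X)"
    and r: "(\<lambda>w. restrict (f w) {1..t}) \<in> M \<rightarrow>\<^sub>M borel_of (path_space t X)"
    and e: "(\<lambda>w. f w (Suc t)) \<in> M \<rightarrow>\<^sub>M borel_of (X (Suc t))"
  shows "f \<in> M \<rightarrow>\<^sub>M borel_of (path_space (Suc t) X)"
proof (rule measurable_borel_ofI[OF f])
  fix W assume W: "openin (path_space (Suc t) X) W"
  have "\<And>i. i \<in> {1..Suc t} \<Longrightarrow> second_countable (X i)"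
    using X by (rule polish_imp_second_countable)
  then obtain B where B: "countable B"
    "\<And>V. V \<in> B \<Longrightarrow> \<exists>U. V = Pi\<^sub>E {1..Suc t} U \<and> (\<forall>i\<in>{1..Suc t}. openin (X i) (U i))"
    "\<And>U x. openin (path_space (Suc t) X) U \<Longrightarrow> x \<in> U \<Longrightarrow> \<exists>V\<in>B. x \<in> V \<and> V \<subseteq> U"
    using product_topology_countable_base[of "{1..Suc t}" X] unfolding path_space_def by (metis finite_atLeastAtMost)
  have "f -` V \<inter> space M \<in> sets M" if V: "V \<in> B" for V
  proof -
    obtain U where U: "V = Pi\<^sub>E {1..Suc t} U" "\<And>i. i \<in> {1..Suc t} \<Longrightarrow> openin (X i) (U i)"
      using B(2)[OF V] by auto
    have "f -` V \<inter> space M = ((\<lambda>w. restrict (f w) {1..t}) -` Pi\<^sub>E {1..t} U \<inter> space M) \<inter>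
      ((\<lambda>w. f w (Suc t)) -` U (Suc t) \<inter> space M)"
      (is "?L = ?A \<inter> ?B")
    proof -
      have ext: "f w \<in> extensional {1..Suc t}" if "w \<in> space M" for w
        using f that by (auto simp: topspace_path_space PiE_iff)
      have "f w \<in> Pi\<^sub>E {1..Suc t} U \<longleftrightarrow> restrict (f w) {1..t} \<in> Pi\<^sub>E {1..t} U \<and> f w (Suc t) \<in> U (Suc t)"
        if "w \<in> space M" for w
        proof -
        have "{1..Suc t} = insert (Suc t) {1..t}" by auto
        then show ?thesis using ext[OF that] by (auto simp: PiE_iff)
      qed
      then show ?thesis unfolding U(1) by blast
    qed
    moreover have "openin (path_space t X) (Pi\<^sub>E {1..t} U)"
      unfolding path_space_def using U(2) by (simp add: openin_PiE_gen)
    ultimately show ?thesis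
      using measurable_sets[OF r openin_sets_borel_of] measurable_sets[OF e openin_sets_borel_of] U(2)
      by auto
  qed
  moreover have "f -` W \<inter> space M = (\<Union>V\<in>{V\<in>B. V \<subseteq> W}. f -` V \<inter> space M)"
    using B(3)[OF W] by blast
  moreover have "countable {V\<in>B. V \<subseteq> W}" using B(1) by (auto intro: countable_subset)
  ultimately show "f -` W \<inter> space M \<in> sets M"
    by (metis (no_types, lifting) sets.countable_UN'' mem_Collect_eq)
qed

section \<open>Bounded measurable functions and Lipschitz approximation\<close>

text \<open>The approximants are the inf-convolutions \<open>inf\<^sub>y (min (h y) k + k d x y)\<close>.\<close>

lemma lipschitz_approximation_from_below:
  fixes h :: "'a \<Rightarrow> real"
  assumes M: "Metric_space M d" and h0: "\<And>x. x \<in> M \<Longrightarrow> 0 \<le> h x"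
    and lsc: "\<And>x a. x \<in> M \<Longrightarrow> a < h x \<Longrightarrow> \<exists>r>0. \<forall>y\<in>M. d x y < r \<longrightarrow> a < h y"
  obtains f :: "nat \<Rightarrow> 'a \<Rightarrow> real" where
    "\<And>k x. x \<in> M \<Longrightarrow> 0 \<le> f k x" "\<And>k x. x \<in> M \<Longrightarrow> f k x \<le> h x" "\<And>k x. x \<in> M \<Longrightarrow> f k x \<le> real k"
    "\<And>k x y. x \<in> M \<Longrightarrow> y \<in> M \<Longrightarrow> \<bar>f k x - f k y\<bar> \<le> real k * d x y"
    "\<And>x. x \<in> M \<Longrightarrow> incseq (\<lambda>k. f k x)"
    "\<And>x. x \<in> M \<Longrightarrow> (\<lambda>k. f k x) \<longlonglongrightarrow> h x"
proof -
  interpret Metric_space M d by fact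
  define q where "q k x y = min (h y) (real k) + real k * d x y" for k x y
  define f where "f k x = (INF y\<in>M. q k x y)" for k x
  have q0: "0 \<le> q k x y" if "y \<in> M" for k x y
    using h0[OF that] unfolding q_def by (simp add: min_def)
  then have bdd: "bdd_below (q k x ` M)" for k x
    by (intro bdd_belowI[of _ 0]) auto
  have low: "f k x \<le> q k x y" if "y \<in> M" for k x y
    unfolding f_def using that bdd by (intro cINF_lower) auto
  have great: "c \<le> f k x" if "x \<in> M" "\<And>y. y \<in> M \<Longrightarrow> c \<le> q k x y" for c k x
    unfolding f_def using that by (intro cINF_greatest) auto
  have diag: "f k x \<le> min (h x) (real k)" if "x \<in> M" for k x
    using low[OF that, of k x] that by (simp add: q_def)
  have inc: "f k x \<le> f l x" if "x \<in> M" "k \<le> l" for k l x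
  proof (rule great[OF that(1)])
    fix y assume y: "y \<in> M"
    have "q k x y \<le> q l x y"
      unfolding q_def using that(2) by (intro add_mono mult_right_mono) (auto simp: min_def)
    then show "f k x \<le> q l x y" using low[OF y, of k x] by linarith
  qed
  have lip: "f k x \<le> f k y + real k * d x y" if xy: "x \<in> M" "y \<in> M" for k x y
  proof -
    have "f k x - real k * d x y \<le> f k y"
    proof (rule great[OF xy(2)])
      fix z assume z: "z \<in> M"
      have "real k * d x z \<le> real k * (d x y + d y z)"
        using triangle[OF xy z] by (intro mult_left_mono) auto
      then show "f k x - real k * d x y \<le> q k y z"
        using low[OF z, of k x] unfolding q_def by (simp add: algebra_simps)
    qed
    then show ?thesis by simp
  qed
  show ?thesis
  proof (rule that[of f])
    show "0 \<le> f k x" if "x \<in> M" for k x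
      using q0 by (intro great[OF that])
    show "f k x \<le> h x" "f k x \<le> real k" if "x \<in> M" for k x
      using diag[OF that, of k] by auto
    show "\<bar>f k x - f k y\<bar> \<le> real k * d x y" if "x \<in> M" "y \<in> M" for k x y
      using lip[OF that, of k] lip[OF that(2,1), of k] by (simp add: commute abs_le_iff)
    show "incseq (\<lambda>k. f k x)" if "x \<in> M" for x
      using inc[OF that] by (auto intro: incseq_SucI)
    show "(\<lambda>k. f k x) \<longlonglongrightarrow> h x" if x: "x \<in> M" for x
    proof (rule LIMSEQ_I)
      fix e :: real assume e: "e > 0"
      define a where "a = h x - e / 2"
      obtain r where r: "r > 0" "\<And>y. y \<in> M \<Longrightarrow> d x y < r \<Longrightarrow> a < h y"
        using lsc[OF x, of a] e by (auto simp: a_def)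
      \<comment> \<open>Two lower bounds are arranged for all k from \<open>n\<close> on: if
        \<open>y\<close> is within \<open>r\<close> of \<open>x\<close>, then
        \<open>min (h y) (real k)\<close> is at least \<open>a\<close>; otherwise the penalty
        \<open>real k * d x y\<close> is at least \<open>real k * r\<close>, hence at least
        \<open>a\<close>.\<close>
      obtain n :: nat where n: "max a (a / r) < real n" using reals_Archimedean2 by blast
      have "norm (f k x - h x) < e" if "k \<ge> n" for k
      proof -
        have k: "real k \<ge> a" "real k * r \<ge> a"
        proof -
          have "real n \<le> real k" using that by simp
          then show "real k \<ge> a" using n by simp
          have "a / r \<le> real k" using n \<open>real n \<le> real k\<close> by simp
          then show "real k * r \<ge> a" using r(1) by (simp add: field_simps)
        qed
        have "a \<le> f k x"
        proof (rule great[OF x])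
          fix y assume y: "y \<in> M"
          show "a \<le> q k x y"
          proof (cases "d x y < r")
            case True
            then have "a \<le> min (h y) (real k)" using r(2)[OF y True] k by simp
            then show ?thesis unfolding q_def by (smt (verit) mult_nonneg_nonneg nonneg of_nat_0_le_iff)
          next
            case False
            then have "real k * r \<le> real k * d x y" by (intro mult_left_mono) auto
            moreover have "0 \<le> min (h y) (real k)" using h0[OF y] by simp
            ultimately show ?thesis using k unfolding q_def by linarith
          qed
        qed
        then show ?thesis using diag[OF x, of k] e unfolding a_def by (auto simp: abs_if)
      qed
      then show "\<exists>n. \<forall>k\<ge>n. norm (f k x - h x) < e" by blast
    qed
  qed
qed

lemma lipschitz_imp_continuous_map:
  fixes f :: "'a \<Rightarrow> real"
  assumes "Metric_space M d" "\<And>x y. x \<in> M \<Longrightarrow> y \<in> M \<Longrightarrow> \<bar>f x - f y\<bar> \<le> K * d x y"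
  shows "continuous_map (Metric_space.mtopology M d) euclideanreal f"
proof -
  interpret Metric_space M d by fact
  have "continuous_map mtopology Met_TC.mtopology f"
    unfolding Met_TC.continuous_map_to_metric
  proof (intro ballI allI impI)
    fix x and e :: real assume x: "x \<in> topspace mtopology" and e: "e > 0"
    have xM: "x \<in> M" using x by simp
    \<comment> \<open>The absolute value and the added 1 keep the radius positive whatever the sign
      of \<open>K\<close>.\<close>
    define r where "r = e / (\<bar>K\<bar> + 1)"
    have r: "r > 0" using e by (simp add: r_def)
    have "\<bar>f x - f y\<bar> < e" if y: "y \<in> M" "d x y < r" for y
    proof -
      have "K * d x y \<le> \<bar>K\<bar> * d x y" by (intro mult_right_mono) auto
      also have "\<dots> \<le> \<bar>K\<bar> * r" using y by (intro mult_left_mono) auto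
      also have "\<dots> < e" using e by (simp add: r_def field_simps)
      finally show ?thesis using assms(2)[OF xM y(1)] by simp
    qed
    then show "\<exists>U. openin mtopology U \<and> x \<in> U \<and> (\<forall>y\<in>U. f y \<in> Met_TC.mball (f x) e)"
      using r xM by (intro exI[of _ "mball x r"]) (auto simp: dist_real_def)
  qed
  then show ?thesis by simp
qed

text \<open>The bound holds at every point instead of almost everywhere, so the notion depends only
  on the \<sigma>-algebra. The same function can then be used under a marginal, on its Borel space
  or, after composition, under a coupling without tracking null sets.\<close>

definition bdd_meas :: "'a measure \<Rightarrow> ('a \<Rightarrow> real) \<Rightarrow> bool" where
  "bdd_meas M f \<longleftrightarrow> f \<in> borel_measurable M \<and> (\<exists>K. \<forall>x\<in>space M. \<bar>f x\<bar> \<le> K)"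

lemma bdd_measI: "f \<in> borel_measurable M \<Longrightarrow> (\<And>x. x \<in> space M \<Longrightarrow> \<bar>f x\<bar> \<le> K) \<Longrightarrow> bdd_meas M f"
  unfolding bdd_meas_def by blast

lemma bdd_meas_measurable: "bdd_meas M f \<Longrightarrow> f \<in> borel_measurable M"
  unfolding bdd_meas_def by blast

lemma bdd_meas_bound:
  assumes "bdd_meas M f"
  obtains K where "K \<ge> 0" "\<And>x. x \<in> space M \<Longrightarrow> \<bar>f x\<bar> \<le> K"
proof -
  from assms obtain K where "\<forall>x\<in>space M. \<bar>f x\<bar> \<le> K" unfolding bdd_meas_def by blast
  then have "\<bar>f x\<bar> \<le> \<bar>K\<bar>" if "x \<in> space M" for x using that by fastforce
  then show thesis using that[of "\<bar>K\<bar>"] by simp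
qed

lemma bdd_meas_integrable: "finite_measure M \<Longrightarrow> bdd_meas M f \<Longrightarrow> integrable M f"
  unfolding bdd_meas_def using finite_measure.integrable_const_bound[of M f] by (auto intro!: AE_I2)

lemma bdd_meas_const [simp]: "bdd_meas M (\<lambda>x. c)"
  by (rule bdd_measI[of _ _ "\<bar>c\<bar>"]) auto

lemma bdd_meas_indicator: "A \<in> sets M \<Longrightarrow> bdd_meas M (indicator A)"
  by (rule bdd_measI[of _ _ 1]) (auto simp: indicator_def)

lemma bdd_meas_mult:
  assumes "bdd_meas M f" "bdd_meas M g"
  shows "bdd_meas M (\<lambda>x. f x * g x)"
proof -
  obtain K L where K: "K \<ge> 0" "\<And>x. x \<in> space M \<Longrightarrow> \<bar>f x\<bar> \<le> K"
    and L: "L \<ge> 0" "\<And>x. x \<in> space M \<Longrightarrow> \<bar>g x\<bar> \<le> L"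
    using bdd_meas_bound[OF assms(1)] bdd_meas_bound[OF assms(2)] by metis
  show ?thesis
    using K L assms[THEN bdd_meas_measurable]
    by (intro bdd_measI[of _ _ "K * L"] borel_measurable_times)
      (auto simp: abs_mult intro!: mult_mono)
qed

lemma bdd_meas_add:
  assumes "bdd_meas M f" "bdd_meas M g"
  shows "bdd_meas M (\<lambda>x. f x + g x)"
proof -
  obtain K L where K: "K \<ge> 0" "\<And>x. x \<in> space M \<Longrightarrow> \<bar>f x\<bar> \<le> K"
    and L: "L \<ge> 0" "\<And>x. x \<in> space M \<Longrightarrow> \<bar>g x\<bar> \<le> L"
    using bdd_meas_bound[OF assms(1)] bdd_meas_bound[OF assms(2)] by metis
  have "\<bar>f x + g x\<bar> \<le> K + L" if "x \<in> space M" for x using K(2)[OF that] L(2)[OF that] by linarith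
  then show ?thesis
    using assms[THEN bdd_meas_measurable]
    by (intro bdd_measI[of _ _ "K + L"] borel_measurable_add) auto
qed

lemma bdd_meas_diff:
  assumes "bdd_meas M f" "bdd_meas M g"
  shows "bdd_meas M (\<lambda>x. f x - g x)"
  using bdd_meas_add[OF assms(1) bdd_meas_mult[OF bdd_meas_const[of M "-1"] assms(2)]] by simp

lemma bdd_meas_sum:
  assumes "\<And>i. i \<in> I \<Longrightarrow> bdd_meas M (f i)"
  shows "bdd_meas M (\<lambda>x. \<Sum>i\<in>I. f i x)"
  using assms by (induction I rule: infinite_finite_induct) (auto intro!: bdd_meas_add)

lemma bdd_meas_comp:
  assumes "bdd_meas N f" "g \<in> M \<rightarrow>\<^sub>M N"
  shows "bdd_meas M (\<lambda>x. f (g x))"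
proof -
  obtain K where K: "\<And>x. x \<in> space N \<Longrightarrow> \<bar>f x\<bar> \<le> K" using bdd_meas_bound[OF assms(1)] by metis
  have "(\<lambda>x. f (g x)) \<in> borel_measurable M"
    using measurable_compose[OF assms(2) bdd_meas_measurable[OF assms(1)]] .
  then show ?thesis
    using K measurable_space[OF assms(2)] by (intro bdd_measI[of _ _ K]) auto
qed

lemma bdd_meas_mono:
  assumes "bdd_meas F f" "sets F \<subseteq> sets M" "space F = space M"
  shows "bdd_meas M f"
proof -
  have "(\<lambda>x. x) \<in> M \<rightarrow>\<^sub>M F"
    using assms(2,3) by (intro measurableI) (auto simp: subset_eq)
  from bdd_meas_comp[OF assms(1) this] show ?thesis by simp
qed

lemma bdd_meas_cong_sets: "sets M = sets N \<Longrightarrow> bdd_meas M f \<longleftrightarrow> bdd_meas N f"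
  unfolding bdd_meas_def using measurable_cong_sets[of M N borel borel] sets_eq_imp_space_eq[of M N] by auto

lemma continuous_map_bdd_meas:
  assumes "sets M = sets (borel_of T)" "continuous_map T euclideanreal g" "bounded (g ` topspace T)"
  shows "bdd_meas M g"
proof -
  obtain K where "\<And>x. x \<in> topspace T \<Longrightarrow> \<bar>g x\<bar> \<le> K"
    using assms(3) unfolding bounded_iff by auto
  then have "bdd_meas (borel_of T) g"
    using continuous_map_borel_measurable[OF assms(2)] by (intro bdd_measI[of _ _ K]) auto
  then show ?thesis using bdd_meas_cong_sets[OF assms(1)] by simp
qed

text \<open>The indicator of an open set is lower semicontinuous, so its inf-convolutions increase
  to it; being Lipschitz, they are continuous.\<close>

lemma indicator_open_approximation:
  assumes "metrizable_space T" "openin T U"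
  obtains f :: "nat \<Rightarrow> 'a \<Rightarrow> real" where
    "\<And>k. continuous_map T euclideanreal (f k)" "\<And>k x. x \<in> topspace T \<Longrightarrow> 0 \<le> f k x"
    "\<And>k x. x \<in> topspace T \<Longrightarrow> f k x \<le> indicator U x"
    "\<And>x. x \<in> topspace T \<Longrightarrow> (\<lambda>k. f k x) \<longlonglongrightarrow> indicator U x"
proof -
  obtain M d where M: "Metric_space M d" and T: "T = Metric_space.mtopology M d"
    using assms(1) unfolding metrizable_space_def by auto
  interpret Metric_space M d by fact
  have lsc: "\<exists>r>0. \<forall>y\<in>M. d x y < r \<longrightarrow> a < indicator U y"
    if x: "x \<in> M" and a: "a < (indicator U x :: real)" for x and a :: real
  proof (cases "x \<in> U")
    case True
    then obtain r where r: "r > 0" "mball x r \<subseteq> U"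
      using assms(2) unfolding T openin_mtopology by blast
    have "a < indicator U y" if "y \<in> M" "d x y < r" for y
    proof -
      have "y \<in> U" using that r x by auto
      then show ?thesis using a True by simp
    qed
    then show ?thesis using r by blast
  next
    case False
    then have "a < 0" using a by simp
    then have "a < indicator U y" for y by (simp add: indicator_def)
    then show ?thesis using zero_less_one by blast
  qed
  show ?thesis
  proof (rule lipschitz_approximation_from_below[OF M, of "indicator U"])
    show "0 \<le> (indicator U x :: real)" for x by simp
    fix x and a :: real assume "x \<in> M" "a < indicator U x"
    then show "\<exists>r>0. \<forall>y\<in>M. d x y < r \<longrightarrow> a < indicator U y" by (rule lsc)
  next
    fix f :: "nat \<Rightarrow> 'a \<Rightarrow> real"
    assume f: "\<And>k x. x \<in> M \<Longrightarrow> 0 \<le> f k x" "\<And>k x. x \<in> M \<Longrightarrow> f k x \<le> indicator U x"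
      "\<And>k x y. x \<in> M \<Longrightarrow> y \<in> M \<Longrightarrow> \<bar>f k x - f k y\<bar> \<le> real k * d x y"
      "\<And>x. x \<in> M \<Longrightarrow> (\<lambda>k. f k x) \<longlonglongrightarrow> indicator U x"
    show ?thesis
    proof (rule that[of f])
      show "continuous_map T euclideanreal (f k)" for k
        unfolding T by (rule lipschitz_imp_continuous_map[OF M f(3)])
    qed (use f T in simp_all)
  qed
qed

text \<open>Open sets form an intersection-stable generator, and their indicators are dominated
  limits of continuous functions. This identifies the marginals of a weak limit.\<close>

lemma measure_eqI_continuous:
  assumes T: "metrizable_space T" and P: "prob_space P" "sets P = sets (borel_of T)"
    and Q: "prob_space Q" "sets Q = sets (borel_of T)"
    and eq: "\<And>g. continuous_map T euclideanreal g \<Longrightarrow> bounded (g ` topspace T) \<Longrightarrow>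
      integral\<^sup>L P g = integral\<^sup>L Q g"
  shows "P = Q"
proof (rule measure_eqI_generator_eq[where E="{U. openin T U}" and \<Omega>="topspace T" and A="\<lambda>_. topspace T"])
  interpret P: prob_space P by fact
  interpret Q: prob_space Q by fact
  have sp: "space P = topspace T" "space Q = topspace T"
    using sets_eq_imp_space_eq[OF P(2)] sets_eq_imp_space_eq[OF Q(2)] by auto
  show "Int_stable {U. openin T U}" by (auto simp: Int_stable_def)
  show "{U. openin T U} \<subseteq> Pow (topspace T)" by (auto dest: openin_subset)
  show "sets P = sigma_sets (topspace T) {U. openin T U}" "sets Q = sigma_sets (topspace T) {U. openin T U}"
    using P Q by (auto simp: sets_borel_of)
  show "emeasure P (topspace T) \<noteq> \<infinity>" for i :: nat
    using P.emeasure_finite by simp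
  show "range (\<lambda>_::nat. topspace T) \<subseteq> {U. openin T U}" by auto
  fix U assume "U \<in> {U. openin T U}"
  then have U: "openin T U" by simp
  obtain f :: "nat \<Rightarrow> 'a \<Rightarrow> real" where f:
    "\<And>k. continuous_map T euclideanreal (f k)" "\<And>k x. x \<in> topspace T \<Longrightarrow> 0 \<le> f k x"
    "\<And>k x. x \<in> topspace T \<Longrightarrow> f k x \<le> indicator U x"
    "\<And>x. x \<in> topspace T \<Longrightarrow> (\<lambda>k. f k x) \<longlonglongrightarrow> indicator U x"
    using indicator_open_approximation[OF T U] by metis
  have f1: "\<bar>f k x\<bar> \<le> 1" if "x \<in> topspace T" for k x
    using f(2,3)[OF that, of k] indicator_le_1[of U x]
    by (smt (verit))
  have bnd: "bounded (f k ` topspace T)" for k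
    using f1 by (auto simp: bounded_iff)
  have lim: "(\<lambda>k. integral\<^sup>L R (f k)) \<longlonglongrightarrow> measure R U"
    if R: "prob_space R" "sets R = sets (borel_of T)" for R
  proof -
    interpret R: prob_space R by fact
    have spR: "space R = topspace T" using sets_eq_imp_space_eq[OF R(2)] by simp
    have U': "U \<in> sets R" using openin_sets_borel_of[OF U] R by simp
    have "(\<lambda>k. integral\<^sup>L R (f k)) \<longlonglongrightarrow> integral\<^sup>L R (indicator U)"
    proof (rule integral_dominated_convergence[where w="\<lambda>_. 1"])
      show "f k \<in> borel_measurable R" for k
        using continuous_map_bdd_meas[OF R(2) f(1) bnd] by (rule bdd_meas_measurable)
      show "(indicator U :: 'a \<Rightarrow> real) \<in> borel_measurable R" using U' by simp
    qed (use f(4) f1 spR in auto)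
    then show ?thesis using U' sets.sets_into_space[OF U'] by (simp add: Int_absorb2)
  qed
  have "measure P U = measure Q U"
    using LIMSEQ_unique[OF lim[OF P]] lim[OF Q] eq[OF f(1) bnd] by simp
  then show "emeasure P U = emeasure Q U"
    by (simp add: P.emeasure_eq_measure Q.emeasure_eq_measure)
qed auto

section \<open>Density of continuous functions and orthogonality to a sub-algebra\<close>

text \<open>The Bochner integral returns 0 for non-integrable functions, so this is a genuine L1
  statement only for integrable \<open>f\<close>; integrability is supplied separately
  below.\<close>

definition L1_approximable :: "'a topology \<Rightarrow> 'a measure \<Rightarrow> ('a \<Rightarrow> real) \<Rightarrow> bool" where
  "L1_approximable T M f \<longleftrightarrow> (\<forall>e>0. \<exists>g. continuous_map T euclideanreal g \<and> bounded (g ` topspace T) \<and>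
     (\<integral>x. \<bar>f x - g x\<bar> \<partial>M) < e)"

lemma bounded_image_add:
  fixes f g :: "'a \<Rightarrow> real"
  assumes "bounded (f ` S)" "bounded (g ` S)"
  shows "bounded ((\<lambda>x. f x + g x) ` S)"
proof -
  obtain a b where a: "\<forall>x\<in>S. \<bar>f x\<bar> \<le> a" and b: "\<forall>x\<in>S. \<bar>g x\<bar> \<le> b"
    using assms unfolding bounded_iff by auto
  have "\<bar>f x + g x\<bar> \<le> a + b" if "x \<in> S" for x
    using a[rule_format, OF that] b[rule_format, OF that] by linarith
  then show ?thesis unfolding bounded_iff by (intro exI[of _ "a + b"]) auto
qed

lemma bounded_image_mult:
  fixes f g :: "'a \<Rightarrow> real"
  assumes "bounded (f ` S)" "bounded (g ` S)"
  shows "bounded ((\<lambda>x. f x * g x) ` S)"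
proof -
  obtain a b where a: "\<forall>x\<in>S. \<bar>f x\<bar> \<le> a" and b: "\<forall>x\<in>S. \<bar>g x\<bar> \<le> b"
    using assms unfolding bounded_iff by auto
  have "\<bar>f x * g x\<bar> \<le> a * b" if "x \<in> S" for x
    unfolding abs_mult using a[rule_format, OF that] b[rule_format, OF that] by (intro mult_mono) auto
  then show ?thesis unfolding bounded_iff by (intro exI[of _ "a * b"]) auto
qed

context
  fixes T :: "'a topology" and M :: "'a measure"
  assumes T: "metrizable_space T" and M: "finite_measure M" "sets M = sets (borel_of T)"
begin

interpretation finite_measure M by (rule M)

lemma space_eq_topspace: "space M = topspace T"
  using sets_eq_imp_space_eq[OF M(2)] by simp

lemma integrable_bounded_continuous:
  "continuous_map T euclideanreal g \<Longrightarrow> bounded (g ` topspace T) \<Longrightarrow> integrable M g"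
  using continuous_map_bdd_meas[OF M(2)] bdd_meas_integrable[OF M(1)] by blast

lemma L1_approximable_add:
  assumes f: "integrable M f" "L1_approximable T M f" and g: "integrable M g" "L1_approximable T M g"
  shows "L1_approximable T M (\<lambda>x. f x + g x)"
  unfolding L1_approximable_def
proof (intro allI impI)
  fix e :: real assume "e > 0"
  then have e: "e / 2 > 0" by simp
  obtain f' where f': "continuous_map T euclideanreal f'" "bounded (f' ` topspace T)"
    "(\<integral>x. \<bar>f x - f' x\<bar> \<partial>M) < e / 2" using f(2) e unfolding L1_approximable_def by blast
  obtain g' where g': "continuous_map T euclideanreal g'" "bounded (g' ` topspace T)"
    "(\<integral>x. \<bar>g x - g' x\<bar> \<partial>M) < e / 2" using g(2) e unfolding L1_approximable_def by blast
  have i: "integrable M f'" "integrable M g'" using f' g' by (auto intro: integrable_bounded_continuous)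
  have "(\<integral>x. \<bar>(f x + g x) - (f' x + g' x)\<bar> \<partial>M) \<le> (\<integral>x. \<bar>f x - f' x\<bar> + \<bar>g x - g' x\<bar> \<partial>M)"
    using f(1) g(1) i by (intro integral_mono) auto
  also have "\<dots> = (\<integral>x. \<bar>f x - f' x\<bar> \<partial>M) + (\<integral>x. \<bar>g x - g' x\<bar> \<partial>M)"
    using f(1) g(1) i by (intro Bochner_Integration.integral_add) auto
  also have "\<dots> < e" using f'(3) g'(3) by simp
  finally have "(\<integral>x. \<bar>(f x + g x) - (f' x + g' x)\<bar> \<partial>M) < e" .
  moreover have "continuous_map T euclideanreal (\<lambda>x. f' x + g' x)"
    using f'(1) g'(1) by (rule continuous_map_add)
  moreover have "bounded ((\<lambda>x. f' x + g' x) ` topspace T)"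
    using f'(2) g'(2) by (rule bounded_image_add)
  ultimately show "\<exists>h. continuous_map T euclideanreal h \<and> bounded (h ` topspace T) \<and>
     (\<integral>x. \<bar>(f x + g x) - h x\<bar> \<partial>M) < e" by blast
qed

lemma L1_approximable_cmult:
  assumes f: "integrable M f" "L1_approximable T M f"
  shows "L1_approximable T M (\<lambda>x. c * f x)"
  unfolding L1_approximable_def
proof (intro allI impI)
  fix e :: real assume "e > 0"
  then have e: "e / (\<bar>c\<bar> + 1) > 0" by simp
  obtain f' where f': "continuous_map T euclideanreal f'" "bounded (f' ` topspace T)"
    "(\<integral>x. \<bar>f x - f' x\<bar> \<partial>M) < e / (\<bar>c\<bar> + 1)" using f(2) e unfolding L1_approximable_def by blast
  have "(\<integral>x. \<bar>c * f x - c * f' x\<bar> \<partial>M) = \<bar>c\<bar> * (\<integral>x. \<bar>f x - f' x\<bar> \<partial>M)"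
    by (simp add: abs_mult flip: right_diff_distrib)
  also have "\<dots> \<le> \<bar>c\<bar> * (e / (\<bar>c\<bar> + 1))" using f'(3) by (intro mult_left_mono) auto
  also have "\<dots> < e" using \<open>e > 0\<close> by (simp add: field_simps)
  finally have "(\<integral>x. \<bar>c * f x - c * f' x\<bar> \<partial>M) < e" .
  moreover have "continuous_map T euclideanreal (\<lambda>x. c * f' x)"
    using f'(1) by (intro continuous_map_real_mult) auto
  moreover have "bounded ((\<lambda>x. c * f' x) ` topspace T)"
    by (rule bounded_image_mult[OF _ f'(2)]) (auto simp: bounded_iff)
  ultimately show "\<exists>h. continuous_map T euclideanreal h \<and> bounded (h ` topspace T) \<and>
     (\<integral>x. \<bar>c * f x - h x\<bar> \<partial>M) < e" by blast
qed

lemma L1_approximable_limit: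
  assumes "\<And>e. e > 0 \<Longrightarrow> \<exists>g. integrable M g \<and> L1_approximable T M g \<and> (\<integral>x. \<bar>f x - g x\<bar> \<partial>M) < e"
    and f: "integrable M f"
  shows "L1_approximable T M f"
  unfolding L1_approximable_def
proof (intro allI impI)
  fix e :: real assume "e > 0"
  then have e: "e / 2 > 0" by simp
  obtain g where g: "integrable M g" "L1_approximable T M g" "(\<integral>x. \<bar>f x - g x\<bar> \<partial>M) < e / 2"
    using assms(1)[OF e] by blast
  obtain g' where g': "continuous_map T euclideanreal g'" "bounded (g' ` topspace T)"
    "(\<integral>x. \<bar>g x - g' x\<bar> \<partial>M) < e / 2" using g(2) e unfolding L1_approximable_def by blast
  have i: "integrable M g'" using g' by (auto intro: integrable_bounded_continuous)
  have "(\<integral>x. \<bar>f x - g' x\<bar> \<partial>M) \<le> (\<integral>x. \<bar>f x - g x\<bar> + \<bar>g x - g' x\<bar> \<partial>M)"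
    using f g(1) i by (intro integral_mono) auto
  also have "\<dots> = (\<integral>x. \<bar>f x - g x\<bar> \<partial>M) + (\<integral>x. \<bar>g x - g' x\<bar> \<partial>M)"
    using f g(1) i by (intro Bochner_Integration.integral_add) auto
  also have "\<dots> < e" using g(3) g'(3) by simp
  finally show "\<exists>h. continuous_map T euclideanreal h \<and> bounded (h ` topspace T) \<and>
     (\<integral>x. \<bar>f x - h x\<bar> \<partial>M) < e" using g'(1,2) by blast
qed

text \<open>The approximable sets contain the open sets and are closed under complements and
  countable disjoint unions, so Dynkin's theorem yields all Borel sets.\<close>

lemma L1_approximable_indicator:
  assumes "A \<in> sets M"
  shows "L1_approximable T M (indicator A)"
proof -
  have int: "integrable M (indicator A :: 'a \<Rightarrow> real)" if "A \<in> sets M" for A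
    using bdd_meas_integrable[OF M(1) bdd_meas_indicator[OF that]] .
  have "Int_stable {U. openin T U}" "{U. openin T U} \<subseteq> Pow (topspace T)"
    by (auto simp: Int_stable_def dest: openin_subset)
  moreover have "A \<in> sigma_sets (topspace T) {U. openin T U}"
    using assms M(2) by (simp add: sets_borel_of)
  ultimately show ?thesis
  proof (induction rule: sigma_sets_induct_disjoint)
    case (basic U)
    then have U: "openin T U" by simp
    have U': "U \<in> sets M" using openin_sets_borel_of[OF U] M by simp
    show ?case
    proof (rule indicator_open_approximation[OF T U])
      fix f :: "nat \<Rightarrow> 'a \<Rightarrow> real"
      assume f: "\<And>k. continuous_map T euclideanreal (f k)" "\<And>k x. x \<in> topspace T \<Longrightarrow> 0 \<le> f k x"
        "\<And>k x. x \<in> topspace T \<Longrightarrow> f k x \<le> indicator U x"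
        "\<And>x. x \<in> topspace T \<Longrightarrow> (\<lambda>k. f k x) \<longlonglongrightarrow> indicator U x"
      have f1: "\<bar>f k x\<bar> \<le> 1" "\<bar>indicator U x - f k x\<bar> \<le> 1" if "x \<in> topspace T" for k x
        using f(2,3)[OF that, of k] indicator_le_1[of U x] by (smt (verit))+
      have bnd: "bounded (f k ` topspace T)" for k
        using f1(1) by (auto simp: bounded_iff)
      have "(\<lambda>k. \<integral>x. \<bar>indicator U x - f k x\<bar> \<partial>M) \<longlonglongrightarrow> (\<integral>x. 0 \<partial>M)"
      proof (rule integral_dominated_convergence[where w="\<lambda>_. 1"])
        show "(\<lambda>x. \<bar>indicator U x - f k x\<bar>) \<in> borel_measurable M" for k
          using bdd_meas_measurable[OF continuous_map_bdd_meas[OF M(2) f(1) bnd]] U' by auto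
        show "AE x in M. (\<lambda>k. \<bar>indicator U x - f k x\<bar>) \<longlonglongrightarrow> 0"
        proof (rule AE_I2)
          fix x assume "x \<in> space M"
          then have "(\<lambda>k. f k x) \<longlonglongrightarrow> indicator U x" using f(4) space_eq_topspace by simp
          then have "(\<lambda>k. \<bar>indicator U x - f k x\<bar>) \<longlonglongrightarrow> \<bar>indicator U x - indicator U x\<bar>"
            by (intro tendsto_intros)
          then show "(\<lambda>k. \<bar>indicator U x - f k x\<bar>) \<longlonglongrightarrow> 0" by simp
        qed
        show "AE x in M. norm \<bar>indicator U x - f k x\<bar> \<le> 1" for k
          using f1(2) space_eq_topspace by (intro AE_I2) simp
      qed auto
      then have lim: "(\<lambda>k. \<integral>x. \<bar>indicator U x - f k x\<bar> \<partial>M) \<longlonglongrightarrow> 0" by simp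
      show ?case unfolding L1_approximable_def
      proof (intro allI impI)
        fix e :: real assume "e > 0"
        then obtain k where "(\<integral>x. \<bar>indicator U x - f k x\<bar> \<partial>M) < e"
          using order_tendstoD(2)[OF lim] by (auto simp: eventually_sequentially)
        then show "\<exists>g. continuous_map T euclideanreal g \<and> bounded (g ` topspace T) \<and>
            (\<integral>x. \<bar>indicator U x - g x\<bar> \<partial>M) < e"
          using f(1) bnd by blast
      qed
    qed
  next
    case empty
    show ?case unfolding L1_approximable_def
      by (intro allI impI exI[of _ "\<lambda>_. 0"]) (auto simp: bounded_iff)
  next
    case (compl A)
    have A: "A \<in> sets M" using compl(1) M(2) by (simp add: sets_borel_of)
    have one: "L1_approximable T M (\<lambda>x. 1)"
      unfolding L1_approximable_def by (intro allI impI exI[of _ "\<lambda>_. 1"]) (auto simp: bounded_iff)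
    have "L1_approximable T M (\<lambda>x. 1 + (-1) * indicator A x)"
      using A compl(2) one by (intro L1_approximable_add L1_approximable_cmult)
        (auto intro: int)
    moreover have "(\<integral>x. \<bar>indicator (topspace T - A) x - g x\<bar> \<partial>M) = (\<integral>x. \<bar>(1 + (-1) * indicator A x) - g x\<bar> \<partial>M)" for g :: "'a \<Rightarrow> real"
      using space_eq_topspace by (intro Bochner_Integration.integral_cong) (auto simp: indicator_def)
    ultimately show ?case unfolding L1_approximable_def by simp
  next
    case (union A)
    have A: "\<And>i. A i \<in> sets M" using union(2) M(2) by (auto simp: sets_borel_of)
    have fin: "L1_approximable T M (\<lambda>x. \<Sum>i<n. indicator (A i) x)" for n :: nat
    proof (induction n)
      case 0
      show ?case unfolding L1_approximable_def
        by (intro allI impI exI[of _ "\<lambda>_. 0"]) (auto simp: bounded_iff)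
    next
      case (Suc n)
      show ?case unfolding sum.lessThan_Suc
        using A union(3) Suc by (intro L1_approximable_add Bochner_Integration.integrable_sum int)
    qed
    have "(\<lambda>n. \<integral>x. \<bar>indicator (\<Union>i. A i) x - (\<Sum>i<n. indicator (A i) x :: real)\<bar> \<partial>M) \<longlonglongrightarrow> (\<integral>x. 0 \<partial>M)"
    proof (rule integral_dominated_convergence[where w="\<lambda>_. 1"])
      \<comment> \<open>Disjointness turns the partial sums into indicators of partial unions, which
        are bounded by 1 uniformly in \<open>n\<close>.\<close>
      have eq: "(\<Sum>i<n. indicator (A i) x :: real) = indicator (\<Union>i<n. A i) x" for n x
        using union(1) by (intro indicator_UN_disjoint[symmetric]) (auto simp: disjoint_family_on_def)
      show "AE x in M. (\<lambda>n. \<bar>indicator (\<Union>i. A i) x - (\<Sum>i<n. indicator (A i) x :: real)\<bar>) \<longlonglongrightarrow> 0"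
      proof (rule AE_I2)
        fix x
        have "(\<lambda>n. indicator (\<Union>i<n. A i) x :: real) \<longlonglongrightarrow> indicator (\<Union>i. A i) x"
          by (rule LIMSEQ_indicator_UN)
        then have "(\<lambda>n. \<bar>indicator (\<Union>i. A i) x - indicator (\<Union>i<n. A i) x :: real\<bar>) \<longlonglongrightarrow>
            \<bar>indicator (\<Union>i. A i) x - indicator (\<Union>i. A i) x\<bar>"
          by (intro tendsto_intros)
        then show "(\<lambda>n. \<bar>indicator (\<Union>i. A i) x - (\<Sum>i<n. indicator (A i) x) :: real\<bar>) \<longlonglongrightarrow> 0"
          unfolding eq by simp
      qed
      show "AE x in M. norm \<bar>indicator (\<Union>i. A i) x - (\<Sum>i<n. indicator (A i) x :: real)\<bar> \<le> 1" for n
        unfolding eq by (intro AE_I2) (auto simp: indicator_def)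
    qed (use A in auto)
    then have lim: "(\<lambda>n. \<integral>x. \<bar>indicator (\<Union>i. A i) x - (\<Sum>i<n. indicator (A i) x :: real)\<bar> \<partial>M) \<longlonglongrightarrow> 0" by simp
    show ?case
    proof (rule L1_approximable_limit)
      fix e :: real assume "e > 0"
      then obtain n where "(\<integral>x. \<bar>indicator (\<Union>i. A i) x - (\<Sum>i<n. indicator (A i) x :: real)\<bar> \<partial>M) < e"
        using order_tendstoD(2)[OF lim] by (auto simp: eventually_sequentially)
      moreover have "integrable M (\<lambda>x. \<Sum>i<n. indicator (A i) x :: real)"
        using A by (intro Bochner_Integration.integrable_sum int)
      ultimately show "\<exists>g. integrable M g \<and> L1_approximable T M g \<and>
          (\<integral>x. \<bar>indicator (\<Union>i. A i) x - g x\<bar> \<partial>M) < e"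
        using fin[of n] by (intro exI conjI)
    next
      show "integrable M (indicator (\<Union>i. A i) :: _ \<Rightarrow> real)"
        using A by (intro int) auto
    qed
  qed
qed

text \<open>Density of the bounded continuous functions in L1, passing from indicators to simple
  functions to limits. It later replaces measurable test functions by continuous ones, which weak
  convergence can see.\<close>

lemma integrable_L1_approximable:
  "integrable M f \<Longrightarrow> L1_approximable T M f"
proof (induction rule: integrable_induct)
  case (base A c)
  then show ?case
    using L1_approximable_cmult[OF _ L1_approximable_indicator[OF base(1)], of c]
    by (simp add: mult.commute)
next
  case (add f g)
  then show ?case by (intro L1_approximable_add)
next
  case (lim f s)
  have "(\<lambda>i. \<integral>x. \<bar>f x - s i x\<bar> \<partial>M) \<longlonglongrightarrow> (\<integral>x. 0 \<partial>M)"
  \<comment> \<open>The approximating simple functions satisfy |s| \<le> 2 |f|, whence the factor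
    3.\<close>
  proof (rule integral_dominated_convergence[where w="\<lambda>x. 3 * \<bar>f x\<bar>"])
    show "AE x in M. (\<lambda>i. \<bar>f x - s i x\<bar>) \<longlonglongrightarrow> 0"
    proof (rule AE_I2)
      fix x assume "x \<in> space M"
      then have "(\<lambda>i. \<bar>f x - s i x\<bar>) \<longlonglongrightarrow> \<bar>f x - f x\<bar>"
        using lim.hyps(2) by (intro tendsto_intros) auto
      then show "(\<lambda>i. \<bar>f x - s i x\<bar>) \<longlonglongrightarrow> 0" by simp
    qed
    show "AE x in M. norm \<bar>f x - s i x\<bar> \<le> 3 * \<bar>f x\<bar>" for i
    proof (rule AE_I2)
      fix x assume "x \<in> space M"
      then show "norm \<bar>f x - s i x\<bar> \<le> 3 * \<bar>f x\<bar>" using lim.hyps(3)[of x i] by simp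
    qed
  qed (use lim.hyps(1,4) in auto)
  then have li: "(\<lambda>i. \<integral>x. \<bar>f x - s i x\<bar> \<partial>M) \<longlonglongrightarrow> 0" by simp
  show ?case
  proof (rule L1_approximable_limit[OF _ lim.hyps(4)])
    fix e :: real assume "e > 0"
    then obtain i where "(\<integral>x. \<bar>f x - s i x\<bar> \<partial>M) < e"
      using order_tendstoD(2)[OF li] by (auto simp: eventually_sequentially)
    then show "\<exists>g. integrable M g \<and> L1_approximable T M g \<and> (\<integral>x. \<bar>f x - g x\<bar> \<partial>M) < e"
      using lim.hyps(1) lim.IH by blast
  qed
qed

end

text \<open>For integrable \<open>f\<close> this says E[f | F] = 0. Testing with indicators only
  makes it verifiable on a generator; bounded test functions follow in
  \<open>orthogonal_to_integral_0\<close>.\<close>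

definition orthogonal_to :: "'a measure \<Rightarrow> 'a measure \<Rightarrow> ('a \<Rightarrow> real) \<Rightarrow> bool" where
  "orthogonal_to M F f \<longleftrightarrow> (\<forall>C\<in>sets F. (\<integral>x. indicator C x * f x \<partial>M) = 0)"

lemma subalgebra_bdd_meas: "subalgebra M F \<Longrightarrow> bdd_meas F f \<Longrightarrow> bdd_meas M f"
  unfolding subalgebra_def using bdd_meas_mono by auto

text \<open>The conditional expectation E[f | F] vanishes almost everywhere, and the bounded
  \<open>F\<close>-measurable factor can be pulled out of it.\<close>

lemma orthogonal_to_integral_0:
  assumes M: "finite_measure M" "subalgebra M F" and f: "integrable M f" "orthogonal_to M F f"
    and a: "bdd_meas F a"
  shows "(\<integral>x. a x * f x \<partial>M) = 0"
proof -
  interpret finite_measure_subalgebra M F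
    using M by (auto simp: finite_measure_subalgebra_def finite_measure_subalgebra_axioms_def)
  have am: "a \<in> borel_measurable F" "a \<in> borel_measurable M"
    using a subalgebra_bdd_meas[OF M(2) a] by (auto intro: bdd_meas_measurable)
  obtain K where K: "K \<ge> 0" "\<And>x. x \<in> space F \<Longrightarrow> \<bar>a x\<bar> \<le> K" using bdd_meas_bound[OF a] by blast
  have sp: "space F = space M" using M(2) by (simp add: subalgebra_def)
  have int: "integrable M (\<lambda>x. a x * f x)"
  proof (rule Bochner_Integration.integrable_bound[of M "\<lambda>x. K * f x"])
    show "integrable M (\<lambda>x. K * f x)" using f by simp
    show "(\<lambda>x. a x * f x) \<in> borel_measurable M" using am f by auto
    show "AE x in M. norm (a x * f x) \<le> norm (K * f x)"
      using K sp by (intro AE_I2) (auto simp: abs_mult intro!: mult_right_mono)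
  qed
  have "AE x in M. real_cond_exp M F f x = 0"
  proof (rule real_cond_exp_charact)
    show "(\<integral>x\<in>A. f x \<partial>M) = (\<integral>x\<in>A. 0 \<partial>M)" if "A \<in> sets F" for A
      using f(2) that by (simp add: orthogonal_to_def set_lebesgue_integral_def)
  qed (use f in auto)
  then have "(\<integral>x. a x * real_cond_exp M F f x \<partial>M) = (\<integral>x. 0 \<partial>M)"
    using am by (intro integral_cong_AE) auto
  then show ?thesis using real_cond_exp_intg(2)[OF int am(1)] f(1) by simp
qed

lemma orthogonal_to_indicator_mult:
  assumes M: "subalgebra M F" and f: "orthogonal_to M F f" and C: "C \<in> sets F"
  shows "orthogonal_to M F (\<lambda>x. indicator C x * f x)"
  unfolding orthogonal_to_def
proof
  fix D assume "D \<in> sets F"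
  then have "D \<inter> C \<in> sets F" using C by auto
  then have "(\<integral>x. indicator (D \<inter> C) x * f x \<partial>M) = 0" using f by (simp add: orthogonal_to_def)
  then show "(\<integral>x. indicator D x * (indicator C x * f x) \<partial>M) = 0"
    by (simp add: indicator_inter_arith mult.assoc)
qed

text \<open>Dynkin argument: the sets over which \<open>f\<close> integrates to 0 are closed under
  disjoint unions, and under complements thanks to the vanishing total integral.\<close>

lemma orthogonal_to_generator:
  assumes f: "integrable M f" and G: "Int_stable G" "G \<subseteq> sets M" and F: "sets F = sigma_sets (space M) G"
    and eq: "\<And>D. D \<in> G \<Longrightarrow> (\<integral>x. indicator D x * f x \<partial>M) = 0" and all: "integral\<^sup>L M f = 0"
  shows "orthogonal_to M F f"
  unfolding orthogonal_to_def
proof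
  fix C assume "C \<in> sets F"
  then have C: "C \<in> sigma_sets (space M) G" using F by simp
  have sub: "sigma_sets (space M) G \<subseteq> sets M" using G(2) by (rule sets.sigma_sets_subset)
  have Gp: "G \<subseteq> Pow (space M)" using G(2) sets.sets_into_space by blast
  have int: "integrable M (\<lambda>x. indicator A x * f x)" if "A \<in> sets M" for A
    using integrable_mult_indicator[OF that f] by simp
  show "(\<integral>x. indicator C x * f x \<partial>M) = 0"
    using G(1) Gp C
  proof (induction rule: sigma_sets_induct_disjoint)
    case (basic A)
    then show ?case by (rule eq)
  next
    case empty
    show ?case by simp
  next
    case (compl A)
    have A: "A \<in> sets M" using compl(1) sub by blast
    have "(\<integral>x. indicator (space M - A) x * f x \<partial>M) = (\<integral>x. f x - indicator A x * f x \<partial>M)"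
      by (intro Bochner_Integration.integral_cong) (auto simp: indicator_def)
    also have "\<dots> = 0" using compl(2) all f int[OF A] by simp
    finally show ?case .
  next
    case (union A)
    have A: "A i \<in> sets M" for i using union(2) sub by blast
    have "(\<integral>x\<in>(\<Union>i. A i). f x \<partial>M) = (\<Sum>i. (\<integral>x\<in>A i. f x \<partial>M))"
    proof (rule lebesgue_integral_countable_add)
      show "A i \<inter> A j = {}" if "i \<noteq> j" for i j
        using union(1) that by (auto simp: disjoint_family_on_def)
      show "set_integrable M (\<Union>i. A i) f"
        unfolding set_integrable_def using integrable_mult_indicator[OF _ f, of "\<Union>i. A i"] A by auto
    qed (rule A)
    also have "\<dots> = 0" using union(3) by (simp add: set_lebesgue_integral_def)
    finally show ?case by (simp add: set_lebesgue_integral_def)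
  qed
qed

text \<open>\<open>real_cond_exp\<close> is bounded only almost everywhere. Clipping it to [-K, K]
  changes it on a null set and gives a version bounded at every point, as \<open>bdd_meas\<close>
  requires.\<close>

lemma bounded_cond_exp:
  assumes M: "finite_measure M" "subalgebra M F" and u: "bdd_meas M u"
  obtains u' where "bdd_meas F u'" "AE x in M. real_cond_exp M F u x = u' x"
    "orthogonal_to M F (\<lambda>x. u x - u' x)"
proof -
  interpret finite_measure_subalgebra M F
    using M by (auto simp: finite_measure_subalgebra_def finite_measure_subalgebra_axioms_def)
  obtain K where K: "K \<ge> 0" "\<And>x. x \<in> space M \<Longrightarrow> \<bar>u x\<bar> \<le> K" using bdd_meas_bound[OF u] by blast
  have iu: "integrable M u" using bdd_meas_integrable[OF M(1) u] .
  define r where "r = real_cond_exp M F u"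
  have rm: "r \<in> borel_measurable F" unfolding r_def by simp
  have ir: "integrable M r" unfolding r_def using iu by (rule real_cond_exp_int)
  define u' where "u' x = max (- K) (min K (r x))" for x
  have u'F: "bdd_meas F u'"
    unfolding u'_def using rm K(1) by (intro bdd_measI[of _ _ K]) auto
  have "AE x in M. r x \<ge> - K" "AE x in M. r x \<le> K"
    unfolding r_def using K(2) by (intro real_cond_exp_ge_c[OF iu] real_cond_exp_le_c[OF iu] AE_I2; force)+
  then have ae: "AE x in M. r x = u' x" unfolding u'_def by eventually_elim auto
  have u'm: "bdd_meas M u'" using subalgebra_bdd_meas[OF M(2) u'F] .
  have "orthogonal_to M F (\<lambda>x. u x - u' x)"
    unfolding orthogonal_to_def
  proof
    fix C assume C: "C \<in> sets F"
    then have CM: "C \<in> sets M" using M(2) by (auto simp: subalgebra_def)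
    have i1: "integrable M (\<lambda>x. indicator C x * u x)" using integrable_mult_indicator[OF CM iu] by simp
    have i2: "integrable M (\<lambda>x. indicator C x * u' x)"
      using integrable_mult_indicator[OF CM bdd_meas_integrable[OF M(1) u'm]] by simp
    have "(\<integral>x. indicator C x * (u x - u' x) \<partial>M) = (\<integral>x. indicator C x * u x \<partial>M) - (\<integral>x. indicator C x * u' x \<partial>M)"
      using i1 i2 by (simp add: right_diff_distrib)
    also have "(\<integral>x. indicator C x * u' x \<partial>M) = (\<integral>x. indicator C x * r x \<partial>M)"
    proof (rule integral_cong_AE)
      show "(\<lambda>x. indicator C x * u' x) \<in> borel_measurable M" using i2 by auto
      show "(\<lambda>x. indicator C x * r x) \<in> borel_measurable M" using ir CM by auto
      show "AE x in M. indicator C x * u' x = indicator C x * r x" using ae by eventually_elim simp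
    qed
    also have "(\<integral>x. indicator C x * r x \<partial>M) = (\<integral>x. indicator C x * u x \<partial>M)"
      unfolding r_def using C iu i1 by (intro real_cond_exp_intg) auto
    finally show "(\<integral>x. indicator C x * (u x - u' x) \<partial>M) = 0" by simp
  qed
  with u'F ae show thesis unfolding r_def by (intro that)
qed

lemma integral_square_eq_0_AE:
  assumes "finite_measure M" "bdd_meas M f" "(\<integral>x. f x * f x \<partial>M) = 0"
  shows "AE x in M. f x = 0"
proof -
  have "integrable M (\<lambda>x. f x * f x)"
    using bdd_meas_integrable[OF assms(1) bdd_meas_mult[OF assms(2,2)]] .
  then have "AE x in M. f x * f x = 0"
    using assms(3) integral_nonneg_eq_0_iff_AE[of M "\<lambda>x. f x * f x"] by auto
  then show ?thesis by eventually_elim simp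
qed

text \<open>The double orthogonal complement of the \<open>F\<close>-measurable functions is that
  space itself, modulo null sets: the test function f = u - E[u | F] is admissible and gives int (u
  - E[u | F])^2 = 0.\<close>

lemma AE_eq_subalgebra_measurable:
  assumes M: "finite_measure M" "subalgebra M F" and u: "bdd_meas M u"
    and orth: "\<And>f. bdd_meas M f \<Longrightarrow> orthogonal_to M F f \<Longrightarrow> (\<integral>x. f x * u x \<partial>M) = 0"
  obtains u' where "bdd_meas F u'" "AE x in M. u x = u' x"
proof -
  obtain u' where u': "bdd_meas F u'" "orthogonal_to M F (\<lambda>x. u x - u' x)"
    using bounded_cond_exp[OF M u] by blast
  have m: "bdd_meas M u'" using subalgebra_bdd_meas[OF M(2) u'(1)] .
  have d: "bdd_meas M (\<lambda>x. u x - u' x)" using u m by (rule bdd_meas_diff)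
  note int = bdd_meas_integrable[OF M(1)]
  have "(\<integral>x. (u x - u' x) * (u x - u' x) \<partial>M) =
    (\<integral>x. (u x - u' x) * u x \<partial>M) - (\<integral>x. u' x * (u x - u' x) \<partial>M)"
    using int[OF bdd_meas_mult[OF d u]] int[OF bdd_meas_mult[OF m d]]
    by (subst Bochner_Integration.integral_diff[symmetric]) (auto simp: algebra_simps)
  also have "\<dots> = 0"
    using orth[OF d u'(2)] orthogonal_to_integral_0[OF M int[OF d] u'(2) u'(1)] by simp
  finally have "AE x in M. u x - u' x = 0"
    by (rule integral_square_eq_0_AE[OF M(1) d])
  then have "AE x in M. u x = u' x" by eventually_elim simp
  with u'(1) show thesis by (rule that)
qed

section \<open>Causality as an orthogonality relation\<close>

text \<open>Placed on the full path space, not on the space of paths of length \<open>t\<close>, so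
  that different times form a filtration and conditioning under the full marginal makes
  sense.\<close>

definition past :: "(nat \<Rightarrow> 'a topology) \<Rightarrow> nat \<Rightarrow> nat \<Rightarrow> (nat \<Rightarrow> 'a) measure" where
  "past X N t = vimage_algebra (topspace (path_space N X)) (\<lambda>x. restrict x {1..t}) (borel_of (path_space t X))"

lemma space_past [simp]: "space (past X N t) = topspace (path_space N X)"
  by (simp add: past_def)

lemma restrict_path_in: "t \<le> n \<Longrightarrow> x \<in> topspace (path_space n X) \<Longrightarrow> restrict x {1..t} \<in> topspace (path_space t X)"
  by (auto simp: topspace_path_space)

lemma sets_past:
  assumes "t \<le> N"
  shows "sets (past X N t) =
    {(\<lambda>x. restrict x {1..t}) -` A \<inter> topspace (path_space N X) | A. A \<in> sets (borel_of (path_space t X))}"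
  unfolding past_def using restrict_path_in[OF assms] by (intro sets_vimage_algebra2) auto

lemma measurable_past_restrict:
  "t \<le> N \<Longrightarrow> (\<lambda>x. restrict x {1..t}) \<in> past X N t \<rightarrow>\<^sub>M borel_of (path_space t X)"
  unfolding past_def using restrict_path_in[of t N] by (intro measurable_vimage_algebra1) auto

lemma sets_past_mono:
  assumes "s \<le> t" "t \<le> N"
  shows "sets (past X N s) \<subseteq> sets (past X N t)"
proof -
  have "(\<lambda>x. restrict x {1..s}) \<in> borel_of (path_space t X) \<rightarrow>\<^sub>M borel_of (path_space s X)"
    using continuous_map_measurable[OF continuous_map_path_restrict[OF assms(1)]] .
  then have "(\<lambda>x. restrict (restrict x {1..t}) {1..s}) \<in> past X N t \<rightarrow>\<^sub>M borel_of (path_space s X)"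
    using measurable_past_restrict[OF assms(2)] by (rule measurable_compose[rotated])
  moreover have "restrict (restrict x {1..t}) {1..s} = restrict x {1..s}" for x :: "nat \<Rightarrow> 'a"
    using assms(1) by (auto simp: restrict_def fun_eq_iff)
  ultimately have "(\<lambda>x. restrict x {1..s}) \<in> past X N t \<rightarrow>\<^sub>M borel_of (path_space s X)" by simp
  from measurable_sets[OF this] show ?thesis
    using sets_past[of s N X] assms by auto
qed

lemma sets_past_self: "sets (past X N N) = sets (borel_of (path_space N X))"
proof -
  have id: "restrict x {1..N} = x" if "x \<in> topspace (path_space N X)" for x
    using that by (auto simp: topspace_path_space PiE_restrict)
  have eq: "(\<lambda>x. restrict x {1..N}) -` A \<inter> topspace (path_space N X) = A"
    if "A \<in> sets (borel_of (path_space N X))" for A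
  proof (intro set_eqI iffI)
    fix z assume "z \<in> (\<lambda>x. restrict x {1..N}) -` A \<inter> topspace (path_space N X)"
    then show "z \<in> A" using id[of z] by (metis IntE vimageE)
  next
    fix z assume z: "z \<in> A"
    then have zt: "z \<in> topspace (path_space N X)" using sets.sets_into_space[OF that] by auto
    with z id[of z] show "z \<in> (\<lambda>x. restrict x {1..N}) -` A \<inter> topspace (path_space N X)"
      by (metis IntI vimageI)
  qed
  have "sets (past X N N) = (\<lambda>A. A) ` sets (borel_of (path_space N X))"
    unfolding sets_past[OF order_refl] Setcompr_eq_image by (rule image_cong[OF refl eq])
  then show ?thesis by simp
qed

lemma subalgebra_past:
  assumes "sets M = sets (borel_of (path_space N X))" "t \<le> N"
  shows "subalgebra M (past X N t)"
  using sets_past_mono[OF assms(2) order_refl, of X] sets_past_self[of X N] assms(1)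
    sets_eq_imp_space_eq[OF assms(1)]
  by (simp add: subalgebra_def)

text \<open>The two paths are arbitrary random variables on \<open>P\<close>, so that causality
  (\<open>fst\<close>, \<open>snd\<close>) and anticausality (\<open>snd\<close>,
  \<open>fst\<close>) are instances of one notion. The condition is linear in \<open>P\<close>, and
  the class of test functions depends on \<open>P\<close> only through the law of
  \<open>x\<close>.\<close>

definition nonanticipative ::
  "(nat \<Rightarrow> 'a topology) \<Rightarrow> (nat \<Rightarrow> 'b topology) \<Rightarrow> nat \<Rightarrow> 'w measure \<Rightarrow>
    ('w \<Rightarrow> nat \<Rightarrow> 'a) \<Rightarrow> ('w \<Rightarrow> nat \<Rightarrow> 'b) \<Rightarrow> nat \<Rightarrow> bool" where
  "nonanticipative X Y N P x y t \<longleftrightarrow> (\<forall>f b. bdd_meas (borel_of (path_space N X)) f \<longrightarrow>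
     orthogonal_to (distr P (borel_of (path_space N X)) x) (past X N t) f \<longrightarrow>
     bdd_meas (past Y N t) b \<longrightarrow> (\<integral>w. f (x w) * b (y w) \<partial>P) = 0)"

section \<open>Conditional independence versus orthogonality on a fixed probability space\<close>

context
  fixes X :: "nat \<Rightarrow> 'a topology" and Y :: "nat \<Rightarrow> 'b topology" and N :: nat
    and P :: "'w measure" and x :: "'w \<Rightarrow> nat \<Rightarrow> 'a" and y :: "'w \<Rightarrow> nat \<Rightarrow> 'b"
  assumes X: "\<And>t. t \<in> {1..N} \<Longrightarrow> polish (X t)"
    and P: "prob_space P"
    and x [measurable]: "x \<in> P \<rightarrow>\<^sub>M borel_of (path_space N X)"
    and y [measurable]: "y \<in> P \<rightarrow>\<^sub>M borel_of (path_space N Y)"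
begin

interpretation prob_space P by (rule P)

abbreviation "law \<equiv> distr P (borel_of (path_space N X)) x"

lemma law_finite: "finite_measure law"
  using prob_space_distr[OF x] by (simp add: prob_space_def)

lemma law_subalgebra: "t \<le> N \<Longrightarrow> subalgebra law (past X N t)"
  by (rule subalgebra_past) auto

lemma integral_law:
  fixes f :: "(nat \<Rightarrow> 'a) \<Rightarrow> real"
  shows "f \<in> borel_measurable (borel_of (path_space N X)) \<Longrightarrow> (\<integral>z. f z \<partial>law) = (\<integral>w. f (x w) \<partial>P)"
  using x by (rule integral_distr)

lemma bdd_meas_past: "t \<le> N \<Longrightarrow> bdd_meas (past X N t) f \<Longrightarrow> bdd_meas (borel_of (path_space N X)) f"
  "t \<le> N \<Longrightarrow> bdd_meas (past Y N t) g \<Longrightarrow> bdd_meas (borel_of (path_space N Y)) g"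
  using bdd_meas_mono[of "past X N t" f "past X N N"] sets_past_mono[of t N N X]
    bdd_meas_mono[of "past Y N t" g "past Y N N"] sets_past_mono[of t N N Y]
    bdd_meas_cong_sets[OF sets_past_self[of X N]] bdd_meas_cong_sets[OF sets_past_self[of Y N]] by auto

lemma path_x: "w \<in> space P \<Longrightarrow> x w \<in> topspace (path_space N X)"
  using measurable_space[OF x] by simp

lemma path_y: "w \<in> space P \<Longrightarrow> y w \<in> topspace (path_space N Y)"
  using measurable_space[OF y] by simp

text \<open>The pullback of \<open>past\<close> to the sample space; it is literally the
  conditioning \<sigma>-algebra that occurs in \<open>cond_indep_var\<close>.\<close>

definition xpast :: "nat \<Rightarrow> 'w measure" where
  "xpast t = vimage_algebra (space P) (\<lambda>w. restrict (x w) {1..t}) (borel_of (path_space t X))"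

definition ypast :: "nat \<Rightarrow> 'w measure" where
  "ypast t = vimage_algebra (space P) (\<lambda>w. restrict (y w) {1..t}) (borel_of (path_space t Y))"

lemma restrict_measurable:
  "t \<le> N \<Longrightarrow> (\<lambda>w. restrict (x w) {1..t}) \<in> P \<rightarrow>\<^sub>M borel_of (path_space t X)"
  "t \<le> N \<Longrightarrow> (\<lambda>w. restrict (y w) {1..t}) \<in> P \<rightarrow>\<^sub>M borel_of (path_space t Y)"
  using measurable_compose[OF x continuous_map_measurable[OF continuous_map_path_restrict]]
    measurable_compose[OF y continuous_map_measurable[OF continuous_map_path_restrict]] by auto

lemma coordinate_measurable:
  "t \<in> {1..N} \<Longrightarrow> (\<lambda>w. x w t) \<in> P \<rightarrow>\<^sub>M borel_of (X t)"
  using measurable_compose[OF x continuous_map_measurable[OF continuous_map_path_coordinate]] by auto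

lemma sets_xpast:
  assumes "t \<le> N"
  shows "sets (xpast t) = {(\<lambda>w. restrict (x w) {1..t}) -` A \<inter> space P | A. A \<in> sets (borel_of (path_space t X))}"
  unfolding xpast_def using path_x restrict_path_in[OF assms] by (intro sets_vimage_algebra2) auto

lemma sets_xpast': "t \<le> N \<Longrightarrow> sets (xpast t) = {x -` C \<inter> space P | C. C \<in> sets (past X N t)}"
proof -
  assume t: "t \<le> N"
  have eq: "x -` ((\<lambda>x. restrict x {1..t}) -` A \<inter> topspace (path_space N X)) \<inter> space P
    = (\<lambda>w. restrict (x w) {1..t}) -` A \<inter> space P" for A
    using path_x by auto
  show ?thesis unfolding sets_xpast[OF t] sets_past[OF t] Setcompr_eq_image image_image eq ..
qed

lemma sets_ypast':
  assumes "t \<le> N"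
  shows "sets (ypast t) = {(\<lambda>w. restrict (y w) {1..t}) -` A \<inter> space P | A. A \<in> sets (borel_of (path_space t Y))}"
  unfolding ypast_def using path_y restrict_path_in[OF assms] by (intro sets_vimage_algebra2) auto

lemma space_xypast [simp]: "space (xpast t) = space P" "space (ypast t) = space P"
  by (auto simp: xpast_def ypast_def)

lemma subalgebra_xypast:
  assumes "t \<le> N" shows "subalgebra P (xpast t)" "subalgebra P (ypast t)"
  using measurable_sets[OF restrict_measurable(1)[OF assms]] measurable_sets[OF restrict_measurable(2)[OF assms]]
  by (auto simp: subalgebra_def sets_xpast[OF assms] sets_ypast'[OF assms])

lemma x_measurable_past: "t \<le> N \<Longrightarrow> x \<in> xpast t \<rightarrow>\<^sub>M past X N t"
  using sets_xpast'[of t] path_x by (auto simp: measurable_def)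

lemma y_measurable_past:
  assumes t: "t \<le> N" shows "y \<in> ypast t \<rightarrow>\<^sub>M past Y N t"
proof (rule measurableI)
  fix C assume "C \<in> sets (past Y N t)"
  then obtain A where A: "A \<in> sets (borel_of (path_space t Y))"
    "C = (\<lambda>x. restrict x {1..t}) -` A \<inter> topspace (path_space N Y)"
    using sets_past[OF t, of Y] by auto
  have "y -` C \<inter> space P = (\<lambda>w. restrict (y w) {1..t}) -` A \<inter> space P"
    unfolding A(2) using path_y by auto
  then show "y -` C \<inter> space (ypast t) \<in> sets (ypast t)" using A(1) sets_ypast'[OF t] by auto
qed (use path_y in auto)

lemma orthogonal_to_law:
  assumes t: "t \<le> N" and f: "bdd_meas (borel_of (path_space N X)) f" and orth: "orthogonal_to law (past X N t) f"
  shows "orthogonal_to P (xpast t) (\<lambda>w. f (x w))"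
  unfolding orthogonal_to_def
proof
  fix C assume "C \<in> sets (xpast t)"
  then obtain D where D: "D \<in> sets (past X N t)" "C = x -` D \<inter> space P"
    using sets_xpast'[OF t] by auto
  have DM: "D \<in> sets (borel_of (path_space N X))"
    using law_subalgebra[OF t] D(1) by (auto simp: subalgebra_def)
  have "(\<integral>w. indicator C w * f (x w) \<partial>P) = (\<integral>w. indicator D (x w) * f (x w) \<partial>P)"
    unfolding D(2) by (intro Bochner_Integration.integral_cong) (auto simp: indicator_def)
  also have "\<dots> = (\<integral>z. indicator D z * f z \<partial>law)"
    using DM bdd_meas_measurable[OF f] by (intro integral_law[symmetric]) auto
  also have "\<dots> = 0" using orth D(1) by (simp add: orthogonal_to_def)
  finally show "(\<integral>w. indicator C w * f (x w) \<partial>P) = 0" .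
qed

text \<open>Conditional independence says that the next coordinate adds nothing to the prediction of
  an event \<open>B'\<close> in the past of \<open>y\<close>: its conditional probability
  \<open>g\<close> given \<open>x\<close> up to \<open>s\<close> is also the one given
  \<open>x\<close> up to \<open>Suc s\<close>. Hence \<open>B'\<close> may be replaced by
  \<open>g\<close> when integrating \<open>f\<close>, and \<open>f\<close> is orthogonal to
  \<open>g\<close>.\<close>

lemma cond_indep_imp_step:
  assumes s: "Suc s \<le> N"
    and CI: "cond_indep_var P (borel_of (X (Suc s))) (\<lambda>w. x w (Suc s))
     (borel_of (path_space s Y)) (\<lambda>w. restrict (y w) {1..s})
     (borel_of (path_space s X)) (\<lambda>w. restrict (x w) {1..s})"
    and f: "bdd_meas (past X N (Suc s)) f" "orthogonal_to law (past X N s) f"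
    and b: "bdd_meas (past Y N s) b"
  shows "(\<integral>w. f (x w) * b (y w) \<partial>P) = 0"
proof -
  have sN: "s \<le> N" using s by simp
  note Gsub = subalgebra_xypast(1)[OF sN]
  interpret G: finite_measure_subalgebra P "xpast s"
    using Gsub by unfold_locales
  have fN: "bdd_meas (borel_of (path_space N X)) f" using bdd_meas_past(1)[OF s f(1)] .
  have fxP: "bdd_meas P (\<lambda>w. f (x w))" using bdd_meas_comp[OF fN x] .
  have fxH: "bdd_meas (xpast (Suc s)) (\<lambda>w. f (x w))" using bdd_meas_comp[OF f(1) x_measurable_past[OF s]] .
  have fxG: "orthogonal_to P (xpast s) (\<lambda>w. f (x w))" using orthogonal_to_law[OF sN fN f(2)] .
  note int = bdd_meas_integrable[OF finite_measure_axioms]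
  have main: "(\<integral>w. indicator B' w * f (x w) \<partial>P) = 0" if B': "B' \<in> sets (ypast s)" for B'
  proof -
    obtain B where B: "B \<in> sets (borel_of (path_space s Y))" "B' = (\<lambda>w. restrict (y w) {1..s}) -` B \<inter> space P"
      using B' sets_ypast'[OF sN] by auto
    have B'P: "B' \<in> sets P" using B' subalgebra_xypast(2)[OF sN] by (auto simp: subalgebra_def)
    have iB: "bdd_meas P (indicator B')" using bdd_meas_indicator[OF B'P] .
    obtain g where g: "bdd_meas (xpast s) g" "AE w in P. real_cond_exp P (xpast s) (indicator B') w = g w"
      "orthogonal_to P (xpast s) (\<lambda>w. indicator B' w - g w)"
      using bounded_cond_exp[OF finite_measure_axioms Gsub iB] by blast
    have gP: "bdd_meas P g" using subalgebra_bdd_meas[OF Gsub g(1)] .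
    have dP: "bdd_meas P (\<lambda>w. indicator B' w - g w)" using bdd_meas_diff[OF iB gP] .
    \<comment> \<open>Rectangles in past and next coordinate: an intersection-stable family to which
      the product formula of conditional independence applies directly.\<close>
    define Gen where "Gen = {((\<lambda>w. restrict (x w) {1..s}) -` C \<inter> space P) \<inter> ((\<lambda>w. x w (Suc s)) -` A \<inter> space P) | C A.
      C \<in> sets (borel_of (path_space s X)) \<and> A \<in> sets (borel_of (X (Suc s)))}"
    have cm: "(\<lambda>w. x w (Suc s)) \<in> P \<rightarrow>\<^sub>M borel_of (X (Suc s))" using s by (intro coordinate_measurable) auto
    have genI: "((\<lambda>w. restrict (x w) {1..s}) -` C \<inter> space P) \<inter> ((\<lambda>w. x w (Suc s)) -` A \<inter> space P) \<in> Gen"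
      if "C \<in> sets (borel_of (path_space s X))" "A \<in> sets (borel_of (X (Suc s)))" for C A
      using that unfolding Gen_def by blast
    have GenP: "Gen \<subseteq> sets P"
      unfolding Gen_def using measurable_sets[OF restrict_measurable(1)[OF sN]] measurable_sets[OF cm] by auto
    \<comment> \<open>In other words, \<open>g\<close> is still the conditional probability of
      \<open>B'\<close> one step later.\<close>
    have "orthogonal_to P (xpast (Suc s)) (\<lambda>w. indicator B' w - g w)"
    proof -
      let ?S = "sigma (space P) Gen"
      have GenPow: "Gen \<subseteq> Pow (space P)" using GenP sets.sets_into_space by blast
      have sS: "sets ?S = sigma_sets (space P) Gen" "space ?S = space P"
        using GenPow by (simp_all add: sets_measure_of space_measure_of)
      have px: "restrict (x w) {1..s} \<in> space (borel_of (path_space s X))" "x w (Suc s) \<in> space (borel_of (X (Suc s)))"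
        if "w \<in> space P" for w
        using that measurable_space[OF restrict_measurable(1)[OF sN]] measurable_space[OF cm] by auto
      have xr: "(\<lambda>w. restrict (x w) {1..s}) \<in> ?S \<rightarrow>\<^sub>M borel_of (path_space s X)"
      proof (rule measurableI)
        fix C assume C: "C \<in> sets (borel_of (path_space s X))"
        have "(\<lambda>w. restrict (x w) {1..s}) -` C \<inter> space P =
          ((\<lambda>w. restrict (x w) {1..s}) -` C \<inter> space P) \<inter> ((\<lambda>w. x w (Suc s)) -` space (borel_of (X (Suc s))) \<inter> space P)"
          using px by blast
        then show "(\<lambda>w. restrict (x w) {1..s}) -` C \<inter> space ?S \<in> sets ?S"
          unfolding sS using genI[OF C sets.top] by (metis sigma_sets.Basic)
      qed (use px sS in auto)
      have xe: "(\<lambda>w. x w (Suc s)) \<in> ?S \<rightarrow>\<^sub>M borel_of (X (Suc s))"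
      proof (rule measurableI)
        fix A assume A: "A \<in> sets (borel_of (X (Suc s)))"
        have "(\<lambda>w. x w (Suc s)) -` A \<inter> space P =
          ((\<lambda>w. restrict (x w) {1..s}) -` space (borel_of (path_space s X)) \<inter> space P) \<inter> ((\<lambda>w. x w (Suc s)) -` A \<inter> space P)"
          using px by blast
        then show "(\<lambda>w. x w (Suc s)) -` A \<inter> space ?S \<in> sets ?S"
          unfolding sS using genI[OF sets.top A] by (metis sigma_sets.Basic)
      qed (use px sS in auto)
      have rr: "restrict (restrict (x w) {1..Suc s}) {1..s} = restrict (x w) {1..s}" for w
        by (auto simp: restrict_def fun_eq_iff)
      have ee: "restrict (x w) {1..Suc s} (Suc s) = x w (Suc s)" for w by simp
      have "(\<lambda>w. restrict (x w) {1..Suc s}) \<in> ?S \<rightarrow>\<^sub>M borel_of (path_space (Suc s) X)"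
      proof (rule measurable_path_SucI)
        show "polish (X i)" if "i \<in> {1..Suc s}" for i using X[of i] that s by auto
        show "(\<lambda>w. restrict (x w) {1..Suc s}) \<in> space ?S \<rightarrow> topspace (path_space (Suc s) X)"
          unfolding sS by (intro funcsetI restrict_path_in[OF s] path_x)
      qed (use xr xe rr ee in auto)
      from measurable_sets[OF this] have "sets (xpast (Suc s)) \<subseteq> sets ?S"
        unfolding sets_xpast[OF s] using sS by auto
      moreover have "orthogonal_to P ?S (\<lambda>w. indicator B' w - g w)"
      proof (rule orthogonal_to_generator[OF int[OF dP] _ GenP sS(1)])
        show "Int_stable Gen"
        proof (rule Int_stableI)
          fix a b assume "a \<in> Gen" "b \<in> Gen"
          then obtain C A C' A' where "C \<in> sets (borel_of (path_space s X))" "A \<in> sets (borel_of (X (Suc s)))"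
            "C' \<in> sets (borel_of (path_space s X))" "A' \<in> sets (borel_of (X (Suc s)))"
            "a = ((\<lambda>w. restrict (x w) {1..s}) -` C \<inter> space P) \<inter> ((\<lambda>w. x w (Suc s)) -` A \<inter> space P)"
            "b = ((\<lambda>w. restrict (x w) {1..s}) -` C' \<inter> space P) \<inter> ((\<lambda>w. x w (Suc s)) -` A' \<inter> space P)"
            unfolding Gen_def by blast
          moreover from this have "a \<inter> b = ((\<lambda>w. restrict (x w) {1..s}) -` (C \<inter> C') \<inter> space P) \<inter>
            ((\<lambda>w. x w (Suc s)) -` (A \<inter> A') \<inter> space P)" by blast
          ultimately show "a \<inter> b \<in> Gen" using genI[of "C \<inter> C'" "A \<inter> A'"] by (metis sets.Int)
        qed
        have "space P \<in> sets (xpast s)" using sets.top[of "xpast s"] by simp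
        then have "(\<integral>w. indicator (space P) w * (indicator B' w - g w) \<partial>P) = 0"
          using g(3) by (simp add: orthogonal_to_def)
        moreover have "(\<integral>w. indicator (space P) w * (indicator B' w - g w) \<partial>P) = (\<integral>w. indicator B' w - g w \<partial>P)"
          by (intro Bochner_Integration.integral_cong) auto
        ultimately show "(\<integral>w. indicator B' w - g w \<partial>P) = 0" by simp
        fix D assume "D \<in> Gen"
        then obtain C A where C: "C \<in> sets (borel_of (path_space s X))" and A: "A \<in> sets (borel_of (X (Suc s)))"
          and D: "D = ((\<lambda>w. restrict (x w) {1..s}) -` C \<inter> space P) \<inter> ((\<lambda>w. x w (Suc s)) -` A \<inter> space P)"
          unfolding Gen_def by blast
        define C' where "C' = (\<lambda>w. restrict (x w) {1..s}) -` C \<inter> space P"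
        define A' where "A' = (\<lambda>w. x w (Suc s)) -` A \<inter> space P"
        have C': "C' \<in> sets (xpast s)" unfolding C'_def using C sets_xpast[OF sN] by auto
        have C'P: "C' \<in> sets P" using C' Gsub by (auto simp: subalgebra_def)
        have A'P: "A' \<in> sets P" unfolding A'_def using measurable_sets[OF cm A] .
        have iA: "integrable P (indicator A' :: _ \<Rightarrow> real)" using int[OF bdd_meas_indicator[OF A'P]] .
        have "AE w in P. real_cond_exp P (xpast s) (indicator (A' \<inter> B')) w
          = real_cond_exp P (xpast s) (indicator A') w * real_cond_exp P (xpast s) (indicator B') w"
          using CI A B unfolding cond_indep_var_def Let_def A'_def xpast_def[symmetric] by auto
        then have ci: "AE w in P. indicator C' w * real_cond_exp P (xpast s) (indicator (A' \<inter> B')) w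
          = (indicator C' w * g w) * real_cond_exp P (xpast s) (indicator A') w"
          using g(2) by eventually_elim simp
        have AB: "A' \<inter> B' \<in> sets P" using A'P B'P by auto
        have iC: "(indicator C' :: _ \<Rightarrow> real) \<in> borel_measurable (xpast s)" using C' by simp
        have gC: "(\<lambda>w. indicator C' w * g w) \<in> borel_measurable (xpast s)"
          using iC bdd_meas_measurable[OF g(1)] by (rule borel_measurable_times)
        have bCg: "bdd_meas P (\<lambda>w. indicator C' w * g w)"
          using bdd_meas_mult[OF bdd_meas_indicator[OF C'P] gP] .
        \<comment> \<open>On a rectangle: condition on \<open>x\<close> up to \<open>s\<close>,
          factorise, replace the conditional probability of \<open>B'\<close> by \<open>g\<close>,
          and undo the conditioning on \<open>A'\<close>.\<close>
        have "(\<integral>w. indicator C' w * indicator (A' \<inter> B') w \<partial>P) =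
          (\<integral>w. indicator C' w * real_cond_exp P (xpast s) (indicator (A' \<inter> B')) w \<partial>P)"
          using int[OF bdd_meas_mult[OF bdd_meas_indicator[OF C'P] bdd_meas_indicator[OF AB]]] iC AB
          by (intro G.real_cond_exp_intg(2)[symmetric]) auto
        also have "\<dots> = (\<integral>w. (indicator C' w * g w) * real_cond_exp P (xpast s) (indicator A') w \<partial>P)"
          using ci C'P AB bdd_meas_measurable[OF gP] by (intro integral_cong_AE) auto
        also have "\<dots> = (\<integral>w. (indicator C' w * g w) * indicator A' w \<partial>P)"
          using int[OF bdd_meas_mult[OF bCg bdd_meas_indicator[OF A'P]]] gC A'P
          by (intro G.real_cond_exp_intg(2)) auto
        finally have e: "(\<integral>w. indicator C' w * indicator (A' \<inter> B') w \<partial>P) = (\<integral>w. (indicator C' w * g w) * indicator A' w \<partial>P)" .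
        have "(\<integral>w. indicator D w * (indicator B' w - g w) \<partial>P) =
          (\<integral>w. indicator C' w * indicator (A' \<inter> B') w - (indicator C' w * g w) * indicator A' w \<partial>P)"
          unfolding D C'_def[symmetric] A'_def[symmetric]
          by (intro Bochner_Integration.integral_cong) (auto simp: indicator_def)
        also have "\<dots> = (\<integral>w. indicator C' w * indicator (A' \<inter> B') w \<partial>P) -
            (\<integral>w. (indicator C' w * g w) * indicator A' w \<partial>P)"
          by (intro Bochner_Integration.integral_diff int bdd_meas_mult bdd_meas_indicator C'P AB A'P gP)
        also have "\<dots> = 0" unfolding e by simp
        finally show "(\<integral>w. indicator D w * (indicator B' w - g w) \<partial>P) = 0" .
      qed
      ultimately show ?thesis unfolding orthogonal_to_def by blast
    qed
    then have "(\<integral>w. f (x w) * (indicator B' w - g w) \<partial>P) = 0"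
      using orthogonal_to_integral_0[OF finite_measure_axioms subalgebra_xypast(1)[OF s] int[OF dP] _ fxH] by simp
    moreover have "(\<integral>w. g w * f (x w) \<partial>P) = 0"
      using orthogonal_to_integral_0[OF finite_measure_axioms Gsub int[OF fxP] fxG g(1)] .
    moreover have "(\<integral>w. indicator B' w * f (x w) \<partial>P) =
      (\<integral>w. f (x w) * (indicator B' w - g w) \<partial>P) + (\<integral>w. g w * f (x w) \<partial>P)"
      using int[OF bdd_meas_mult[OF fxP dP]] int[OF bdd_meas_mult[OF gP fxP]]
      by (subst Bochner_Integration.integral_add[symmetric]) (auto simp: algebra_simps)
    ultimately show ?thesis by simp
  qed
  then have "orthogonal_to P (ypast s) (\<lambda>w. f (x w))" by (simp add: orthogonal_to_def)
  from orthogonal_to_integral_0[OF finite_measure_axioms subalgebra_xypast(2)[OF sN] int[OF fxP] this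
      bdd_meas_comp[OF b y_measurable_past[OF sN]]]
  show ?thesis by (simp add: mult.commute)
qed

text \<open>Conditional independence concerns one next coordinate, whereas the test function may
  depend on the whole future. Induction on the horizon \<open>s\<close> from \<open>t\<close> to
  \<open>N\<close> splits a function \<open>f\<close> of the past at \<open>Suc s\<close> into f -
  E[f | past at s], killed by the one-step lemma at time \<open>s\<close>, and E[f | past at s],
  covered by the induction hypothesis.\<close>

lemma cond_indep_imp_nonanticipative:
  assumes CI: "\<And>s. s \<in> {1..<N} \<Longrightarrow> cond_indep_var P (borel_of (X (Suc s))) (\<lambda>w. x w (Suc s))
     (borel_of (path_space s Y)) (\<lambda>w. restrict (y w) {1..s})
     (borel_of (path_space s X)) (\<lambda>w. restrict (x w) {1..s})"
    and t: "t \<in> {1..<N}"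
  shows "nonanticipative X Y N P x y t"
proof -
  have tN: "t \<le> N" using t by simp
  note int = bdd_meas_integrable[OF finite_measure_axioms]
  have claim: "s \<le> N \<longrightarrow> (\<forall>f b. bdd_meas (past X N s) f \<longrightarrow> orthogonal_to law (past X N t) f \<longrightarrow>
    bdd_meas (past Y N t) b \<longrightarrow> (\<integral>w. f (x w) * b (y w) \<partial>P) = 0)" if "t \<le> s" for s
    using that
  proof (induction s rule: dec_induct)
    \<comment> \<open>At horizon \<open>t\<close> the function is measurable with respect to, and
      orthogonal to, the same \<sigma>-algebra, so it vanishes almost everywhere.\<close>
    case base
    show ?case
    proof (intro impI allI)
      fix f b assume f: "bdd_meas (past X N t) f" "orthogonal_to law (past X N t) f" and b: "bdd_meas (past Y N t) b"
      have fl: "bdd_meas law f" using subalgebra_bdd_meas[OF law_subalgebra[OF tN] f(1)] .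
      have "(\<integral>z. f z * f z \<partial>law) = 0"
        using orthogonal_to_integral_0[OF law_finite law_subalgebra[OF tN] bdd_meas_integrable[OF law_finite fl] f(2,1)] .
      then have "AE z in law. f z = 0" by (rule integral_square_eq_0_AE[OF law_finite fl])
      then have "AE w in P. f (x w) = 0" using AE_distrD[OF x] by blast
      then have "AE w in P. f (x w) * b (y w) = 0" by eventually_elim simp
      then show "(\<integral>w. f (x w) * b (y w) \<partial>P) = 0" by (rule integral_eq_zero_AE)
    qed
  next
    case (step s)
    show ?case
    proof (intro impI allI)
      assume sN: "Suc s \<le> N"
      fix f b assume f: "bdd_meas (past X N (Suc s)) f" "orthogonal_to law (past X N t) f" and b: "bdd_meas (past Y N t) b"
      have sN': "s \<le> N" using sN by simp
      note lint = bdd_meas_integrable[OF law_finite]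
      have fl: "bdd_meas law f" using subalgebra_bdd_meas[OF law_subalgebra[OF sN] f(1)] .
      obtain u where u: "bdd_meas (past X N s) u" "orthogonal_to law (past X N s) (\<lambda>z. f z - u z)"
        using bounded_cond_exp[OF law_finite law_subalgebra[OF sN'] fl] by blast
      have ul: "bdd_meas law u" using subalgebra_bdd_meas[OF law_subalgebra[OF sN'] u(1)] .
      have us: "bdd_meas (past X N (Suc s)) u"
        using bdd_meas_mono[OF u(1) sets_past_mono[of s "Suc s" N X]] sN by simp
      have bs: "bdd_meas (past Y N s) b"
        using bdd_meas_mono[OF b sets_past_mono[OF step(1) sN', of Y]] by simp
      have c1: "(\<integral>w. (f (x w) - u (x w)) * b (y w) \<partial>P) = 0"
        using step(1) t sN by (intro cond_indep_imp_step[OF sN CI bdd_meas_diff[OF f(1) us] u(2) bs]) auto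
      \<comment> \<open>Tower property: projecting onto the finer past at \<open>s\<close> does not
        spoil orthogonality to the past at \<open>t\<close>.\<close>
      have "orthogonal_to law (past X N t) u"
        unfolding orthogonal_to_def
      proof
        fix C assume C: "C \<in> sets (past X N t)"
        then have Cs: "C \<in> sets (past X N s)" using sets_past_mono[OF step(1) sN', of X] by blast
        have Cl: "bdd_meas law (indicator C)"
          using C law_subalgebra[OF tN] by (intro bdd_meas_indicator) (auto simp: subalgebra_def)
        have "(\<integral>z. indicator C z * u z \<partial>law) =
          (\<integral>z. indicator C z * f z \<partial>law) - (\<integral>z. indicator C z * (f z - u z) \<partial>law)"
          using lint[OF bdd_meas_mult[OF Cl fl]] lint[OF bdd_meas_mult[OF Cl bdd_meas_diff[OF fl ul]]]
          by (subst Bochner_Integration.integral_diff[symmetric]) (auto simp: algebra_simps)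
        then show "(\<integral>z. indicator C z * u z \<partial>law) = 0"
          using u(2) Cs f(2) C by (simp add: orthogonal_to_def)
      qed
      then have c2: "(\<integral>w. u (x w) * b (y w) \<partial>P) = 0"
        using step(3) sN' u(1) b by blast
      have bP: "bdd_meas P (\<lambda>w. b (y w))" using bdd_meas_comp[OF bdd_meas_past(2)[OF tN b] y] .
      have uP: "bdd_meas P (\<lambda>w. u (x w))" using bdd_meas_comp[OF bdd_meas_past(1)[OF sN' u(1)] x] .
      have fP: "bdd_meas P (\<lambda>w. f (x w))" using bdd_meas_comp[OF bdd_meas_past(1)[OF sN f(1)] x] .
      have "(\<integral>w. f (x w) * b (y w) \<partial>P) =
        (\<integral>w. (f (x w) - u (x w)) * b (y w) \<partial>P) + (\<integral>w. u (x w) * b (y w) \<partial>P)"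
        using int[OF bdd_meas_mult[OF bdd_meas_diff[OF fP uP] bP]] int[OF bdd_meas_mult[OF uP bP]]
        by (subst Bochner_Integration.integral_add[symmetric]) (auto simp: algebra_simps)
      then show "(\<integral>w. f (x w) * b (y w) \<partial>P) = 0" using c1 c2 by simp
    qed
  qed
  have "bdd_meas (past X N N) f" if "bdd_meas (borel_of (path_space N X)) f" for f
    using that bdd_meas_cong_sets[OF sets_past_self] by blast
  then show ?thesis unfolding nonanticipative_def using claim[OF tN] by blast
qed

text \<open>Subtracting from the indicator of an event on the next coordinate its conditional
  expectation \<open>u\<close> gives an admissible test function. Its orthogonality to functions of
  the past of \<open>y\<close> allows replacing the event by \<open>u\<close> in the joint
  conditional probability, which is the product formula.\<close>

lemma nonanticipative_imp_cond_indep: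
  assumes na: "nonanticipative X Y N P x y t" and t: "t \<in> {1..<N}"
  shows "cond_indep_var P (borel_of (X (Suc t))) (\<lambda>w. x w (Suc t))
     (borel_of (path_space t Y)) (\<lambda>w. restrict (y w) {1..t})
     (borel_of (path_space t X)) (\<lambda>w. restrict (x w) {1..t})"
  unfolding cond_indep_var_def Let_def xpast_def[symmetric]
proof (intro ballI)
  fix A B assume A: "A \<in> sets (borel_of (X (Suc t)))" and B: "B \<in> sets (borel_of (path_space t Y))"
  have tN: "t \<le> N" using t by simp
  note Gsub = subalgebra_xypast(1)[OF tN]
  interpret G: finite_measure_subalgebra P "xpast t"
    using Gsub by unfold_locales
  note int = bdd_meas_integrable[OF finite_measure_axioms]
  note lint = bdd_meas_integrable[OF law_finite]
  define A' where "A' = (\<lambda>w. x w (Suc t)) -` A \<inter> space P"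
  define B' where "B' = (\<lambda>w. restrict (y w) {1..t}) -` B \<inter> space P"
  define A0 where "A0 = (\<lambda>z. z (Suc t)) -` A \<inter> topspace (path_space N X)"
  have A0: "A0 \<in> sets (borel_of (path_space N X))"
    using measurable_sets[OF continuous_map_measurable[OF continuous_map_path_coordinate[of "Suc t" N X]] A] t
    by (simp add: A0_def)
  define B0 where "B0 = (\<lambda>z. restrict z {1..t}) -` B \<inter> topspace (path_space N Y)"
  have B0: "B0 \<in> sets (past Y N t)" unfolding B0_def sets_past[OF tN] using B by blast
  have A': "A' \<in> sets P" unfolding A'_def using t by (intro measurable_sets[OF coordinate_measurable A]) auto
  have B': "B' \<in> sets P" unfolding B'_def using measurable_sets[OF restrict_measurable(2)[OF tN] B] .
  have AB': "A' \<inter> B' \<in> sets P" using A' B' by blast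
  have iA: "indicator A' w = (indicator A0 (x w) :: real)" if "w \<in> space P" for w
    using path_x[OF that] that by (simp add: A'_def A0_def indicator_def)
  have iB: "indicator B' w = (indicator B0 (y w) :: real)" if "w \<in> space P" for w
    using path_y[OF that] that by (simp add: B'_def B0_def indicator_def)
  have bA0: "bdd_meas (borel_of (path_space N X)) (indicator A0)" using bdd_meas_indicator[OF A0] .
  have lA0: "bdd_meas law (indicator A0)" using bA0 by (simp add: bdd_meas_cong_sets[of law "borel_of (path_space N X)"])
  obtain u where u: "bdd_meas (past X N t) u" "orthogonal_to law (past X N t) (\<lambda>z. indicator A0 z - u z)"
    using bounded_cond_exp[OF law_finite law_subalgebra[OF tN] lA0] by blast
  have uN: "bdd_meas (borel_of (path_space N X)) u" using bdd_meas_past(1)[OF tN u(1)] .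
  have uG: "bdd_meas (xpast t) (\<lambda>w. u (x w))" using bdd_meas_comp[OF u(1) x_measurable_past[OF tN]] .
  have uP: "bdd_meas P (\<lambda>w. u (x w))" using bdd_meas_comp[OF uN x] .
  have dN: "bdd_meas (borel_of (path_space N X)) (\<lambda>z. indicator A0 z - u z)" using bdd_meas_diff[OF bA0 uN] .
  have dP: "bdd_meas P (\<lambda>w. indicator A0 (x w) - u (x w))" using bdd_meas_comp[OF dN x] .
  have bA: "bdd_meas P (indicator A')" and bB: "bdd_meas P (indicator B')" and bAB: "bdd_meas P (indicator (A' \<inter> B'))"
    using A' B' AB' by (auto intro: bdd_meas_indicator)
  obtain g where g: "bdd_meas (xpast t) g" "AE w in P. real_cond_exp P (xpast t) (indicator B') w = g w"
    using bounded_cond_exp[OF finite_measure_axioms Gsub bB] by blast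
  have gP: "bdd_meas P g" using subalgebra_bdd_meas[OF Gsub g(1)] .
  have ugG: "bdd_meas (xpast t) (\<lambda>w. u (x w) * g w)" using bdd_meas_mult[OF uG g(1)] .
  have ugP: "bdd_meas P (\<lambda>w. u (x w) * g w)" using bdd_meas_mult[OF uP gP] .
  have e1: "AE w in P. real_cond_exp P (xpast t) (indicator A') w = u (x w)"
  proof (rule G.real_cond_exp_charact[OF _ int[OF bA] int[OF uP] bdd_meas_measurable[OF uG]])
    fix C assume C: "C \<in> sets (xpast t)"
    then have CP: "bdd_meas P (indicator C)" using Gsub by (auto simp: subalgebra_def intro: bdd_meas_indicator)
    have "(\<integral>w. indicator C w * (indicator A0 (x w) - u (x w)) \<partial>P) = 0"
      using orthogonal_to_law[OF tN dN u(2)] C by (simp add: orthogonal_to_def)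
    moreover have "(\<integral>w. indicator C w * (indicator A0 (x w) - u (x w)) \<partial>P) =
        (\<integral>w. indicator C w * indicator A' w - indicator C w * u (x w) \<partial>P)"
      using iA by (intro Bochner_Integration.integral_cong) (simp_all add: algebra_simps)
    moreover have "\<dots> = (\<integral>w. indicator C w * indicator A' w \<partial>P) - (\<integral>w. indicator C w * u (x w) \<partial>P)"
      by (intro Bochner_Integration.integral_diff int bdd_meas_mult CP bA uP)
    ultimately show "(\<integral>w\<in>C. indicator A' w \<partial>P) = (\<integral>w\<in>C. u (x w) \<partial>P)"
      by (simp add: set_lebesgue_integral_def)
  qed
  have e2: "AE w in P. real_cond_exp P (xpast t) (indicator (A' \<inter> B')) w = u (x w) * g w"
  proof (rule G.real_cond_exp_charact[OF _ int[OF bAB] int[OF ugP] bdd_meas_measurable[OF ugG]])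
    fix C assume C: "C \<in> sets (xpast t)"
    then obtain D where D: "D \<in> sets (past X N t)" "C = x -` D \<inter> space P"
      using sets_xpast'[OF tN] by auto
    have CP: "bdd_meas P (indicator C)" using C Gsub by (auto simp: subalgebra_def intro: bdd_meas_indicator)
    have DN: "bdd_meas (borel_of (path_space N X)) (indicator D)"
      using D law_subalgebra[OF tN] by (auto simp: subalgebra_def intro: bdd_meas_indicator)
    \<comment> \<open>The factor \<open>indicator D\<close>, with \<open>D\<close> in the past of
      \<open>x\<close>, localises the test to the conditioning event \<open>C\<close> and preserves
      orthogonality.\<close>
    have "(\<integral>w. (indicator D (x w) * (indicator A0 (x w) - u (x w))) * indicator B0 (y w) \<partial>P) = 0"
      using na bdd_meas_mult[OF DN dN] orthogonal_to_indicator_mult[OF law_subalgebra[OF tN] u(2) D(1)]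
        bdd_meas_indicator[OF B0] unfolding nonanticipative_def by blast
    moreover have "(\<integral>w. indicator C w * indicator (A' \<inter> B') w \<partial>P) - (\<integral>w. (indicator C w * u (x w)) * indicator B' w \<partial>P)
      = (\<integral>w. (indicator D (x w) * (indicator A0 (x w) - u (x w))) * indicator B0 (y w) \<partial>P)"
    proof -
      have "indicator C w = (indicator D (x w) :: real)" if "w \<in> space P" for w
        using that D(2) by (simp add: indicator_def)
      then have "indicator C w * indicator (A' \<inter> B') w - (indicator C w * u (x w)) * indicator B' w =
        (indicator D (x w) * (indicator A0 (x w) - u (x w))) * indicator B0 (y w)" if "w \<in> space P" for w
        using iA[OF that] iB[OF that] that by (simp add: indicator_inter_arith algebra_simps)
      then have "(\<integral>w. (indicator D (x w) * (indicator A0 (x w) - u (x w))) * indicator B0 (y w) \<partial>P) =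
          (\<integral>w. indicator C w * indicator (A' \<inter> B') w - (indicator C w * u (x w)) * indicator B' w \<partial>P)"
        by (intro Bochner_Integration.integral_cong) auto
      also have "\<dots> = (\<integral>w. indicator C w * indicator (A' \<inter> B') w \<partial>P) - (\<integral>w. (indicator C w * u (x w)) * indicator B' w \<partial>P)"
        by (intro Bochner_Integration.integral_diff int bdd_meas_mult CP uP bB bAB)
      finally show ?thesis ..
    qed
    ultimately have "(\<integral>w. indicator C w * indicator (A' \<inter> B') w \<partial>P) = (\<integral>w. (indicator C w * u (x w)) * indicator B' w \<partial>P)"
      by simp
    also have "\<dots> = (\<integral>w. (indicator C w * u (x w)) * real_cond_exp P (xpast t) (indicator B') w \<partial>P)"
      using int[OF bdd_meas_mult[OF bdd_meas_mult[OF CP uP] bB]] C bdd_meas_measurable[OF uG] B'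
      by (intro G.real_cond_exp_intg(2)[symmetric]) auto
    also have "\<dots> = (\<integral>w. indicator C w * (u (x w) * g w) \<partial>P)"
    proof (rule integral_cong_AE)
      show "AE w in P. indicator C w * u (x w) * real_cond_exp P (xpast t) (indicator B') w
          = indicator C w * (u (x w) * g w)"
        using g(2) by eventually_elim simp
    qed (use bdd_meas_measurable[OF CP] bdd_meas_measurable[OF uP] bdd_meas_measurable[OF gP] in auto)
    finally show "(\<integral>w\<in>C. indicator (A' \<inter> B') w \<partial>P) = (\<integral>w\<in>C. u (x w) * g w \<partial>P)"
      by (simp add: set_lebesgue_integral_def)
  qed
  have "AE w in P. real_cond_exp P (xpast t) (indicator (A' \<inter> B')) w
    = real_cond_exp P (xpast t) (indicator A') w * real_cond_exp P (xpast t) (indicator B') w"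
    using e1 e2 g(2) by eventually_elim simp
  then show "AE w in P. real_cond_exp P (xpast t) (indicator (((\<lambda>w. x w (Suc t)) -` A \<inter> space P) \<inter>
      ((\<lambda>w. restrict (y w) {1..t}) -` B \<inter> space P))) w
    = real_cond_exp P (xpast t) (indicator ((\<lambda>w. x w (Suc t)) -` A \<inter> space P)) w
      * real_cond_exp P (xpast t) (indicator ((\<lambda>w. restrict (y w) {1..t}) -` B \<inter> space P)) w"
    unfolding A'_def B'_def .
qed

end

section \<open>Adapted partitions from bicausal couplings\<close>

text \<open>On the set \<open>B\<close> where the Radon-Nikodym density \<open>h\<close> exceeds 1,
  the integral of h - 1 is K(B) - M(B), which is not positive; so \<open>B\<close> is a null
  set.\<close>

lemma dominated_density:
  assumes M: "finite_measure M" and K: "sets K = sets M" and le: "\<And>B. B \<in> sets M \<Longrightarrow> emeasure K B \<le> emeasure M B"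
  obtains f :: "'a \<Rightarrow> real" where "f \<in> borel_measurable M" "\<And>x. 0 \<le> f x" "\<And>x. f x \<le> 1"
    "K = density M (\<lambda>x. ennreal (f x))"
proof -
  interpret finite_measure M by fact
  have ac: "absolutely_continuous M K"
    unfolding absolutely_continuous_def
  proof
    fix B assume B: "B \<in> null_sets M"
    then have "emeasure K B \<le> 0" using le[of B] by (metis null_setsD1 null_setsD2)
    then show "B \<in> null_sets K" using B K by (auto simp: null_sets_def)
  qed
  define h where "h = RN_deriv M K"
  have hm [measurable]: "h \<in> borel_measurable M" unfolding h_def by simp
  have K': "K = density M h" unfolding h_def using density_RN_deriv[OF ac K] by simp
  define B where "B = {x \<in> space M. 1 < h x}"
  have B [measurable]: "B \<in> sets M" unfolding B_def by measurable
  have fin: "(\<integral>\<^sup>+x. indicator B x \<partial>M) \<noteq> \<infinity>" by simp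
  have "(\<integral>\<^sup>+x. h x * indicator B x - indicator B x \<partial>M) = (\<integral>\<^sup>+x. h x * indicator B x \<partial>M) - (\<integral>\<^sup>+x. indicator B x \<partial>M)"
  proof (rule nn_integral_diff)
    show "AE x in M. indicator B x \<le> h x * indicator B x"
      by (rule AE_I2) (auto simp: B_def indicator_def)
  qed (use fin in auto)
  also have "(\<integral>\<^sup>+x. h x * indicator B x \<partial>M) = emeasure K B" unfolding K' by (simp add: emeasure_density)
  also have "emeasure K B - (\<integral>\<^sup>+x. indicator B x \<partial>M) = 0"
  proof -
    have "emeasure K B \<noteq> \<top>" using le[OF B] emeasure_finite[of B] by (metis top_unique)
    then show ?thesis using le[OF B] by (simp add: diff_eq_0_iff_ennreal less_top)
  qed
  finally have "AE x in M. h x * indicator B x - indicator B x = 0"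
    by (subst (asm) nn_integral_0_iff_AE) auto
  then have le1: "AE x in M. h x \<le> 1"
    using AE_space
  proof eventually_elim
    case (elim x)
    then show ?case
      by (cases "x \<in> B") (auto simp: B_def diff_eq_0_iff_ennreal not_le less_imp_le top_unique)
  qed
  show thesis
  \<comment> \<open>Truncation at 1 turns the almost sure bound into one at every point.\<close>
  proof (rule that[of "\<lambda>x. min 1 (enn2real (h x))"])
    have "AE x in M. h x = ennreal (min 1 (enn2real (h x)))"
      using le1
    proof eventually_elim
      case (elim x)
      then obtain r where "h x = ennreal r" "0 \<le> r" by (cases "h x") (auto simp: top_unique)
      then show ?case using elim by (simp add: min_def ennreal_le_1)
    qed
    then show "K = density M (\<lambda>x. ennreal (min 1 (enn2real (h x))))"
      unfolding K' by (intro density_cong) auto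
  qed auto
qed

text \<open>As a Markov kernel: from \<open>x\<close> choose the cell \<open>i\<close> with
  probability \<open>f i x\<close>, then draw a new point from the normalised density
  \<open>f i\<close>.\<close>

definition smoothing ::
  "'a measure \<Rightarrow> 'i set \<Rightarrow> ('i \<Rightarrow> 'a \<Rightarrow> real) \<Rightarrow> ('a \<Rightarrow> real) \<Rightarrow> 'a \<Rightarrow> real" where
  "smoothing M I f a x = (\<Sum>i\<in>I. f i x * ((\<integral>z. f i z * a z \<partial>M) / (\<integral>z. f i z \<partial>M)))"

text \<open>The last clause states adaptedness in dual form, since \<open>smoothing M I f a\<close>
  need only agree almost everywhere with a function of the past. Positive masses make the quotients
  in \<open>smoothing\<close> meaningful. The index type is free; in the application the indices are
  the support points themselves.\<close>

definition adapted_partition ::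
  "(nat \<Rightarrow> 'a topology) \<Rightarrow> nat \<Rightarrow> (nat \<Rightarrow> 'a) measure \<Rightarrow> 'i set \<Rightarrow> ('i \<Rightarrow> (nat \<Rightarrow> 'a) \<Rightarrow> real) \<Rightarrow> bool" where
  "adapted_partition X N M I f \<longleftrightarrow> finite I \<and>
     (\<forall>i\<in>I. f i \<in> borel_measurable M \<and> (\<forall>x. 0 \<le> f i x \<and> f i x \<le> 1) \<and> (\<integral>x. f i x \<partial>M) > 0) \<and>
     (AE x in M. (\<Sum>i\<in>I. f i x) = 1) \<and>
     (\<forall>t\<in>{1..<N}. \<forall>u a. bdd_meas M u \<longrightarrow> orthogonal_to M (past X N t) u \<longrightarrow> bdd_meas (past X N t) a \<longrightarrow>
        (\<integral>x. u x * smoothing M I f a x \<partial>M) = 0)"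

lemma bicausal_imp_nonanticipative:
  assumes X: "\<And>t. t \<in> {1..N} \<Longrightarrow> polish (X t)" and G: "G \<in> version_couplings Bicausal N X X M' M"
    and t: "t \<in> {1..<N}"
  shows "nonanticipative X X N G fst snd t" "nonanticipative X X N G snd fst t"
proof -
  have G': "prob_space G" "sets G = sets (borel_of (prod_topology (path_space N X) (path_space N X)))"
    and c: "causal N X X G" "anticausal N X X G"
    using G by (auto simp: version_couplings_def couplings_def prob_measures_def)
  have m: "fst \<in> G \<rightarrow>\<^sub>M borel_of (path_space N X)" "snd \<in> G \<rightarrow>\<^sub>M borel_of (path_space N X)"
    using continuous_map_measurable[OF continuous_map_fst[of "path_space N X" "path_space N X"]]
      continuous_map_measurable[OF continuous_map_snd[of "path_space N X" "path_space N X"]]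
      measurable_cong_sets[OF G'(2) refl] by auto
  show "nonanticipative X X N G fst snd t"
    using c(1) by (intro cond_indep_imp_nonanticipative[OF X G'(1) m _ t]) (auto simp: causal_def)
  show "nonanticipative X X N G snd fst t"
    using c(2) by (intro cond_indep_imp_nonanticipative[OF X G'(1) m(2,1) _ t]) (auto simp: anticausal_def)
qed

text \<open>\<open>f i x\<close> is the conditional probability of \<open>fst = i\<close> given
  \<open>snd = x\<close>. The smoothing of \<open>a\<close> is then E[ E[a(snd) | fst] | snd ], and
  each half of bicausality handles one of the two conditional expectations.\<close>

lemma adapted_partition_of_coupling:
  fixes d :: "(nat \<Rightarrow> 'a) \<Rightarrow> (nat \<Rightarrow> 'a) \<Rightarrow> real"
  assumes X: "\<And>t. t \<in> {1..N} \<Longrightarrow> polish (X t)"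
    and d: "metric_inducing (path_space N X) d"
    and M': "M' \<in> prob_measures (path_space N X)" "finitely_supported M'"
    and M: "M \<in> prob_measures (path_space N X)"
    and G: "G \<in> version_couplings Bicausal N X X M' M"
  obtains I f where "adapted_partition X N M I f" "I \<subseteq> topspace (path_space N X)"
    "(\<Sum>i\<in>I. \<integral>\<^sup>+x. ennreal (f i x) * ennreal (d i x powr p) \<partial>M) \<le> (\<integral>\<^sup>+w. ennreal (d (fst w) (snd w) powr p) \<partial>G)"
proof -
  let ?S = "path_space N X"
  have G': "prob_space G" "sets G = sets (borel_of (prod_topology ?S ?S))"
    and marg: "distr G (borel_of ?S) fst = M'" "distr G (borel_of ?S) snd = M"
    using G by (auto simp: version_couplings_def couplings_def prob_measures_def)
  interpret G: prob_space G by fact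
  have sM': "sets M' = sets (borel_of ?S)" and sM: "sets M = sets (borel_of ?S)"
    and pM': "prob_space M'" and pM: "prob_space M" using M' M by (auto simp: prob_measures_def)
  interpret M': prob_space M' by fact
  interpret M: prob_space M by fact
  have spM': "space M' = topspace ?S" and spM: "space M = topspace ?S"
    using sets_eq_imp_space_eq[OF sM'] sets_eq_imp_space_eq[OF sM] by auto
  have fstm: "fst \<in> G \<rightarrow>\<^sub>M borel_of ?S" and sndm: "snd \<in> G \<rightarrow>\<^sub>M borel_of ?S"
    using continuous_map_measurable[OF continuous_map_fst[of ?S ?S]]
      continuous_map_measurable[OF continuous_map_snd[of ?S ?S]]
      measurable_cong_sets[OF G'(2) refl] by auto
  have fstM' [measurable]: "fst \<in> G \<rightarrow>\<^sub>M M'" and sndM [measurable]: "snd \<in> G \<rightarrow>\<^sub>M M"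
    using fstm sndm measurable_cong_sets[OF refl sM'] measurable_cong_sets[OF refl sM] by auto
  have bddM: "bdd_meas M f \<longleftrightarrow> bdd_meas (borel_of ?S) f" "bdd_meas M' f \<longleftrightarrow> bdd_meas (borel_of ?S) f" for f
    using bdd_meas_cong_sets[OF sM] bdd_meas_cong_sets[OF sM'] by auto
  note Gint = bdd_meas_integrable[OF G.finite_measure_axioms]
  note Mint = bdd_meas_integrable[OF M.finite_measure_axioms]
  note M'int = bdd_meas_integrable[OF M'.finite_measure_axioms]
  have single: "{i} \<in> sets M'" if "i \<in> topspace ?S" for i
  proof -
    have "closedin ?S {i}"
      using metrizable_imp_t1_space[OF path_space_metrizable[OF X]] that
      by (auto simp: t1_space_closedin_singleton)
    then show ?thesis using closedin_sets_borel_of sM' by blast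
  qed
  obtain A where A: "A \<in> sets M'" "finite A" "emeasure M' (space M' - A) = 0"
    using M'(2) unfolding finitely_supported_def by blast
  have AS: "A \<subseteq> topspace ?S" using sets.sets_into_space[OF A(1)] spM' by simp
  \<comment> \<open>Atoms of mass 0 are dropped, because the masses become denominators in
    \<open>smoothing\<close>.\<close>
  define I where "I = {i \<in> A. measure M' {i} > 0}"
  have IS: "I \<subseteq> topspace ?S" and finI: "finite I" using AS A(2) by (auto simp: I_def)
  have AEI': "AE z in M'. z \<in> I"
  proof -
    have "AE z in M'. z \<notin> space M' - A"
      using A(1,3) by (intro AE_not_in) auto
    moreover have "AE z in M'. \<forall>i\<in>A - I. z \<noteq> i"
    proof (rule AE_finite_allI)
      show "finite (A - I)" using A(2) by simp
      fix i assume i: "i \<in> A - I"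
      then have "measure M' {i} = 0" unfolding I_def using measure_nonneg[of M' "{i}"] by (auto simp: less_le)
      then have "emeasure M' {i} = 0" by (simp add: M'.emeasure_eq_measure)
      then have "{i} \<in> null_sets M'" using single[of i] AS i by auto
      from AE_not_in[OF this] show "AE z in M'. z \<noteq> i" by simp
    qed
    ultimately show ?thesis using AE_space by eventually_elim auto
  qed
  have AEI: "AE w in G. fst w \<in> I"
    using AEI' unfolding marg(1)[symmetric] by (rule AE_distrD[OF fstm])
  \<comment> \<open>Restricting \<open>G\<close> to \<open>fst = i\<close> and projecting to the
    second factor gives a measure dominated by \<open>M\<close>; its density will be
    \<open>f i\<close>.\<close>
  have ex: "\<exists>f. f \<in> borel_measurable M \<and> (\<forall>x. 0 \<le> f x \<and> f x \<le> (1::real)) \<and>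
     distr (density G (\<lambda>w. indicator {i} (fst w))) M snd = density M (\<lambda>x. ennreal (f x))" if i: "i \<in> I" for i
  proof -
    let ?D = "density G (\<lambda>w. indicator {i} (fst w))"
    have si: "{i} \<in> sets M'" using single IS i by blast
    have im: "(\<lambda>w. indicator {i} (fst w) :: ennreal) \<in> borel_measurable G"
      using si by (intro measurable_compose[OF fstM' borel_measurable_indicator])
    have sD: "snd \<in> ?D \<rightarrow>\<^sub>M M" using sndM by simp
    have le: "emeasure (distr ?D M snd) B \<le> emeasure M B" if B: "B \<in> sets M" for B
    proof -
      have Bs: "snd -` B \<inter> space G \<in> sets G" using measurable_sets[OF sndM B] .
      have "emeasure (distr ?D M snd) B = emeasure ?D (snd -` B \<inter> space G)"
        using B sD by (simp add: emeasure_distr)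
      also have "\<dots> = (\<integral>\<^sup>+w. indicator {i} (fst w) * indicator (snd -` B \<inter> space G) w \<partial>G)"
        using im Bs by (simp add: emeasure_density)
      also have "\<dots> \<le> (\<integral>\<^sup>+w. indicator (snd -` B \<inter> space G) w \<partial>G)"
        by (intro nn_integral_mono) (auto simp: indicator_def)
      also have "\<dots> = emeasure G (snd -` B \<inter> space G)" using Bs by simp
      also have "\<dots> = emeasure (distr G (borel_of ?S) snd) B"
        using B sM by (simp add: emeasure_distr[OF sndm])
      also have "\<dots> = emeasure M B" unfolding marg(2) ..
      finally show ?thesis .
    qed
    show ?thesis
    proof (rule dominated_density[OF M.finite_measure_axioms _ le])
      fix f :: "(nat \<Rightarrow> 'a) \<Rightarrow> real"
      assume "f \<in> borel_measurable M" "\<And>x. 0 \<le> f x" "\<And>x. f x \<le> 1"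
        "distr ?D M snd = density M (\<lambda>x. ennreal (f x))"
      then show ?thesis by blast
    qed simp_all
  qed
  then obtain f where fm: "\<And>i. i \<in> I \<Longrightarrow> f i \<in> borel_measurable M"
    and f01: "\<And>i x. i \<in> I \<Longrightarrow> 0 \<le> f i x \<and> f i x \<le> (1::real)"
    and fd: "\<And>i. i \<in> I \<Longrightarrow> distr (density G (\<lambda>w. indicator {i} (fst w))) M snd = density M (\<lambda>x. ennreal (f i x))"
    by metis
  have im: "(\<lambda>w. indicator {i} (fst w) :: real) \<in> borel_measurable G" "(\<lambda>w. indicator {i} (fst w) :: ennreal) \<in> borel_measurable G"
    if "i \<in> I" for i
    using single[of i] IS that by (auto intro!: measurable_compose[OF fstM' borel_measurable_indicator])
  have ind_b: "bdd_meas G (\<lambda>w. indicator {i} (fst w))" if "i \<in> I" for i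
    using im(1)[OF that] by (intro bdd_measI[of _ _ 1]) (auto simp: indicator_def)
  have fb: "bdd_meas M (f i)" if "i \<in> I" for i
    using fm[OF that] f01[OF that] by (intro bdd_measI[of _ _ 1]) auto
  \<comment> \<open>A dictionary: weighting by \<open>f i\<close> under \<open>M\<close> is
    restricting to the slice \<open>fst = i\<close> under \<open>G\<close>.\<close>
  have key: "(\<integral>w. indicator {i} (fst w) * a (snd w) \<partial>G) = (\<integral>x. f i x * a x \<partial>M)"
    if i: "i \<in> I" and a: "bdd_meas M a" for i a
  proof -
    have am: "a \<in> borel_measurable M" using bdd_meas_measurable[OF a] .
    have "(\<integral>x. f i x * a x \<partial>M) = (\<integral>x. a x \<partial>density M (\<lambda>x. ennreal (f i x)))"
      using fm[OF i] f01[OF i] am by (subst integral_real_density) auto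
    also have "\<dots> = (\<integral>w. a (snd w) \<partial>density G (\<lambda>w. indicator {i} (fst w)))"
      unfolding fd[OF i, symmetric] using am by (intro integral_distr) auto
    also have "density G (\<lambda>w. indicator {i} (fst w)) = density G (\<lambda>w. ennreal (indicator {i} (fst w)))"
      by (simp add: ennreal_indicator)
    also have "(\<integral>w. a (snd w) \<partial>density G (\<lambda>w. ennreal (indicator {i} (fst w)))) = (\<integral>w. indicator {i} (fst w) * a (snd w) \<partial>G)"
      using im(1)[OF i] measurable_compose[OF sndM am] by (subst integral_real_density) auto
    finally show ?thesis ..
  qed
  have nnkey: "(\<integral>\<^sup>+w. indicator {i} (fst w) * a (snd w) \<partial>G) = (\<integral>\<^sup>+x. ennreal (f i x) * a x \<partial>M)"
    if i: "i \<in> I" and am: "a \<in> borel_measurable M" for i a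
  proof -
    have "(\<integral>\<^sup>+x. ennreal (f i x) * a x \<partial>M) = (\<integral>\<^sup>+x. a x \<partial>density M (\<lambda>x. ennreal (f i x)))"
      using fm[OF i] am by (subst nn_integral_density) auto
    also have "\<dots> = (\<integral>\<^sup>+w. a (snd w) \<partial>density G (\<lambda>w. indicator {i} (fst w)))"
      unfolding fd[OF i, symmetric] using am by (intro nn_integral_distr) auto
    also have "\<dots> = (\<integral>\<^sup>+w. indicator {i} (fst w) * a (snd w) \<partial>G)"
      using im(2)[OF i] measurable_compose[OF sndM am] by (subst nn_integral_density) auto
    finally show ?thesis ..
  qed
  have m_eq: "(\<integral>x. f i x \<partial>M) = measure M' {i}" if i: "i \<in> I" for i
  proof -
    have si: "{i} \<in> sets M'" using single IS i by blast
    have "(\<integral>x. f i x \<partial>M) = (\<integral>w. indicator {i} (fst w) \<partial>G)" using key[OF i, of "\<lambda>_. 1"] by simp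
    also have "\<dots> = (\<integral>z. indicator {i} z \<partial>distr G (borel_of ?S) fst)"
      using si sM' by (intro integral_distr[symmetric] fstm) auto
    also have "\<dots> = measure M' {i}" unfolding marg(1) using si sets.sets_into_space[OF si] by (simp add: Int_absorb2)
    finally show ?thesis .
  qed
  have m_pos: "(\<integral>x. f i x \<partial>M) > 0" if i: "i \<in> I" for i using m_eq[OF i] i by (simp add: I_def)
  have sum_ind: "(\<Sum>i\<in>I. indicator {i} z * b i) = b z" if "z \<in> I" for z and b :: "_ \<Rightarrow> real"
  proof -
    have "(\<Sum>i\<in>I. indicator {i} z * b i) = (\<Sum>i\<in>I. if i = z then b i else 0)"
      by (intro sum.cong) (auto simp: indicator_def)
    then show ?thesis using that finI by simp
  qed
  \<comment> \<open>With s = (sum of the \<open>f i\<close>) - 1, the dictionary gives int (sum of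
    the \<open>f i\<close>) s dM = int s dM, because \<open>fst\<close> lies in \<open>I\<close>
    almost surely. Hence int s^2 dM = 0.\<close>
  have sum1: "AE x in M. (\<Sum>i\<in>I. f i x) = 1"
  proof -
    let ?s = "\<lambda>x. (\<Sum>i\<in>I. f i x) - 1"
    have sb: "bdd_meas M ?s" by (intro bdd_meas_diff bdd_meas_sum fb bdd_meas_const)
    have "(\<integral>x. ?s x * ?s x \<partial>M) = (\<Sum>i\<in>I. \<integral>x. f i x * ?s x \<partial>M) - (\<integral>x. ?s x \<partial>M)"
    proof -
      have "(\<integral>x. ?s x * ?s x \<partial>M) = (\<integral>x. (\<Sum>i\<in>I. f i x * ?s x) - ?s x \<partial>M)"
        by (intro Bochner_Integration.integral_cong) (auto simp: sum_distrib_right left_diff_distrib)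
      also have "\<dots> = (\<integral>x. (\<Sum>i\<in>I. f i x * ?s x) \<partial>M) - (\<integral>x. ?s x \<partial>M)"
        by (intro Bochner_Integration.integral_diff Mint bdd_meas_sum bdd_meas_mult fb sb)
      also have "(\<integral>x. (\<Sum>i\<in>I. f i x * ?s x) \<partial>M) = (\<Sum>i\<in>I. \<integral>x. f i x * ?s x \<partial>M)"
        by (intro Bochner_Integration.integral_sum Mint bdd_meas_mult fb sb)
      finally show ?thesis .
    qed
    also have "(\<Sum>i\<in>I. \<integral>x. f i x * ?s x \<partial>M) = (\<Sum>i\<in>I. \<integral>w. indicator {i} (fst w) * ?s (snd w) \<partial>G)"
      by (intro sum.cong key[symmetric] sb) auto
    also have "\<dots> = (\<integral>w. (\<Sum>i\<in>I. indicator {i} (fst w) * ?s (snd w)) \<partial>G)"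
      by (intro Bochner_Integration.integral_sum[symmetric] Gint bdd_meas_mult ind_b bdd_meas_comp[OF sb sndM])
    also have "\<dots> = (\<integral>w. ?s (snd w) \<partial>G)"
    proof (rule integral_cong_AE)
      show "(\<lambda>w. \<Sum>i\<in>I. indicator {i} (fst w) * ?s (snd w)) \<in> borel_measurable G"
        by (intro bdd_meas_measurable bdd_meas_sum bdd_meas_mult ind_b bdd_meas_comp[OF sb sndM])
      show "(\<lambda>w. ?s (snd w)) \<in> borel_measurable G"
        by (intro bdd_meas_measurable bdd_meas_comp[OF sb sndM])
      show "AE w in G. (\<Sum>i\<in>I. indicator {i} (fst w) * ?s (snd w)) = ?s (snd w)"
        using AEI by eventually_elim (rule sum_ind)
    qed
    also have "\<dots> = (\<integral>x. ?s x \<partial>distr G (borel_of ?S) snd)"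
      using bdd_meas_measurable[OF sb] measurable_cong_sets[OF sM refl, of borel]
      by (intro integral_distr[symmetric] sndm) auto
    also have "\<dots> = (\<integral>x. ?s x \<partial>M)" unfolding marg(2) ..
    finally have "(\<integral>x. ?s x * ?s x \<partial>M) = 0" by simp
    from integral_square_eq_0_AE[OF M.finite_measure_axioms sb this]
    show ?thesis by eventually_elim simp
  qed
  have adapted: "(\<integral>x. u x * smoothing M I f a x \<partial>M) = 0"
    if t: "t \<in> {1..<N}" and u: "bdd_meas M u" "orthogonal_to M (past X N t) u" and a: "bdd_meas (past X N t) a" for t u a
  proof -
    have tN: "t \<le> N" using t by simp
    have aM: "bdd_meas M a" using subalgebra_bdd_meas[OF subalgebra_past[OF sM tN] a] .
    define c where "c i = (\<integral>z. f i z * a z \<partial>M) / (\<integral>z. f i z \<partial>M)" for i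
    \<comment> \<open>On the support, \<open>v\<close> is the conditional expectation
      E[a(snd) | fst].\<close>
    define v where "v z = (\<Sum>i\<in>I. indicator {i} z * c i)" for z
    have indM': "bdd_meas M' (indicator {i})" if "i \<in> I" for i using single IS that by (intro bdd_meas_indicator) auto
    have vb: "bdd_meas M' v" unfolding v_def by (intro bdd_meas_sum bdd_meas_mult indM' bdd_meas_const)
    \<comment> \<open>First half of bicausality: the integral equals that of \<open>q\<close> in
      \<open>fst\<close> against \<open>a\<close> in \<open>snd\<close>, which vanishes. So
      \<open>v\<close> agrees almost everywhere with a function of the past.\<close>
    have vorth: "(\<integral>z. q z * v z \<partial>M') = 0" if q: "bdd_meas M' q" "orthogonal_to M' (past X N t) q" for q
    proof -
      have "(\<integral>z. q z * v z \<partial>M') = (\<integral>z. (\<Sum>i\<in>I. (q i * c i) * indicator {i} z) \<partial>M')"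
        unfolding v_def by (intro Bochner_Integration.integral_cong) (auto simp: sum_distrib_left indicator_def intro!: sum.cong)
      also have "\<dots> = (\<Sum>i\<in>I. \<integral>z. (q i * c i) * indicator {i} z \<partial>M')"
        by (intro Bochner_Integration.integral_sum M'int bdd_meas_mult indM' bdd_meas_const)
      also have "\<dots> = (\<Sum>i\<in>I. q i * (\<integral>x. f i x * a x \<partial>M))"
      proof (intro sum.cong refl)
        fix i assume i: "i \<in> I"
        have "(\<integral>z. (q i * c i) * indicator {i} z \<partial>M') = (q i * c i) * measure M' {i}"
          using IS i spM' by auto
        also have "\<dots> = q i * (\<integral>x. f i x * a x \<partial>M)" unfolding c_def m_eq[OF i, symmetric] using m_pos[OF i] by simp
        finally show "(\<integral>z. (q i * c i) * indicator {i} z \<partial>M') = q i * (\<integral>x. f i x * a x \<partial>M)" .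
      qed
      also have "\<dots> = (\<Sum>i\<in>I. \<integral>w. q i * (indicator {i} (fst w) * a (snd w)) \<partial>G)"
        using key[OF _ aM] by (intro sum.cong) simp_all
      also have "\<dots> = (\<integral>w. (\<Sum>i\<in>I. q i * (indicator {i} (fst w) * a (snd w))) \<partial>G)"
        by (intro Bochner_Integration.integral_sum[symmetric] Gint bdd_meas_mult ind_b bdd_meas_const bdd_meas_comp[OF aM sndM])
      also have "\<dots> = (\<integral>w. q (fst w) * a (snd w) \<partial>G)"
      proof (rule integral_cong_AE)
        show "(\<lambda>w. \<Sum>i\<in>I. q i * (indicator {i} (fst w) * a (snd w))) \<in> borel_measurable G"
          by (intro bdd_meas_measurable bdd_meas_sum bdd_meas_mult ind_b bdd_meas_const bdd_meas_comp[OF aM sndM])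
        show "(\<lambda>w. q (fst w) * a (snd w)) \<in> borel_measurable G"
          by (intro bdd_meas_measurable bdd_meas_mult bdd_meas_comp[OF aM sndM] bdd_meas_comp[OF q(1) fstM'])
        show "AE w in G. (\<Sum>i\<in>I. q i * (indicator {i} (fst w) * a (snd w))) = q (fst w) * a (snd w)"
          using AEI
        proof eventually_elim
          case (elim w)
          show ?case using sum_ind[OF elim, of "\<lambda>i. q i * a (snd w)"] by (simp add: mult_ac)
        qed
      qed
      also have "\<dots> = 0"
        using bicausal_imp_nonanticipative(1)[OF X G t] q a bddM(2) marg(1) unfolding nonanticipative_def by blast
      finally show ?thesis .
    qed
    obtain v' where v': "bdd_meas (past X N t) v'" "AE z in M'. v z = v' z"
      using AE_eq_subalgebra_measurable[OF M'.finite_measure_axioms subalgebra_past[OF sM' tN] vb vorth] by blast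
    have v'M': "bdd_meas M' v'" using subalgebra_bdd_meas[OF subalgebra_past[OF sM' tN] v'(1)] .
    have AEv: "AE w in G. v (fst w) = v' (fst w)"
      using v'(2) unfolding marg(1)[symmetric] by (rule AE_distrD[OF fstm])
    \<comment> \<open>Second half of bicausality: the integral becomes that of \<open>u\<close> in
      \<open>snd\<close> against the past-measurable \<open>v'\<close> in
      \<open>fst\<close>.\<close>
    have "(\<integral>x. u x * smoothing M I f a x \<partial>M) = (\<integral>x. (\<Sum>i\<in>I. c i * (f i x * u x)) \<partial>M)"
      unfolding smoothing_def c_def by (intro Bochner_Integration.integral_cong) (simp_all add: sum_distrib_left mult_ac)
    also have "\<dots> = (\<Sum>i\<in>I. \<integral>x. c i * (f i x * u x) \<partial>M)"
      by (intro Bochner_Integration.integral_sum Mint bdd_meas_mult bdd_meas_const fb u)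
    also have "\<dots> = (\<Sum>i\<in>I. \<integral>w. c i * (indicator {i} (fst w) * u (snd w)) \<partial>G)"
      using key[OF _ u(1)] by (intro sum.cong) simp_all
    also have "\<dots> = (\<integral>w. (\<Sum>i\<in>I. c i * (indicator {i} (fst w) * u (snd w))) \<partial>G)"
      by (intro Bochner_Integration.integral_sum[symmetric] Gint bdd_meas_mult ind_b bdd_meas_const bdd_meas_comp[OF u(1) sndM])
    also have "\<dots> = (\<integral>w. u (snd w) * v' (fst w) \<partial>G)"
    proof (rule integral_cong_AE)
      show "(\<lambda>w. \<Sum>i\<in>I. c i * (indicator {i} (fst w) * u (snd w))) \<in> borel_measurable G"
        by (intro bdd_meas_measurable bdd_meas_sum bdd_meas_mult ind_b bdd_meas_const bdd_meas_comp[OF u(1) sndM])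
      show "(\<lambda>w. u (snd w) * v' (fst w)) \<in> borel_measurable G"
        by (intro bdd_meas_measurable bdd_meas_mult bdd_meas_comp[OF u(1) sndM] bdd_meas_comp[OF v'M' fstM'])
      show "AE w in G. (\<Sum>i\<in>I. c i * (indicator {i} (fst w) * u (snd w))) = u (snd w) * v' (fst w)"
        using AEv
      proof eventually_elim
        case (elim w)
        show ?case unfolding elim[symmetric] v_def by (simp add: sum_distrib_left mult_ac)
      qed
    qed
    also have "\<dots> = 0"
      using bicausal_imp_nonanticipative(2)[OF X G t] u v'(1) bddM(1) marg(2) unfolding nonanticipative_def by blast
    finally show ?thesis .
  qed
  have part: "adapted_partition X N M I f"
    unfolding adapted_partition_def using finI fm f01 m_pos sum1 adapted by blast
  have metric: "Metric_space (topspace ?S) d" "Metric_space.mtopology (topspace ?S) d = ?S"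
    using d by (auto simp: metric_inducing_def)
  interpret Metric_space "topspace ?S" d by fact
  have dm: "(\<lambda>x. ennreal (d i x powr p)) \<in> borel_measurable M" if "i \<in> I" for i
  proof -
    have "continuous_map ?S euclideanreal (d i)"
    proof -
      have "\<bar>d i x - d i y\<bar> \<le> 1 * d x y" if "x \<in> topspace ?S" "y \<in> topspace ?S" for x y
        using triangle[of i x y] triangle[of i y x] that IS \<open>i \<in> I\<close> by (auto simp: commute abs_le_iff)
      from lipschitz_imp_continuous_map[OF metric(1) this] show ?thesis using metric(2) by simp
    qed
    then have "d i \<in> borel_measurable M"
      using continuous_map_borel_measurable measurable_cong_sets[OF sM refl, of borel] by blast
    then show ?thesis by measurable
  qed
  have "(\<Sum>i\<in>I. \<integral>\<^sup>+x. ennreal (f i x) * ennreal (d i x powr p) \<partial>M) =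
      (\<Sum>i\<in>I. \<integral>\<^sup>+w. indicator {i} (fst w) * ennreal (d i (snd w) powr p) \<partial>G)"
    using nnkey[OF _ dm] by (intro sum.cong) simp_all
  also have "\<dots> = (\<integral>\<^sup>+w. (\<Sum>i\<in>I. indicator {i} (fst w) * ennreal (d i (snd w) powr p)) \<partial>G)"
    using im(2) measurable_compose[OF sndM dm] by (intro nn_integral_sum[symmetric] borel_measurable_times_ennreal) auto
  \<comment> \<open>Only an inequality pointwise: when \<open>fst w\<close> lies outside
    \<open>I\<close>, the left side is 0.\<close>
  also have "\<dots> \<le> (\<integral>\<^sup>+w. ennreal (d (fst w) (snd w) powr p) \<partial>G)"
  proof (intro nn_integral_mono)
    fix w
    have "(\<Sum>i\<in>I. indicator {i} (fst w) * ennreal (d i (snd w) powr p)) =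
        (\<Sum>i\<in>I. if i = fst w then ennreal (d (fst w) (snd w) powr p) else 0)"
      by (intro sum.cong) (auto simp: indicator_def)
    also have "\<dots> \<le> ennreal (d (fst w) (snd w) powr p)" using finI by simp
    finally show "(\<Sum>i\<in>I. indicator {i} (fst w) * ennreal (d i (snd w) powr p)) \<le> ennreal (d (fst w) (snd w) powr p)" .
  qed
  finally show thesis using that[OF part IS] by blast
qed

section \<open>Smoothing operators\<close>

lemma integrable_bdd_meas_mult:
  assumes "bdd_meas M a" "integrable M f"
  shows "integrable M (\<lambda>x. a x * f x)"
proof -
  obtain K where K: "\<And>x. x \<in> space M \<Longrightarrow> \<bar>a x\<bar> \<le> K" using bdd_meas_bound[OF assms(1)] by blast
  show ?thesis
  proof (rule Bochner_Integration.integrable_bound[of M "\<lambda>x. K * f x"])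
    show "integrable M (\<lambda>x. K * f x)" using assms(2) by simp
    show "(\<lambda>x. a x * f x) \<in> borel_measurable M"
      using bdd_meas_measurable[OF assms(1)] assms(2) by auto
    show "AE x in M. norm (a x * f x) \<le> norm (K * f x)"
    proof (rule AE_I2)
      fix x assume "x \<in> space M"
      then have "\<bar>a x\<bar> * \<bar>f x\<bar> \<le> \<bar>K\<bar> * \<bar>f x\<bar>" using K[of x] by (intro mult_right_mono) auto
      then show "norm (a x * f x) \<le> norm (K * f x)" by (simp add: abs_mult)
    qed
  qed
qed

lemma integral_pair_mult:
  fixes f :: "'a \<Rightarrow> real" and g :: "'b \<Rightarrow> real"
  assumes M: "prob_space M" "prob_space M'" and f: "integrable M f" and g: "bdd_meas M' g"
  shows "integrable (M \<Otimes>\<^sub>M M') (\<lambda>z. f (fst z) * g (snd z))"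
    "(\<integral>z. f (fst z) * g (snd z) \<partial>(M \<Otimes>\<^sub>M M')) = (\<integral>x. f x \<partial>M) * (\<integral>y. g y \<partial>M')"
proof -
  interpret M: prob_space M by fact
  interpret M': prob_space M' by fact
  interpret pair_prob_space M M' ..
  have "integrable (distr (M \<Otimes>\<^sub>M M') M fst) f" by (subst M'.distr_pair_fst) (rule f)
  then have "integrable (M \<Otimes>\<^sub>M M') (\<lambda>z. f (fst z))"
    using f by (subst (asm) integrable_distr_eq) auto
  from integrable_bdd_meas_mult[OF bdd_meas_comp[OF g measurable_snd] this]
  show i: "integrable (M \<Otimes>\<^sub>M M') (\<lambda>z. f (fst z) * g (snd z))" by (simp add: mult.commute)
  have "(\<integral>z. f (fst z) * g (snd z) \<partial>(M \<Otimes>\<^sub>M M')) = (\<integral>x. (\<integral>y. f x * g y \<partial>M') \<partial>M)"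
    using integral_fst'[OF i] by simp
  then show "(\<integral>z. f (fst z) * g (snd z) \<partial>(M \<Otimes>\<^sub>M M')) = (\<integral>x. f x \<partial>M) * (\<integral>y. g y \<partial>M')" by simp
qed

lemma integral_pair_mult':
  fixes f :: "'a \<Rightarrow> real" and g :: "'b \<Rightarrow> real"
  assumes M: "prob_space M" "prob_space M'" and f: "bdd_meas M f" and g: "integrable M' g"
  shows "integrable (M \<Otimes>\<^sub>M M') (\<lambda>z. f (fst z) * g (snd z))"
    "(\<integral>z. f (fst z) * g (snd z) \<partial>(M \<Otimes>\<^sub>M M')) = (\<integral>x. f x \<partial>M) * (\<integral>y. g y \<partial>M')"
proof -
  interpret M: prob_space M by fact
  interpret M': prob_space M' by fact
  interpret pair_prob_space M M' ..
  interpret Q: pair_prob_space M' M ..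
  note sw = integral_pair_mult[OF M(2,1) g f]
  have m: "(\<lambda>z. f (fst z) * g (snd z)) \<in> borel_measurable (M \<Otimes>\<^sub>M M')"
    using bdd_meas_measurable[OF f] g by (intro borel_measurable_times) auto
  have c: "(\<lambda>(x, y). f (fst (y, x)) * g (snd (y, x))) = (\<lambda>z. g (fst z) * f (snd z))"
    by (auto simp: fun_eq_iff)
  show "integrable (M \<Otimes>\<^sub>M M') (\<lambda>z. f (fst z) * g (snd z))"
    using Q.integrable_product_swap[OF sw(1)] by (simp add: case_prod_beta' mult.commute)
  have "(\<integral>z. f (fst z) * g (snd z) \<partial>(M \<Otimes>\<^sub>M M')) = (\<integral>z. g (fst z) * f (snd z) \<partial>(M' \<Otimes>\<^sub>M M))"
    using Q.integral_product_swap[of "\<lambda>z. g (fst z) * f (snd z)"] sw(1) borel_measurable_integrable[OF sw(1)]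
    by (simp add: case_prod_beta' mult.commute)
  then show "(\<integral>z. f (fst z) * g (snd z) \<partial>(M \<Otimes>\<^sub>M M')) = (\<integral>x. f x \<partial>M) * (\<integral>y. g y \<partial>M')"
    using sw(2) by simp
qed

context
  fixes X :: "nat \<Rightarrow> 'a topology" and N :: nat and M :: "(nat \<Rightarrow> 'a) measure"
    and I :: "'i set" and f :: "'i \<Rightarrow> (nat \<Rightarrow> 'a) \<Rightarrow> real"
  assumes M: "prob_space M" and part: "adapted_partition X N M I f"
begin

interpretation prob_space M by (rule M)

lemma partition_bdd_meas: "i \<in> I \<Longrightarrow> bdd_meas M (f i)"
  using part by (intro bdd_measI[of _ _ 1]) (auto simp: adapted_partition_def)

lemma partition_nonneg: "i \<in> I \<Longrightarrow> 0 \<le> f i x" "i \<in> I \<Longrightarrow> f i x \<le> 1"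
  using part by (auto simp: adapted_partition_def)

lemma partition_pos: "i \<in> I \<Longrightarrow> (\<integral>x. f i x \<partial>M) > 0"
  using part by (auto simp: adapted_partition_def)

lemma partition_sum: "AE x in M. (\<Sum>i\<in>I. f i x) = 1"
  using part by (auto simp: adapted_partition_def)

lemma partition_finite: "finite I"
  using part by (auto simp: adapted_partition_def)

lemma smoothing_bdd_meas: "bdd_meas M (smoothing M I f a)"
  unfolding smoothing_def by (intro bdd_meas_sum bdd_meas_mult partition_bdd_meas bdd_meas_const)

text \<open>The right-hand side is symmetric in \<open>a\<close> and \<open>b\<close>; this is the
  source of self-adjointness.\<close>

lemma smoothing_integral:
  assumes a: "bdd_meas M a"
  shows "(\<integral>x. a x * smoothing M I f b x \<partial>M) =
    (\<Sum>i\<in>I. (\<integral>x. f i x * a x \<partial>M) * (\<integral>x. f i x * b x \<partial>M) / (\<integral>x. f i x \<partial>M))"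
proof -
  have "(\<integral>x. a x * smoothing M I f b x \<partial>M) =
      (\<integral>x. (\<Sum>i\<in>I. ((\<integral>z. f i z * b z \<partial>M) / (\<integral>z. f i z \<partial>M)) * (f i x * a x)) \<partial>M)"
    unfolding smoothing_def by (intro Bochner_Integration.integral_cong) (simp_all add: sum_distrib_left mult_ac)
  also have "\<dots> = (\<Sum>i\<in>I. \<integral>x. ((\<integral>z. f i z * b z \<partial>M) / (\<integral>z. f i z \<partial>M)) * (f i x * a x) \<partial>M)"
    by (intro Bochner_Integration.integral_sum bdd_meas_integrable[OF finite_measure_axioms] bdd_meas_mult
        bdd_meas_const partition_bdd_meas a)
  also have "\<dots> = (\<Sum>i\<in>I. (\<integral>x. f i x * a x \<partial>M) * (\<integral>x. f i x * b x \<partial>M) / (\<integral>x. f i x \<partial>M))"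
    by (intro sum.cong refl) (subst integral_mult_right_zero, simp)
  finally show ?thesis .
qed

lemma smoothing_self_adjoint:
  assumes "bdd_meas M a" "bdd_meas M b"
  shows "(\<integral>x. a x * smoothing M I f b x \<partial>M) = (\<integral>x. smoothing M I f a x * b x \<partial>M)"
  using smoothing_integral[OF assms(1), of b] smoothing_integral[OF assms(2), of a] by (simp add: mult_ac)

text \<open>Self-adjointness moves the operator onto the indicator of a past event, where the
  adaptedness clause of the partition applies.\<close>

lemma smoothing_orthogonal:
  assumes sM: "sets M = sets (borel_of (path_space N X))" and t: "t \<in> {1..<N}"
    and u: "bdd_meas M u" "orthogonal_to M (past X N t) u"
  shows "orthogonal_to M (past X N t) (smoothing M I f u)"
  unfolding orthogonal_to_def
proof
  fix C assume C: "C \<in> sets (past X N t)"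
  have sub: "subalgebra M (past X N t)" using subalgebra_past[OF sM] t by simp
  have Cp: "bdd_meas (past X N t) (indicator C)" using bdd_meas_indicator[OF C] .
  have CM: "bdd_meas M (indicator C)" using subalgebra_bdd_meas[OF sub Cp] .
  have "(\<integral>x. indicator C x * smoothing M I f u x \<partial>M) = (\<integral>x. smoothing M I f (indicator C) x * u x \<partial>M)"
    by (rule smoothing_self_adjoint[OF CM u(1)])
  also have "\<dots> = (\<integral>x. u x * smoothing M I f (indicator C) x \<partial>M)" by (simp add: mult.commute)
  also have "\<dots> = 0" using part t u Cp unfolding adapted_partition_def by blast
  finally show "(\<integral>x. indicator C x * smoothing M I f u x \<partial>M) = 0" .
qed

text \<open>Recovers an actual past-measurable version from the dual clause, by the double
  orthogonal complement.\<close>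

lemma smoothing_past:
  assumes sM: "sets M = sets (borel_of (path_space N X))" and t: "t \<in> {1..<N}"
    and a: "bdd_meas (past X N t) a"
  obtains a' where "bdd_meas (past X N t) a'" "AE x in M. smoothing M I f a x = a' x"
proof (rule AE_eq_subalgebra_measurable[OF finite_measure_axioms _ smoothing_bdd_meas])
  show "subalgebra M (past X N t)" using subalgebra_past[OF sM] t by simp
  show "(\<integral>x. u x * smoothing M I f a x \<partial>M) = 0"
    if "bdd_meas M u" "orthogonal_to M (past X N t) u" for u
    using part t a that unfolding adapted_partition_def by blast
qed (rule that)

end

text \<open>Testing \<open>Q\<close> with a pair of functions is testing \<open>P\<close> with the
  smoothed pair. Smoothing keeps the first function orthogonal to the past and the second one
  past-measurable up to a null set of \<open>M'\<close>. With \<open>x\<close> and \<open>y\<close>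
  abstract, the statement serves causality and anticausality alike.\<close>

lemma nonanticipative_smoothing:
  assumes PQ: "prob_space P" "prob_space Q"
    and x: "x \<in> P \<rightarrow>\<^sub>M borel_of (path_space N X)" "distr P (borel_of (path_space N X)) x = M"
      "distr Q (borel_of (path_space N X)) x = M"
    and y: "y \<in> P \<rightarrow>\<^sub>M borel_of (path_space N Y)" "distr P (borel_of (path_space N Y)) y = M'"
    and part: "adapted_partition X N M I f" "adapted_partition Y N M' J g"
    and eq: "\<And>a b. bdd_meas M a \<Longrightarrow> bdd_meas M' b \<Longrightarrow>
      (\<integral>w. a (x w) * b (y w) \<partial>Q) = (\<integral>w. smoothing M I f a (x w) * smoothing M' J g b (y w) \<partial>P)"
    and t: "t \<in> {1..<N}" and na: "nonanticipative X Y N P x y t"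
  shows "nonanticipative X Y N Q x y t"
proof -
  have sM: "sets M = sets (borel_of (path_space N X))" and sM': "sets M' = sets (borel_of (path_space N Y))"
    using x(2) y(2) by auto
  have pM: "prob_space M" and pM': "prob_space M'"
    using prob_space.prob_space_distr[OF PQ(1) x(1)] prob_space.prob_space_distr[OF PQ(1) y(1)] x(2) y(2) by auto
  have fM: "finite_measure M" "finite_measure M'" using pM pM' by (auto simp: prob_space_def)
  have xM: "x \<in> P \<rightarrow>\<^sub>M M" and yM: "y \<in> P \<rightarrow>\<^sub>M M'"
    using x(1) y(1) measurable_cong_sets[OF refl sM] measurable_cong_sets[OF refl sM'] by auto
  have sub: "subalgebra M' (past Y N t)" using subalgebra_past[OF sM'] t by simp
  show ?thesis
    unfolding nonanticipative_def x(3)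
  proof (intro allI impI)
    fix a b assume a: "bdd_meas (borel_of (path_space N X)) a" "orthogonal_to M (past X N t) a"
      and b: "bdd_meas (past Y N t) b"
    have aM: "bdd_meas M a" using a(1) bdd_meas_cong_sets[OF sM] by blast
    have bM: "bdd_meas M' b" using subalgebra_bdd_meas[OF sub b] .
    have SaM: "bdd_meas M (smoothing M I f a)" by (rule smoothing_bdd_meas[OF pM part(1)])
    obtain b' where b': "bdd_meas (past Y N t) b'" "AE z in M'. smoothing M' J g b z = b' z"
      using smoothing_past[OF pM' part(2) sM' t b] by blast
    have AE: "AE w in P. smoothing M' J g b (y w) = b' (y w)"
      using b'(2) unfolding y(2)[symmetric] by (rule AE_distrD[OF y(1)])
    have "(\<integral>w. a (x w) * b (y w) \<partial>Q) = (\<integral>w. smoothing M I f a (x w) * smoothing M' J g b (y w) \<partial>P)"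
      by (rule eq[OF aM bM])
    also have "\<dots> = (\<integral>w. smoothing M I f a (x w) * b' (y w) \<partial>P)"
    proof (rule integral_cong_AE)
      show "AE w in P. smoothing M I f a (x w) * smoothing M' J g b (y w) = smoothing M I f a (x w) * b' (y w)"
        using AE by eventually_elim simp
      show "(\<lambda>w. smoothing M I f a (x w) * smoothing M' J g b (y w)) \<in> borel_measurable P"
        by (intro bdd_meas_measurable bdd_meas_mult bdd_meas_comp[OF SaM xM]
            bdd_meas_comp[OF smoothing_bdd_meas[OF pM' part(2)] yM])
      show "(\<lambda>w. smoothing M I f a (x w) * b' (y w)) \<in> borel_measurable P"
        by (intro bdd_meas_measurable bdd_meas_mult bdd_meas_comp[OF SaM xM]
            bdd_meas_comp[OF subalgebra_bdd_meas[OF sub b'(1)] yM])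
    qed
    also have "\<dots> = 0"
    proof -
      have "bdd_meas (borel_of (path_space N X)) (smoothing M I f a)"
        using SaM bdd_meas_cong_sets[OF sM] by blast
      moreover have "orthogonal_to (distr P (borel_of (path_space N X)) x) (past X N t) (smoothing M I f a)"
        unfolding x(2) by (rule smoothing_orthogonal[OF pM part(1) sM t aM a(2)])
      ultimately show ?thesis using na b'(1) unfolding nonanticipative_def by blast
    qed
    finally show "(\<integral>w. a (x w) * b (y w) \<partial>Q) = 0" .
  qed
qed

text \<open>Replacing \<open>F\<close> by the constant \<open>G i j\<close> on each cell costs at
  most \<open>k\<close> times a displacement that separates into a part for \<open>i\<close> and a
  part for \<open>j\<close>. Summing over the other index leaves the marginal quantities
  \<open>A i\<close> and \<open>B j\<close>, which will be the same for the original and for the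
  smoothed coupling.\<close>

lemma weighted_lipschitz_estimate:
  fixes w :: "'i \<Rightarrow> 'j \<Rightarrow> 'z \<Rightarrow> real" and F :: "'z \<Rightarrow> real"
  assumes Q: "finite_measure Q" and fin: "finite I" "finite J"
    and w: "\<And>i j. i \<in> I \<Longrightarrow> j \<in> J \<Longrightarrow> bdd_meas Q (w i j)" "\<And>i j z. i \<in> I \<Longrightarrow> j \<in> J \<Longrightarrow> 0 \<le> w i j z"
    and F: "bdd_meas Q F"
    and lip: "\<And>i j z. i \<in> I \<Longrightarrow> j \<in> J \<Longrightarrow> z \<in> space Q \<Longrightarrow> \<bar>F z - G i j\<bar> \<le> k * (p i z + q j z)"
    and p: "\<And>i. i \<in> I \<Longrightarrow> integrable Q (p i)" and q: "\<And>j. j \<in> J \<Longrightarrow> integrable Q (q j)"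
    and A: "\<And>i. i \<in> I \<Longrightarrow> (\<Sum>j\<in>J. \<integral>z. w i j z * p i z \<partial>Q) = A i"
    and B: "\<And>j. j \<in> J \<Longrightarrow> (\<Sum>i\<in>I. \<integral>z. w i j z * q j z \<partial>Q) = B j"
  shows "\<bar>(\<Sum>i\<in>I. \<Sum>j\<in>J. \<integral>z. w i j z * F z \<partial>Q) - (\<Sum>i\<in>I. \<Sum>j\<in>J. (\<integral>z. w i j z \<partial>Q) * G i j)\<bar>
    \<le> k * ((\<Sum>i\<in>I. A i) + (\<Sum>j\<in>J. B j))"
proof -
  note int = bdd_meas_integrable[OF Q]
  have each: "\<bar>(\<integral>z. w i j z * F z \<partial>Q) - (\<integral>z. w i j z \<partial>Q) * G i j\<bar>
      \<le> k * ((\<integral>z. w i j z * p i z \<partial>Q) + (\<integral>z. w i j z * q j z \<partial>Q))" if ij: "i \<in> I" "j \<in> J" for i j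
  proof -
    have d: "bdd_meas Q (\<lambda>z. F z - G i j)" by (intro bdd_meas_diff F bdd_meas_const)
    have ip: "integrable Q (\<lambda>z. w i j z * p i z)" "integrable Q (\<lambda>z. w i j z * q j z)"
      using integrable_bdd_meas_mult[OF w(1)[OF ij] p[OF ij(1)]] integrable_bdd_meas_mult[OF w(1)[OF ij] q[OF ij(2)]] .
    have "(\<integral>z. w i j z * F z \<partial>Q) - (\<integral>z. w i j z \<partial>Q) * G i j = (\<integral>z. w i j z * F z - w i j z * G i j \<partial>Q)"
      using int[OF bdd_meas_mult[OF w(1)[OF ij] F]] int[OF w(1)[OF ij]] by simp
    also have "\<dots> = (\<integral>z. w i j z * (F z - G i j) \<partial>Q)" by (simp add: right_diff_distrib)
    finally have "\<bar>(\<integral>z. w i j z * F z \<partial>Q) - (\<integral>z. w i j z \<partial>Q) * G i j\<bar> \<le> (\<integral>z. \<bar>w i j z * (F z - G i j)\<bar> \<partial>Q)"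
      using integral_abs_bound[of Q "\<lambda>z. w i j z * (F z - G i j)"] by simp
    also have "\<dots> \<le> (\<integral>z. k * (w i j z * p i z + w i j z * q j z) \<partial>Q)"
    proof (rule integral_mono)
      show "integrable Q (\<lambda>z. \<bar>w i j z * (F z - G i j)\<bar>)"
        using int[OF bdd_meas_mult[OF w(1)[OF ij] d]] by simp
      show "integrable Q (\<lambda>z. k * (w i j z * p i z + w i j z * q j z))" using ip by simp
      fix z assume "z \<in> space Q"
      then have "w i j z * \<bar>F z - G i j\<bar> \<le> w i j z * (k * (p i z + q j z))"
        using lip[OF ij] w(2)[OF ij] by (intro mult_left_mono) auto
      moreover have "\<bar>w i j z * (F z - G i j)\<bar> = w i j z * \<bar>F z - G i j\<bar>"
        using w(2)[OF ij, of z] by (simp add: abs_mult)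
      moreover have "w i j z * (k * (p i z + q j z)) = k * (w i j z * p i z + w i j z * q j z)"
        by (simp add: algebra_simps)
      ultimately show "\<bar>w i j z * (F z - G i j)\<bar> \<le> k * (w i j z * p i z + w i j z * q j z)"
        by simp
    qed
    also have "\<dots> = k * ((\<integral>z. w i j z * p i z \<partial>Q) + (\<integral>z. w i j z * q j z \<partial>Q))" using ip by simp
    finally show ?thesis .
  qed
  have "\<bar>(\<Sum>i\<in>I. \<Sum>j\<in>J. \<integral>z. w i j z * F z \<partial>Q) - (\<Sum>i\<in>I. \<Sum>j\<in>J. (\<integral>z. w i j z \<partial>Q) * G i j)\<bar>
      \<le> (\<Sum>i\<in>I. \<Sum>j\<in>J. \<bar>(\<integral>z. w i j z * F z \<partial>Q) - (\<integral>z. w i j z \<partial>Q) * G i j\<bar>)"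
    unfolding sum_subtractf[symmetric] by (intro order_trans[OF sum_abs] sum_mono sum_abs)
  also have "\<dots> \<le> (\<Sum>i\<in>I. \<Sum>j\<in>J. k * ((\<integral>z. w i j z * p i z \<partial>Q) + (\<integral>z. w i j z * q j z \<partial>Q)))"
    by (intro sum_mono each)
  also have "\<dots> = k * ((\<Sum>i\<in>I. \<Sum>j\<in>J. \<integral>z. w i j z * p i z \<partial>Q) + (\<Sum>i\<in>I. \<Sum>j\<in>J. \<integral>z. w i j z * q j z \<partial>Q))"
    by (simp add: sum_distrib_left sum.distrib distrib_left)
  also have "(\<Sum>i\<in>I. \<Sum>j\<in>J. \<integral>z. w i j z * q j z \<partial>Q) = (\<Sum>j\<in>J. B j)"
    by (subst sum.swap) (intro sum.cong B refl)
  also have "(\<Sum>i\<in>I. \<Sum>j\<in>J. \<integral>z. w i j z * p i z \<partial>Q) = (\<Sum>i\<in>I. A i)"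
    by (intro sum.cong A refl)
  finally show ?thesis .
qed

section \<open>Smoothed couplings\<close>

lemma couplings_prob_space: "P \<in> couplings S T M M' \<Longrightarrow> prob_space P"
  by (auto simp: couplings_def prob_measures_def)

lemma couplings_sets: "P \<in> couplings S T M M' \<Longrightarrow> sets P = sets (borel_of (prod_topology S T))"
  by (auto simp: couplings_def prob_measures_def)

lemma couplings_space: "P \<in> couplings S T M M' \<Longrightarrow> space P = topspace S \<times> topspace T"
  using sets_eq_imp_space_eq[OF couplings_sets] by fastforce

lemma measurable_prod_topology:
  "sets P = sets (borel_of (prod_topology S T)) \<Longrightarrow> fst \<in> P \<rightarrow>\<^sub>M borel_of S"
  "sets P = sets (borel_of (prod_topology S T)) \<Longrightarrow> snd \<in> P \<rightarrow>\<^sub>M borel_of T"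
  using continuous_map_measurable[OF continuous_map_fst[of S T]]
    continuous_map_measurable[OF continuous_map_snd[of S T]] measurable_cong_sets[of P _ "borel_of S" "borel_of S"]
    measurable_cong_sets[of P _ "borel_of T" "borel_of T"] by auto

lemma couplings_distr:
  assumes "P \<in> couplings S T M M'"
  shows "distr P (borel_of S) fst = M" "distr P (borel_of T) snd = M'"
  using assms by (auto simp: couplings_def)

lemma couplings_marginal_sets:
  assumes "P \<in> couplings S T M M'"
  shows "sets M = sets (borel_of S)" "sets M' = sets (borel_of T)"
  using couplings_distr[OF assms] by auto

lemma couplings_measurable:
  assumes "P \<in> couplings S T M M'"
  shows "fst \<in> P \<rightarrow>\<^sub>M M" "snd \<in> P \<rightarrow>\<^sub>M M'"
  using measurable_prod_topology[OF couplings_sets[OF assms]]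
    measurable_cong_sets[OF refl couplings_marginal_sets(1)[OF assms]]
    measurable_cong_sets[OF refl couplings_marginal_sets(2)[OF assms]] by auto

lemma couplings_marginal_prob:
  assumes "P \<in> couplings S T M M'"
  shows "prob_space M" "prob_space M'"
  using prob_space.prob_space_distr[OF couplings_prob_space[OF assms] measurable_prod_topology(1)[OF couplings_sets[OF assms]]]
    prob_space.prob_space_distr[OF couplings_prob_space[OF assms] measurable_prod_topology(2)[OF couplings_sets[OF assms]]]
    couplings_distr[OF assms] by auto

lemma couplings_distr':
  assumes "P \<in> couplings S T M M'"
  shows "distr P M fst = M" "distr P M' snd = M'"
  using couplings_distr[OF assms] distr_cong[OF refl couplings_marginal_sets(1)[OF assms], of P fst fst]
    distr_cong[OF refl couplings_marginal_sets(2)[OF assms], of P snd snd] by auto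

lemma couplings_integral_fst:
  fixes a :: "'a \<Rightarrow> real"
  assumes P: "P \<in> couplings S T M M'" and a: "a \<in> borel_measurable M"
  shows "(\<integral>w. a (fst w) \<partial>P) = (\<integral>x. a x \<partial>M)" "integrable P (\<lambda>w. a (fst w)) \<longleftrightarrow> integrable M a"
  using integral_distr[OF couplings_measurable(1)[OF P] a] integrable_distr_eq[OF couplings_measurable(1)[OF P] a]
    couplings_distr'(1)[OF P] by auto

lemma couplings_integral_snd:
  fixes a :: "'b \<Rightarrow> real"
  assumes P: "P \<in> couplings S T M M'" and a: "a \<in> borel_measurable M'"
  shows "(\<integral>w. a (snd w) \<partial>P) = (\<integral>x. a x \<partial>M')" "integrable P (\<lambda>w. a (snd w)) \<longleftrightarrow> integrable M' a"
  using integral_distr[OF couplings_measurable(2)[OF P] a] integrable_distr_eq[OF couplings_measurable(2)[OF P] a]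
    couplings_distr'(2)[OF P] by auto

lemma couplings_AE:
  assumes P: "P \<in> couplings S T M M'"
  shows "AE x in M. p x \<Longrightarrow> AE w in P. p (fst w)" "AE y in M'. q y \<Longrightarrow> AE w in P. q (snd w)"
proof -
  show "AE w in P. p (fst w)" if "AE x in M. p x"
    using that unfolding couplings_distr(1)[OF P, symmetric]
    by (rule AE_distrD[OF measurable_prod_topology(1)[OF couplings_sets[OF P]]])
  show "AE w in P. q (snd w)" if "AE y in M'. q y"
    using that unfolding couplings_distr(2)[OF P, symmetric]
    by (rule AE_distrD[OF measurable_prod_topology(2)[OF couplings_sets[OF P]]])
qed

lemma causal_iff_nonanticipative:
  assumes X: "\<And>t. t \<in> {1..N} \<Longrightarrow> polish (X t)" and Y: "\<And>t. t \<in> {1..N} \<Longrightarrow> polish (Y t)"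
    and P: "P \<in> couplings (path_space N X) (path_space N Y) M M'"
  shows "causal N X Y P \<longleftrightarrow> (\<forall>t\<in>{1..<N}. nonanticipative X Y N P fst snd t)"
    "anticausal N X Y P \<longleftrightarrow> (\<forall>t\<in>{1..<N}. nonanticipative Y X N P snd fst t)"
proof -
  note pr = couplings_prob_space[OF P]
  note m = measurable_prod_topology[OF couplings_sets[OF P]]
  show "causal N X Y P \<longleftrightarrow> (\<forall>t\<in>{1..<N}. nonanticipative X Y N P fst snd t)"
    unfolding causal_def
    using cond_indep_imp_nonanticipative[OF X pr m] nonanticipative_imp_cond_indep[OF X pr m] by blast
  show "anticausal N X Y P \<longleftrightarrow> (\<forall>t\<in>{1..<N}. nonanticipative Y X N P snd fst t)"
    unfolding anticausal_def
    using cond_indep_imp_nonanticipative[OF Y pr m(2,1)] nonanticipative_imp_cond_indep[OF Y pr m(2,1)] by blast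
qed

text \<open>One transfer principle for all four versions. The family \<open>F\<close> is a single
  coupling when smoothing and the range of a sequence when taking weak limits.\<close>

lemma version_couplings_transfer:
  assumes X: "\<And>t. t \<in> {1..N} \<Longrightarrow> polish (X t)" and Y: "\<And>t. t \<in> {1..N} \<Longrightarrow> polish (Y t)"
    and Q: "Q \<in> couplings (path_space N X) (path_space N Y) M M'"
    and F: "F \<noteq> {}" "F \<subseteq> version_couplings v N X Y M M'"
    and c: "\<And>t. t \<in> {1..<N} \<Longrightarrow> (\<And>P. P \<in> F \<Longrightarrow> nonanticipative X Y N P fst snd t) \<Longrightarrow> nonanticipative X Y N Q fst snd t"
    and ac: "\<And>t. t \<in> {1..<N} \<Longrightarrow> (\<And>P. P \<in> F \<Longrightarrow> nonanticipative Y X N P snd fst t) \<Longrightarrow> nonanticipative Y X N Q snd fst t"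
  shows "Q \<in> version_couplings v N X Y M M'"
proof -
  have FP: "P \<in> couplings (path_space N X) (path_space N Y) M M'" "admissible v N X Y P" if "P \<in> F" for P
    using that F(2) by (auto simp: version_couplings_def)
  have causal: "causal N X Y Q" if "\<And>P. P \<in> F \<Longrightarrow> causal N X Y P"
    using that c causal_iff_nonanticipative(1)[OF X Y Q] causal_iff_nonanticipative(1)[OF X Y FP(1)] by blast
  have anticausal: "anticausal N X Y Q" if "\<And>P. P \<in> F \<Longrightarrow> anticausal N X Y P"
    using that ac causal_iff_nonanticipative(2)[OF X Y Q] causal_iff_nonanticipative(2)[OF X Y FP(1)] by blast
  have "admissible v N X Y Q"
    using FP(2) causal anticausal by (cases v) auto
  then show ?thesis using Q by (simp add: version_couplings_def)
qed

lemma sets_pair_measure_path_space: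
  assumes X: "\<And>t. t \<in> {1..N} \<Longrightarrow> polish (X t)" and Y: "\<And>t. t \<in> {1..N} \<Longrightarrow> polish (Y t)"
    and P: "P \<in> couplings (path_space N X) (path_space N Y) M M'"
  shows "sets (M \<Otimes>\<^sub>M M') = sets (borel_of (prod_topology (path_space N X) (path_space N Y)))"
  using sets_borel_of_prod_topology[OF path_space_second_countable[OF X] path_space_second_countable[OF Y]]
    sets_pair_measure_cong[OF couplings_marginal_sets[OF P]] by simp

section \<open>Construction of the smoothed coupling and its properties\<close>

context
  fixes X :: "nat \<Rightarrow> 'a topology" and Y :: "nat \<Rightarrow> 'b topology" and N :: nat
    and M :: "(nat \<Rightarrow> 'a) measure" and M' :: "(nat \<Rightarrow> 'b) measure" and P
    and I :: "'i set" and f and J :: "'j set" and g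
  assumes X: "\<And>t. t \<in> {1..N} \<Longrightarrow> polish (X t)" and Y: "\<And>t. t \<in> {1..N} \<Longrightarrow> polish (Y t)"
    and P: "P \<in> couplings (path_space N X) (path_space N Y) M M'"
    and f: "adapted_partition X N M I f" and g: "adapted_partition Y N M' J g"
begin

interpretation P: prob_space P by (rule couplings_prob_space[OF P])
interpretation M: prob_space M by (rule couplings_marginal_prob[OF P])
interpretation M': prob_space M' by (rule couplings_marginal_prob[OF P])
interpretation MM: pair_prob_space M M' ..

text \<open>The mass at (i, j) of the discrete coupling obtained from \<open>P\<close> by sending
  each coordinate independently to its cells.\<close>

definition joint_mass :: "'i \<Rightarrow> 'j \<Rightarrow> real" where
  "joint_mass i j = (\<integral>w. f i (fst w) * g j (snd w) \<partial>P)"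

text \<open>\<open>joint_mass i j\<close> times the product of the normalised cell densities: once
  the pair of cells is known, the two paths are redrawn independently. This gluing of
  \<open>M\<close>, the discrete coupling and \<open>M'\<close> is what makes the result absolutely
  continuous.\<close>

definition smooth_weight :: "'i \<Rightarrow> 'j \<Rightarrow> (nat \<Rightarrow> 'a) \<times> (nat \<Rightarrow> 'b) \<Rightarrow> real" where
  "smooth_weight i j z = joint_mass i j / ((\<integral>x. f i x \<partial>M) * (\<integral>y. g j y \<partial>M')) * (f i (fst z) * g j (snd z))"

definition smooth_density :: "(nat \<Rightarrow> 'a) \<times> (nat \<Rightarrow> 'b) \<Rightarrow> real" where
  "smooth_density z = (\<Sum>i\<in>I. \<Sum>j\<in>J. smooth_weight i j z)"

definition smooth_coupling :: "((nat \<Rightarrow> 'a) \<times> (nat \<Rightarrow> 'b)) measure" where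
  "smooth_coupling = density (M \<Otimes>\<^sub>M M') (\<lambda>z. ennreal (smooth_density z))"

lemmas f_part = partition_bdd_meas[OF M.prob_space_axioms f] partition_nonneg[OF M.prob_space_axioms f]
  partition_pos[OF M.prob_space_axioms f] partition_sum[OF M.prob_space_axioms f] partition_finite[OF M.prob_space_axioms f]
lemmas g_part = partition_bdd_meas[OF M'.prob_space_axioms g] partition_nonneg[OF M'.prob_space_axioms g]
  partition_pos[OF M'.prob_space_axioms g] partition_sum[OF M'.prob_space_axioms g] partition_finite[OF M'.prob_space_axioms g]

lemma bdd_meas_P: "bdd_meas M a \<Longrightarrow> bdd_meas P (\<lambda>w. a (fst w))" "bdd_meas M' b \<Longrightarrow> bdd_meas P (\<lambda>w. b (snd w))"
  using bdd_meas_comp couplings_measurable[OF P] by blast+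

lemma bdd_meas_MM: "bdd_meas M a \<Longrightarrow> bdd_meas (M \<Otimes>\<^sub>M M') (\<lambda>w. a (fst w))"
  "bdd_meas M' b \<Longrightarrow> bdd_meas (M \<Otimes>\<^sub>M M') (\<lambda>w. b (snd w))"
  using bdd_meas_comp measurable_fst measurable_snd by blast+

lemmas P_integrable = bdd_meas_integrable[OF P.finite_measure_axioms]
lemmas MM_integrable = bdd_meas_integrable[OF MM.finite_measure_axioms]

lemma joint_mass_nonneg: "i \<in> I \<Longrightarrow> j \<in> J \<Longrightarrow> 0 \<le> joint_mass i j"
  unfolding joint_mass_def using f_part(2) g_part(2) by (intro integral_nonneg_AE AE_I2) auto

lemma smooth_weight_nonneg: "i \<in> I \<Longrightarrow> j \<in> J \<Longrightarrow> 0 \<le> smooth_weight i j z"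
  unfolding smooth_weight_def
  using joint_mass_nonneg f_part(2,4) g_part(2,4) by (intro mult_nonneg_nonneg divide_nonneg_pos mult_pos_pos) auto

lemma smooth_density_nonneg: "0 \<le> smooth_density z"
  unfolding smooth_density_def by (intro sum_nonneg smooth_weight_nonneg)

lemma smooth_weight_bdd_meas: "i \<in> I \<Longrightarrow> j \<in> J \<Longrightarrow> bdd_meas (M \<Otimes>\<^sub>M M') (smooth_weight i j)"
  unfolding smooth_weight_def
  by (intro bdd_meas_mult bdd_meas_const bdd_meas_MM f_part(1) g_part(1))

lemma smooth_density_bdd_meas: "bdd_meas (M \<Otimes>\<^sub>M M') smooth_density"
  unfolding smooth_density_def by (intro bdd_meas_sum smooth_weight_bdd_meas)

lemma smooth_coupling_integral:
  assumes F: "bdd_meas (M \<Otimes>\<^sub>M M') F"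
  shows "(\<integral>z. F z \<partial>smooth_coupling) = (\<Sum>i\<in>I. \<Sum>j\<in>J. \<integral>z. smooth_weight i j z * F z \<partial>(M \<Otimes>\<^sub>M M'))"
proof -
  have "(\<integral>z. F z \<partial>smooth_coupling) = (\<integral>z. smooth_density z * F z \<partial>(M \<Otimes>\<^sub>M M'))"
    unfolding smooth_coupling_def
    using smooth_density_nonneg bdd_meas_measurable[OF smooth_density_bdd_meas] bdd_meas_measurable[OF F]
    by (subst integral_real_density) auto
  also have "\<dots> = (\<integral>z. (\<Sum>i\<in>I. \<Sum>j\<in>J. smooth_weight i j z * F z) \<partial>(M \<Otimes>\<^sub>M M'))"
    unfolding smooth_density_def by (simp add: sum_distrib_right)
  also have "\<dots> = (\<Sum>i\<in>I. \<integral>z. (\<Sum>j\<in>J. smooth_weight i j z * F z) \<partial>(M \<Otimes>\<^sub>M M'))"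
    by (intro Bochner_Integration.integral_sum MM_integrable bdd_meas_sum bdd_meas_mult smooth_weight_bdd_meas F)
  also have "\<dots> = (\<Sum>i\<in>I. \<Sum>j\<in>J. \<integral>z. smooth_weight i j z * F z \<partial>(M \<Otimes>\<^sub>M M'))"
    by (intro sum.cong refl Bochner_Integration.integral_sum MM_integrable bdd_meas_mult smooth_weight_bdd_meas F)
  finally show ?thesis .
qed

text \<open>Both sides expand to the sum of \<open>A i * B j * joint_mass i j\<close>: on the left
  because the product measure factorises, on the right by the form of \<open>smoothing\<close>. This
  links the explicit density with the two operators.\<close>

lemma smooth_coupling_product:
  assumes a: "bdd_meas M a" and b: "bdd_meas M' b"
  shows "(\<integral>z. a (fst z) * b (snd z) \<partial>smooth_coupling) =
    (\<integral>w. smoothing M I f a (fst w) * smoothing M' J g b (snd w) \<partial>P)"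
proof -
  define A where "A i = (\<integral>x. f i x * a x \<partial>M) / (\<integral>x. f i x \<partial>M)" for i
  define B where "B j = (\<integral>y. g j y * b y \<partial>M') / (\<integral>y. g j y \<partial>M')" for j
  have "(\<integral>z. a (fst z) * b (snd z) \<partial>smooth_coupling) =
      (\<Sum>i\<in>I. \<Sum>j\<in>J. \<integral>z. smooth_weight i j z * (a (fst z) * b (snd z)) \<partial>(M \<Otimes>\<^sub>M M'))"
    by (intro smooth_coupling_integral bdd_meas_mult bdd_meas_MM a b)
  also have "\<dots> = (\<Sum>i\<in>I. \<Sum>j\<in>J. A i * B j * joint_mass i j)"
  proof (intro sum.cong refl)
    fix i j assume ij: "i \<in> I" "j \<in> J"
    let ?c = "joint_mass i j / ((\<integral>x. f i x \<partial>M) * (\<integral>y. g j y \<partial>M'))"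
    have "(\<integral>z. smooth_weight i j z * (a (fst z) * b (snd z)) \<partial>(M \<Otimes>\<^sub>M M')) =
        (\<integral>z. ?c * ((f i (fst z) * a (fst z)) * (g j (snd z) * b (snd z))) \<partial>(M \<Otimes>\<^sub>M M'))"
      unfolding smooth_weight_def by (simp add: mult_ac)
    also have "\<dots> = ?c * (\<integral>z. (f i (fst z) * a (fst z)) * (g j (snd z) * b (snd z)) \<partial>(M \<Otimes>\<^sub>M M'))"
      by (rule integral_mult_right_zero)
    also have "(\<integral>z. (f i (fst z) * a (fst z)) * (g j (snd z) * b (snd z)) \<partial>(M \<Otimes>\<^sub>M M')) =
        (\<integral>x. f i x * a x \<partial>M) * (\<integral>y. g j y * b y \<partial>M')"
      by (intro integral_pair_mult(2)[OF M.prob_space_axioms M'.prob_space_axioms]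
          bdd_meas_integrable[OF M.finite_measure_axioms] bdd_meas_mult f_part(1) g_part(1) ij a b)
    finally show "(\<integral>z. smooth_weight i j z * (a (fst z) * b (snd z)) \<partial>(M \<Otimes>\<^sub>M M')) = A i * B j * joint_mass i j"
      by (simp add: A_def B_def)
  qed
  also have "\<dots> = (\<Sum>i\<in>I. \<Sum>j\<in>J. \<integral>w. (A i * B j) * (f i (fst w) * g j (snd w)) \<partial>P)"
    unfolding joint_mass_def by simp
  also have "\<dots> = (\<Sum>i\<in>I. \<integral>w. (\<Sum>j\<in>J. (A i * B j) * (f i (fst w) * g j (snd w))) \<partial>P)"
    by (intro sum.cong refl Bochner_Integration.integral_sum[symmetric] P_integrable bdd_meas_mult bdd_meas_const
        bdd_meas_P f_part(1) g_part(1))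
  also have "\<dots> = (\<integral>w. (\<Sum>i\<in>I. \<Sum>j\<in>J. (A i * B j) * (f i (fst w) * g j (snd w))) \<partial>P)"
    by (intro Bochner_Integration.integral_sum[symmetric] P_integrable bdd_meas_sum bdd_meas_mult bdd_meas_const
        bdd_meas_P f_part(1) g_part(1))
  also have "\<dots> = (\<integral>w. smoothing M I f a (fst w) * smoothing M' J g b (snd w) \<partial>P)"
    unfolding smoothing_def A_def B_def sum_product
    by (intro Bochner_Integration.integral_cong sum.cong refl) (simp add: mult_ac)
  finally show ?thesis .
qed

lemma smoothing_one:
  "AE x in M. smoothing M I f (\<lambda>_. 1) x = 1" "AE y in M'. smoothing M' J g (\<lambda>_. 1) y = 1"
proof -
  have "smoothing M I f (\<lambda>_. 1) x = (\<Sum>i\<in>I. f i x)" for x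
    unfolding smoothing_def using f_part(4) by (intro sum.cong) (auto simp: less_imp_neq[symmetric])
  then show "AE x in M. smoothing M I f (\<lambda>_. 1) x = 1" using f_part(5) by simp
  have "smoothing M' J g (\<lambda>_. 1) y = (\<Sum>j\<in>J. g j y)" for y
    unfolding smoothing_def using g_part(4) by (intro sum.cong) (auto simp: less_imp_neq[symmetric])
  then show "AE y in M'. smoothing M' J g (\<lambda>_. 1) y = 1" using g_part(5) by simp
qed

text \<open>A self-adjoint operator that fixes the constant 1 preserves integrals.\<close>

lemma integral_smoothing:
  "bdd_meas M a \<Longrightarrow> (\<integral>x. smoothing M I f a x \<partial>M) = (\<integral>x. a x \<partial>M)"
  "bdd_meas M' b \<Longrightarrow> (\<integral>y. smoothing M' J g b y \<partial>M') = (\<integral>y. b y \<partial>M')"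
proof -
  assume a: "bdd_meas M a"
  have "(\<integral>x. smoothing M I f a x \<partial>M) = (\<integral>x. smoothing M I f (\<lambda>_. 1) x * a x \<partial>M)"
    using smoothing_self_adjoint[OF M.prob_space_axioms f bdd_meas_const a, of 1] by simp
  also have "\<dots> = (\<integral>x. a x \<partial>M)"
  proof (rule integral_cong_AE)
    show "(\<lambda>x. smoothing M I f (\<lambda>_. 1) x * a x) \<in> borel_measurable M"
      by (intro bdd_meas_measurable bdd_meas_mult smoothing_bdd_meas[OF M.prob_space_axioms f] a)
    show "a \<in> borel_measurable M" using bdd_meas_measurable[OF a] .
    show "AE x in M. smoothing M I f (\<lambda>_. 1) x * a x = a x" using smoothing_one(1) by eventually_elim simp
  qed
  finally show "(\<integral>x. smoothing M I f a x \<partial>M) = (\<integral>x. a x \<partial>M)" .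
next
  assume b: "bdd_meas M' b"
  have "(\<integral>x. smoothing M' J g b x \<partial>M') = (\<integral>x. smoothing M' J g (\<lambda>_. 1) x * b x \<partial>M')"
    using smoothing_self_adjoint[OF M'.prob_space_axioms g bdd_meas_const b, of 1] by simp
  also have "\<dots> = (\<integral>x. b x \<partial>M')"
  proof (rule integral_cong_AE)
    show "(\<lambda>x. smoothing M' J g (\<lambda>_. 1) x * b x) \<in> borel_measurable M'"
      by (intro bdd_meas_measurable bdd_meas_mult smoothing_bdd_meas[OF M'.prob_space_axioms g] b)
    show "b \<in> borel_measurable M'" using bdd_meas_measurable[OF b] .
    show "AE x in M'. smoothing M' J g (\<lambda>_. 1) x * b x = b x" using smoothing_one(2) by eventually_elim simp
  qed
  finally show "(\<integral>x. smoothing M' J g b x \<partial>M') = (\<integral>x. b x \<partial>M')" .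
qed

text \<open>The product formula with the constant 1 in the other variable, where smoothing has no
  effect; smoothing in the remaining variable preserves the integral.\<close>

lemma smooth_coupling_marginals:
  "bdd_meas M a \<Longrightarrow> (\<integral>z. a (fst z) \<partial>smooth_coupling) = (\<integral>x. a x \<partial>M)"
  "bdd_meas M' b \<Longrightarrow> (\<integral>z. b (snd z) \<partial>smooth_coupling) = (\<integral>y. b y \<partial>M')"
proof -
  note Sa = smoothing_bdd_meas[OF M.prob_space_axioms f] and Sb = smoothing_bdd_meas[OF M'.prob_space_axioms g]
  assume a: "bdd_meas M a"
  have "(\<integral>z. a (fst z) \<partial>smooth_coupling) = (\<integral>w. smoothing M I f a (fst w) * smoothing M' J g (\<lambda>_. 1) (snd w) \<partial>P)"
    using smooth_coupling_product[OF a bdd_meas_const, of 1] by simp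
  also have "\<dots> = (\<integral>w. smoothing M I f a (fst w) \<partial>P)"
  proof (rule integral_cong_AE)
    show "(\<lambda>w. smoothing M I f a (fst w) * smoothing M' J g (\<lambda>_. 1) (snd w)) \<in> borel_measurable P"
      by (intro bdd_meas_measurable bdd_meas_mult bdd_meas_P Sa Sb)
    show "(\<lambda>w. smoothing M I f a (fst w)) \<in> borel_measurable P"
      by (intro bdd_meas_measurable bdd_meas_P Sa)
    show "AE w in P. smoothing M I f a (fst w) * smoothing M' J g (\<lambda>_. 1) (snd w) = smoothing M I f a (fst w)"
      using couplings_AE(2)[OF P smoothing_one(2)] by eventually_elim simp
  qed
  also have "\<dots> = (\<integral>x. a x \<partial>M)"
    using couplings_integral_fst(1)[OF P bdd_meas_measurable[OF Sa]] integral_smoothing(1)[OF a] by simp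
  finally show "(\<integral>z. a (fst z) \<partial>smooth_coupling) = (\<integral>x. a x \<partial>M)" .
next
  note Sa = smoothing_bdd_meas[OF M.prob_space_axioms f] and Sb = smoothing_bdd_meas[OF M'.prob_space_axioms g]
  assume b: "bdd_meas M' b"
  have "(\<integral>z. b (snd z) \<partial>smooth_coupling) = (\<integral>w. smoothing M I f (\<lambda>_. 1) (fst w) * smoothing M' J g b (snd w) \<partial>P)"
    using smooth_coupling_product[OF bdd_meas_const b, of 1] by simp
  also have "\<dots> = (\<integral>w. smoothing M' J g b (snd w) \<partial>P)"
  proof (rule integral_cong_AE)
    show "(\<lambda>w. smoothing M I f (\<lambda>_. 1) (fst w) * smoothing M' J g b (snd w)) \<in> borel_measurable P"
      by (intro bdd_meas_measurable bdd_meas_mult bdd_meas_P Sa Sb)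
    show "(\<lambda>w. smoothing M' J g b (snd w)) \<in> borel_measurable P"
      by (intro bdd_meas_measurable bdd_meas_P Sb)
    show "AE w in P. smoothing M I f (\<lambda>_. 1) (fst w) * smoothing M' J g b (snd w) = smoothing M' J g b (snd w)"
      using couplings_AE(1)[OF P smoothing_one(1)] by eventually_elim simp
  qed
  also have "\<dots> = (\<integral>y. b y \<partial>M')"
    using couplings_integral_snd(1)[OF P bdd_meas_measurable[OF Sb]] integral_smoothing(2)[OF b] by simp
  finally show "(\<integral>z. b (snd z) \<partial>smooth_coupling) = (\<integral>y. b y \<partial>M')" .
qed

lemma smooth_coupling_prob_space: "prob_space smooth_coupling"
proof (rule prob_spaceI)
  have i: "integrable (M \<Otimes>\<^sub>M M') smooth_density" by (intro MM_integrable smooth_density_bdd_meas)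
  \<comment> \<open>The total mass is read off from the marginal formula applied to the constant
    1.\<close>
  have one: "(\<integral>z. 1 \<partial>smooth_coupling) = (1::real)"
    using smooth_coupling_marginals(1)[of "\<lambda>_. 1"] M.prob_space by simp
  moreover have "(\<integral>z. 1 \<partial>smooth_coupling) = (\<integral>z. smooth_density z \<partial>(M \<Otimes>\<^sub>M M'))"
    unfolding smooth_coupling_def using smooth_density_nonneg i
    by (subst integral_real_density) auto
  moreover have "emeasure smooth_coupling (space smooth_coupling) = (\<integral>\<^sup>+z. ennreal (smooth_density z) \<partial>(M \<Otimes>\<^sub>M M'))"
    unfolding smooth_coupling_def using i by (subst emeasure_density) (auto intro!: nn_integral_cong)
  ultimately show "emeasure smooth_coupling (space smooth_coupling) = 1"
    using nn_integral_eq_integral[OF i] smooth_density_nonneg by simp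
qed

lemma smooth_coupling_couplings: "smooth_coupling \<in> couplings (path_space N X) (path_space N Y) M M'"
proof -
  interpret Q: prob_space smooth_coupling by (rule smooth_coupling_prob_space)
  have sQ: "sets smooth_coupling = sets (borel_of (prod_topology (path_space N X) (path_space N Y)))"
    using sets_pair_measure_path_space[OF X Y P] by (simp add: smooth_coupling_def)
  note sM = couplings_marginal_sets[OF P]
  note m = measurable_prod_topology[OF sQ]
  have "distr smooth_coupling (borel_of (path_space N X)) fst = M"
  proof (rule measure_eqI)
    show "sets (distr smooth_coupling (borel_of (path_space N X)) fst) = sets M" using sM by simp
    fix A assume "A \<in> sets (distr smooth_coupling (borel_of (path_space N X)) fst)"
    then have A: "A \<in> sets (borel_of (path_space N X))" "A \<in> sets M" using sM by auto
    have "measure smooth_coupling (fst -` A \<inter> space smooth_coupling) =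
        (\<integral>z. indicator (fst -` A \<inter> space smooth_coupling) z \<partial>smooth_coupling)"
      by simp
    also have "\<dots> = (\<integral>z. indicator A (fst z) \<partial>smooth_coupling)"
      by (intro Bochner_Integration.integral_cong) (auto simp: indicator_def)
    also have "\<dots> = measure M A"
      using smooth_coupling_marginals(1)[OF bdd_meas_indicator[OF A(2)]] sets.sets_into_space[OF A(2)]
      by (simp add: Int_absorb2)
    finally show "emeasure (distr smooth_coupling (borel_of (path_space N X)) fst) A = emeasure M A"
      using A by (simp add: emeasure_distr[OF m(1)] Q.emeasure_eq_measure M.emeasure_eq_measure)
  qed
  moreover have "distr smooth_coupling (borel_of (path_space N Y)) snd = M'"
  proof (rule measure_eqI)
    show "sets (distr smooth_coupling (borel_of (path_space N Y)) snd) = sets M'" using sM by simp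
    fix A assume "A \<in> sets (distr smooth_coupling (borel_of (path_space N Y)) snd)"
    then have A: "A \<in> sets (borel_of (path_space N Y))" "A \<in> sets M'" using sM by auto
    have "measure smooth_coupling (snd -` A \<inter> space smooth_coupling) =
        (\<integral>z. indicator (snd -` A \<inter> space smooth_coupling) z \<partial>smooth_coupling)"
      by simp
    also have "\<dots> = (\<integral>z. indicator A (snd z) \<partial>smooth_coupling)"
      by (intro Bochner_Integration.integral_cong) (auto simp: indicator_def)
    also have "\<dots> = measure M' A"
      using smooth_coupling_marginals(2)[OF bdd_meas_indicator[OF A(2)]] sets.sets_into_space[OF A(2)]
      by (simp add: Int_absorb2)
    finally show "emeasure (distr smooth_coupling (borel_of (path_space N Y)) snd) A = emeasure M' A"
      using A by (simp add: emeasure_distr[OF m(2)] Q.emeasure_eq_measure M'.emeasure_eq_measure)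
  qed
  ultimately show ?thesis
    using sQ smooth_coupling_prob_space by (simp add: couplings_def prob_measures_def)
qed

lemma smooth_coupling_version:
  assumes "admissible v N X Y P"
  shows "smooth_coupling \<in> version_couplings v N X Y M M'"
proof (rule version_couplings_transfer[OF X Y smooth_coupling_couplings, of "{P}"])
  note m = measurable_prod_topology[OF couplings_sets[OF P]]
  note dP = couplings_distr[OF P] and dQ = couplings_distr[OF smooth_coupling_couplings]
  fix t assume t: "t \<in> {1..<N}"
  show "nonanticipative X Y N smooth_coupling fst snd t" if "\<And>P'. P' \<in> {P} \<Longrightarrow> nonanticipative X Y N P' fst snd t"
    using that by (intro nonanticipative_smoothing[OF P.prob_space_axioms smooth_coupling_prob_space m(1) dP(1) dQ(1)
        m(2) dP(2) f g smooth_coupling_product t]) auto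
  \<comment> \<open>For the anticausal half, the roles of the paths, the marginals and the
    partitions are exchanged.\<close>
  show "nonanticipative Y X N smooth_coupling snd fst t" if "\<And>P'. P' \<in> {P} \<Longrightarrow> nonanticipative Y X N P' snd fst t"
  proof (rule nonanticipative_smoothing[OF P.prob_space_axioms smooth_coupling_prob_space m(2) dP(2) dQ(2)
        m(1) dP(1) g f _ t])
    show "(\<integral>w. a (snd w) * b (fst w) \<partial>smooth_coupling) =
        (\<integral>w. smoothing M' J g a (snd w) * smoothing M I f b (fst w) \<partial>P)"
      if "bdd_meas M' a" "bdd_meas M b" for a b
      using smooth_coupling_product[OF that(2,1)] by (simp add: mult.commute)
  qed (use that in auto)
qed (use P assms in \<open>auto simp: version_couplings_def\<close>)

lemma joint_mass_sum:
  "i \<in> I \<Longrightarrow> (\<Sum>j\<in>J. joint_mass i j) = (\<integral>x. f i x \<partial>M)"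
  "j \<in> J \<Longrightarrow> (\<Sum>i\<in>I. joint_mass i j) = (\<integral>y. g j y \<partial>M')"
proof -
  assume i: "i \<in> I"
  have "(\<Sum>j\<in>J. joint_mass i j) = (\<integral>w. (\<Sum>j\<in>J. f i (fst w) * g j (snd w)) \<partial>P)"
    unfolding joint_mass_def
    by (intro Bochner_Integration.integral_sum[symmetric] P_integrable bdd_meas_mult bdd_meas_P f_part(1) g_part(1) i)
  also have "\<dots> = (\<integral>w. f i (fst w) \<partial>P)"
  proof (rule integral_cong_AE)
    show "(\<lambda>w. \<Sum>j\<in>J. f i (fst w) * g j (snd w)) \<in> borel_measurable P"
      by (intro bdd_meas_measurable bdd_meas_sum bdd_meas_mult bdd_meas_P f_part(1) g_part(1) i)
    show "(\<lambda>w. f i (fst w)) \<in> borel_measurable P" by (intro bdd_meas_measurable bdd_meas_P f_part(1) i)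
    show "AE w in P. (\<Sum>j\<in>J. f i (fst w) * g j (snd w)) = f i (fst w)"
      using couplings_AE(2)[OF P g_part(5)] by eventually_elim (simp add: sum_distrib_left[symmetric])
  qed
  also have "\<dots> = (\<integral>x. f i x \<partial>M)" by (rule couplings_integral_fst(1)[OF P bdd_meas_measurable[OF f_part(1)[OF i]]])
  finally show "(\<Sum>j\<in>J. joint_mass i j) = (\<integral>x. f i x \<partial>M)" .
next
  assume j: "j \<in> J"
  have "(\<Sum>i\<in>I. joint_mass i j) = (\<integral>w. (\<Sum>i\<in>I. f i (fst w) * g j (snd w)) \<partial>P)"
    unfolding joint_mass_def
    by (intro Bochner_Integration.integral_sum[symmetric] P_integrable bdd_meas_mult bdd_meas_P f_part(1) g_part(1) j)
  also have "\<dots> = (\<integral>w. g j (snd w) \<partial>P)"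
  proof (rule integral_cong_AE)
    show "(\<lambda>w. \<Sum>i\<in>I. f i (fst w) * g j (snd w)) \<in> borel_measurable P"
      by (intro bdd_meas_measurable bdd_meas_sum bdd_meas_mult bdd_meas_P f_part(1) g_part(1) j)
    show "(\<lambda>w. g j (snd w)) \<in> borel_measurable P" by (intro bdd_meas_measurable bdd_meas_P g_part(1) j)
    show "AE w in P. (\<Sum>i\<in>I. f i (fst w) * g j (snd w)) = g j (snd w)"
      using couplings_AE(1)[OF P f_part(5)] by eventually_elim (simp add: sum_distrib_right[symmetric])
  qed
  also have "\<dots> = (\<integral>y. g j y \<partial>M')" by (rule couplings_integral_snd(1)[OF P bdd_meas_measurable[OF g_part(1)[OF j]]])
  finally show "(\<Sum>i\<in>I. joint_mass i j) = (\<integral>y. g j y \<partial>M')" .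
qed

lemma smooth_weight_mass:
  assumes "i \<in> I" "j \<in> J"
  shows "(\<integral>z. smooth_weight i j z \<partial>(M \<Otimes>\<^sub>M M')) = joint_mass i j"
proof -
  have "(\<integral>z. smooth_weight i j z \<partial>(M \<Otimes>\<^sub>M M')) = joint_mass i j / ((\<integral>x. f i x \<partial>M) * (\<integral>y. g j y \<partial>M')) *
      (\<integral>z. f i (fst z) * g j (snd z) \<partial>(M \<Otimes>\<^sub>M M'))"
    unfolding smooth_weight_def by (rule integral_mult_right_zero)
  also have "(\<integral>z. f i (fst z) * g j (snd z) \<partial>(M \<Otimes>\<^sub>M M')) = (\<integral>x. f i x \<partial>M) * (\<integral>y. g j y \<partial>M')"
    by (intro integral_pair_mult(2)[OF M.prob_space_axioms M'.prob_space_axioms]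
          bdd_meas_integrable[OF M.finite_measure_axioms] f_part(1) g_part(1) assms)
  finally show ?thesis using f_part(4)[OF assms(1)] g_part(4)[OF assms(2)] by simp
qed

text \<open>\<open>P\<close> and the smoothed coupling give the same mass
  \<open>joint_mass i j\<close> to each pair of cells. Both are compared with the same discrete
  integral \<open>?R\<close>, and both errors obey the same bound, whence the factor 2.\<close>

lemma smooth_coupling_lipschitz:
  assumes F: "bdd_meas (M \<Otimes>\<^sub>M M') F"
    and lip: "\<And>i j z. i \<in> I \<Longrightarrow> j \<in> J \<Longrightarrow> z \<in> space (M \<Otimes>\<^sub>M M') \<Longrightarrow> \<bar>F z - G i j\<bar> \<le> k * (p i (fst z) + q j (snd z))"
    and p: "\<And>i. i \<in> I \<Longrightarrow> integrable M (p i)" and q: "\<And>j. j \<in> J \<Longrightarrow> integrable M' (q j)"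
  shows "\<bar>(\<integral>z. F z \<partial>P) - (\<integral>z. F z \<partial>smooth_coupling)\<bar> \<le>
    2 * k * ((\<Sum>i\<in>I. \<integral>x. f i x * p i x \<partial>M) + (\<Sum>j\<in>J. \<integral>y. g j y * q j y \<partial>M'))"
proof -
  let ?R = "\<Sum>i\<in>I. \<Sum>j\<in>J. joint_mass i j * G i j"
  let ?D = "(\<Sum>i\<in>I. \<integral>x. f i x * p i x \<partial>M) + (\<Sum>j\<in>J. \<integral>y. g j y * q j y \<partial>M')"
  have sPM: "sets P = sets (M \<Otimes>\<^sub>M M')" using couplings_sets[OF P] sets_pair_measure_path_space[OF X Y P] by simp
  have spPM: "space P = space (M \<Otimes>\<^sub>M M')" using sets_eq_imp_space_eq[OF sPM] .
  have FP: "bdd_meas P F" using F bdd_meas_cong_sets[OF sPM] by blast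
  have pP: "integrable P (\<lambda>w. p i (fst w))" if "i \<in> I" for i
    using couplings_integral_fst(2)[OF P borel_measurable_integrable[OF p[OF that]]] p[OF that] by simp
  have qP: "integrable P (\<lambda>w. q j (snd w))" if "j \<in> J" for j
    using couplings_integral_snd(2)[OF P borel_measurable_integrable[OF q[OF that]]] q[OF that] by simp
  have fp: "integrable M (\<lambda>x. f i x * p i x)" if "i \<in> I" for i
    by (rule integrable_bdd_meas_mult[OF f_part(1)[OF that] p[OF that]])
  have gq: "integrable M' (\<lambda>y. g j y * q j y)" if "j \<in> J" for j
    by (rule integrable_bdd_meas_mult[OF g_part(1)[OF that] q[OF that]])
  have fgP: "bdd_meas P (\<lambda>w. f i (fst w) * g j (snd w))" if "i \<in> I" "j \<in> J" for i j
    by (intro bdd_meas_mult bdd_meas_P f_part(1) g_part(1) that)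
  have "\<bar>(\<Sum>i\<in>I. \<Sum>j\<in>J. \<integral>w. (f i (fst w) * g j (snd w)) * F w \<partial>P) -
      (\<Sum>i\<in>I. \<Sum>j\<in>J. (\<integral>w. f i (fst w) * g j (snd w) \<partial>P) * G i j)\<bar> \<le> k * ?D"
  proof (rule weighted_lipschitz_estimate[OF P.finite_measure_axioms f_part(6) g_part(6) fgP _ FP _ pP qP])
    show "0 \<le> f i (fst z) * g j (snd z)" if "i \<in> I" "j \<in> J" for i j z
      using f_part(2) g_part(2) that by auto
    show "\<bar>F z - G i j\<bar> \<le> k * (p i (fst z) + q j (snd z))" if "i \<in> I" "j \<in> J" "z \<in> space P" for i j z
      using lip that spPM by auto
    show "(\<Sum>j\<in>J. \<integral>w. (f i (fst w) * g j (snd w)) * p i (fst w) \<partial>P) = (\<integral>x. f i x * p i x \<partial>M)" if i: "i \<in> I" for i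
    proof -
      have "(\<Sum>j\<in>J. \<integral>w. (f i (fst w) * g j (snd w)) * p i (fst w) \<partial>P) =
          (\<integral>w. (\<Sum>j\<in>J. (f i (fst w) * g j (snd w)) * p i (fst w)) \<partial>P)"
        by (intro Bochner_Integration.integral_sum[symmetric] integrable_bdd_meas_mult fgP pP i)
      also have "\<dots> = (\<integral>w. f i (fst w) * p i (fst w) \<partial>P)"
      proof (rule integral_cong_AE)
        show "(\<lambda>w. \<Sum>j\<in>J. (f i (fst w) * g j (snd w)) * p i (fst w)) \<in> borel_measurable P"
          by (intro borel_measurable_integrable Bochner_Integration.integrable_sum integrable_bdd_meas_mult fgP pP i)
        show "(\<lambda>w. f i (fst w) * p i (fst w)) \<in> borel_measurable P"
          by (intro borel_measurable_integrable integrable_bdd_meas_mult bdd_meas_P f_part(1) pP i)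
        show "AE w in P. (\<Sum>j\<in>J. (f i (fst w) * g j (snd w)) * p i (fst w)) = f i (fst w) * p i (fst w)"
          using couplings_AE(2)[OF P g_part(5)]
          by eventually_elim (simp add: sum_distrib_left[symmetric] sum_distrib_right[symmetric])
      qed
      also have "\<dots> = (\<integral>x. f i x * p i x \<partial>M)"
        by (rule couplings_integral_fst(1)[OF P borel_measurable_integrable[OF fp[OF i]]])
      finally show ?thesis .
    qed
    show "(\<Sum>i\<in>I. \<integral>w. (f i (fst w) * g j (snd w)) * q j (snd w) \<partial>P) = (\<integral>y. g j y * q j y \<partial>M')" if j: "j \<in> J" for j
    proof -
      have "(\<Sum>i\<in>I. \<integral>w. (f i (fst w) * g j (snd w)) * q j (snd w) \<partial>P) =
          (\<integral>w. (\<Sum>i\<in>I. (f i (fst w) * g j (snd w)) * q j (snd w)) \<partial>P)"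
        by (intro Bochner_Integration.integral_sum[symmetric] integrable_bdd_meas_mult fgP qP j)
      also have "\<dots> = (\<integral>w. g j (snd w) * q j (snd w) \<partial>P)"
      proof (rule integral_cong_AE)
        show "(\<lambda>w. \<Sum>i\<in>I. (f i (fst w) * g j (snd w)) * q j (snd w)) \<in> borel_measurable P"
          by (intro borel_measurable_integrable Bochner_Integration.integrable_sum integrable_bdd_meas_mult fgP qP j)
        show "(\<lambda>w. g j (snd w) * q j (snd w)) \<in> borel_measurable P"
          by (intro borel_measurable_integrable integrable_bdd_meas_mult bdd_meas_P g_part(1) qP j)
        show "AE w in P. (\<Sum>i\<in>I. (f i (fst w) * g j (snd w)) * q j (snd w)) = g j (snd w) * q j (snd w)"
          using couplings_AE(1)[OF P f_part(5)]
          by eventually_elim (simp add: sum_distrib_left[symmetric] sum_distrib_right[symmetric])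
      qed
      also have "\<dots> = (\<integral>y. g j y * q j y \<partial>M')"
        by (rule couplings_integral_snd(1)[OF P borel_measurable_integrable[OF gq[OF j]]])
      finally show ?thesis .
    qed
  qed
  moreover have "(\<Sum>i\<in>I. \<Sum>j\<in>J. \<integral>w. (f i (fst w) * g j (snd w)) * F w \<partial>P) = (\<integral>w. F w \<partial>P)"
  proof -
    have "(\<Sum>i\<in>I. \<Sum>j\<in>J. \<integral>w. (f i (fst w) * g j (snd w)) * F w \<partial>P) =
        (\<Sum>i\<in>I. \<integral>w. (\<Sum>j\<in>J. (f i (fst w) * g j (snd w)) * F w) \<partial>P)"
      by (intro sum.cong refl Bochner_Integration.integral_sum[symmetric] P_integrable bdd_meas_mult[OF fgP FP])
    also have "\<dots> = (\<integral>w. (\<Sum>i\<in>I. \<Sum>j\<in>J. (f i (fst w) * g j (snd w)) * F w) \<partial>P)"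
      by (intro Bochner_Integration.integral_sum[symmetric] P_integrable bdd_meas_sum bdd_meas_mult[OF fgP FP])
    also have "\<dots> = (\<integral>w. F w \<partial>P)"
    proof (rule integral_cong_AE)
      show "(\<lambda>w. \<Sum>i\<in>I. \<Sum>j\<in>J. (f i (fst w) * g j (snd w)) * F w) \<in> borel_measurable P"
        by (intro bdd_meas_measurable bdd_meas_sum bdd_meas_mult[OF fgP FP])
      show "F \<in> borel_measurable P" using bdd_meas_measurable[OF FP] .
      show "AE w in P. (\<Sum>i\<in>I. \<Sum>j\<in>J. (f i (fst w) * g j (snd w)) * F w) = F w"
        using couplings_AE(1)[OF P f_part(5)] couplings_AE(2)[OF P g_part(5)]
        by eventually_elim (simp add: sum_distrib_left[symmetric] sum_distrib_right[symmetric])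
    qed
    finally show ?thesis .
  qed
  ultimately have 1: "\<bar>(\<integral>w. F w \<partial>P) - ?R\<bar> \<le> k * ?D" unfolding joint_mass_def by simp
  have "\<bar>(\<Sum>i\<in>I. \<Sum>j\<in>J. \<integral>z. smooth_weight i j z * F z \<partial>(M \<Otimes>\<^sub>M M')) -
      (\<Sum>i\<in>I. \<Sum>j\<in>J. (\<integral>z. smooth_weight i j z \<partial>(M \<Otimes>\<^sub>M M')) * G i j)\<bar> \<le> k * ?D"
  proof (rule weighted_lipschitz_estimate[OF MM.finite_measure_axioms f_part(6) g_part(6)
        smooth_weight_bdd_meas smooth_weight_nonneg F lip])
    show "integrable (M \<Otimes>\<^sub>M M') (\<lambda>z. p i (fst z))" if "i \<in> I" for i
      using integral_pair_mult(1)[OF M.prob_space_axioms M'.prob_space_axioms p[OF that] bdd_meas_const, of 1] by simp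
    show "integrable (M \<Otimes>\<^sub>M M') (\<lambda>z. q j (snd z))" if "j \<in> J" for j
      using integral_pair_mult'(1)[OF M.prob_space_axioms M'.prob_space_axioms bdd_meas_const q[OF that], of 1] by simp
    let ?c = "\<lambda>i j. joint_mass i j / ((\<integral>x. f i x \<partial>M) * (\<integral>y. g j y \<partial>M'))"
    show "(\<Sum>j\<in>J. \<integral>z. smooth_weight i j z * p i (fst z) \<partial>(M \<Otimes>\<^sub>M M')) = (\<integral>x. f i x * p i x \<partial>M)" if i: "i \<in> I" for i
    proof -
      have e: "(\<integral>z. smooth_weight i j z * p i (fst z) \<partial>(M \<Otimes>\<^sub>M M')) =
          joint_mass i j * ((\<integral>x. f i x * p i x \<partial>M) / (\<integral>x. f i x \<partial>M))" if j: "j \<in> J" for j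
      proof -
        have "(\<integral>z. smooth_weight i j z * p i (fst z) \<partial>(M \<Otimes>\<^sub>M M')) =
            (\<integral>z. ?c i j * ((f i (fst z) * p i (fst z)) * g j (snd z)) \<partial>(M \<Otimes>\<^sub>M M'))"
          unfolding smooth_weight_def by (simp add: mult_ac)
        also have "\<dots> = ?c i j * (\<integral>z. (f i (fst z) * p i (fst z)) * g j (snd z) \<partial>(M \<Otimes>\<^sub>M M'))"
          by (rule integral_mult_right_zero)
        also have "(\<integral>z. (f i (fst z) * p i (fst z)) * g j (snd z) \<partial>(M \<Otimes>\<^sub>M M')) =
            (\<integral>x. f i x * p i x \<partial>M) * (\<integral>y. g j y \<partial>M')"
          by (rule integral_pair_mult(2)[OF M.prob_space_axioms M'.prob_space_axioms fp[OF i] g_part(1)[OF j]])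
        finally show ?thesis using g_part(4)[OF j] by simp
      qed
      have "(\<Sum>j\<in>J. \<integral>z. smooth_weight i j z * p i (fst z) \<partial>(M \<Otimes>\<^sub>M M')) =
          (\<Sum>j\<in>J. joint_mass i j) * ((\<integral>x. f i x * p i x \<partial>M) / (\<integral>x. f i x \<partial>M))"
        unfolding sum_distrib_right by (intro sum.cong refl e)
      also have "\<dots> = (\<integral>x. f i x * p i x \<partial>M)" unfolding joint_mass_sum(1)[OF i] using f_part(4)[OF i] by simp
      finally show ?thesis .
    qed
    show "(\<Sum>i\<in>I. \<integral>z. smooth_weight i j z * q j (snd z) \<partial>(M \<Otimes>\<^sub>M M')) = (\<integral>y. g j y * q j y \<partial>M')" if j: "j \<in> J" for j
    proof -
      have e: "(\<integral>z. smooth_weight i j z * q j (snd z) \<partial>(M \<Otimes>\<^sub>M M')) =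
          joint_mass i j * ((\<integral>y. g j y * q j y \<partial>M') / (\<integral>y. g j y \<partial>M'))" if i: "i \<in> I" for i
      proof -
        have "(\<integral>z. smooth_weight i j z * q j (snd z) \<partial>(M \<Otimes>\<^sub>M M')) =
            (\<integral>z. ?c i j * (f i (fst z) * (g j (snd z) * q j (snd z))) \<partial>(M \<Otimes>\<^sub>M M'))"
          unfolding smooth_weight_def by (simp add: mult_ac)
        also have "\<dots> = ?c i j * (\<integral>z. f i (fst z) * (g j (snd z) * q j (snd z)) \<partial>(M \<Otimes>\<^sub>M M'))"
          by (rule integral_mult_right_zero)
        also have "(\<integral>z. f i (fst z) * (g j (snd z) * q j (snd z)) \<partial>(M \<Otimes>\<^sub>M M')) =
            (\<integral>x. f i x \<partial>M) * (\<integral>y. g j y * q j y \<partial>M')"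
          by (rule integral_pair_mult'(2)[OF M.prob_space_axioms M'.prob_space_axioms f_part(1)[OF i] gq[OF j]])
        finally show ?thesis using f_part(4)[OF i] by simp
      qed
      have "(\<Sum>i\<in>I. \<integral>z. smooth_weight i j z * q j (snd z) \<partial>(M \<Otimes>\<^sub>M M')) =
          (\<Sum>i\<in>I. joint_mass i j) * ((\<integral>y. g j y * q j y \<partial>M') / (\<integral>y. g j y \<partial>M'))"
        unfolding sum_distrib_right by (intro sum.cong refl e)
      also have "\<dots> = (\<integral>y. g j y * q j y \<partial>M')" unfolding joint_mass_sum(2)[OF j] using g_part(4)[OF j] by simp
      finally show ?thesis .
    qed
  qed
  moreover have "(\<Sum>i\<in>I. \<Sum>j\<in>J. (\<integral>z. smooth_weight i j z \<partial>(M \<Otimes>\<^sub>M M')) * G i j) = ?R"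
    by (intro sum.cong refl) (simp add: smooth_weight_mass)
  ultimately have 2: "\<bar>(\<integral>z. F z \<partial>smooth_coupling) - ?R\<bar> \<le> k * ?D"
    unfolding smooth_coupling_integral[OF F] by simp
  show ?thesis using 1 2 by (simp add: abs_le_iff)
qed

end

section \<open>Relative entropy and weak limits of couplings\<close>

lemma ext_integral_eq:
  assumes "integrable M f"
  shows "ext_integral M f = ereal (\<integral>x. f x \<partial>M)"
proof -
  from assms have fin: "(\<integral>\<^sup>+x. ennreal (f x) \<partial>M) \<noteq> \<infinity>" "(\<integral>\<^sup>+x. ennreal (- f x) \<partial>M) \<noteq> \<infinity>"
    by (auto simp: real_integrable_def)
  have e: "enn2ereal a = ereal (enn2real a)" if "a \<noteq> \<infinity>" for a
    using that by (cases a) (auto simp: enn2ereal_ennreal)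
  show ?thesis
    unfolding ext_integral_def real_lebesgue_integral_def[OF assms] e[OF fin(1)] e[OF fin(2)] by simp
qed

text \<open>This is r - 1 \<le> r ln r, with the terms arranged so that all of them are nonnegative.
  In this form it can be integrated in \<open>ennreal\<close> before anything is known about
  integrability of the logarithm.\<close>

lemma ln_mult_bound:
  assumes "0 \<le> r"
  shows "ennreal r + ennreal r * ennreal (- ln r) \<le> ennreal r * ennreal (ln r) + 1"
proof (cases "r = 0")
  case False
  then have r: "0 < r" using assms by simp
  have "ln (1 / r) \<le> 1 / r - 1" using r by (intro ln_le_minus_one) simp
  then have "r * (1 - 1 / r) \<le> r * ln r" using r by (intro mult_left_mono) (auto simp: ln_div)
  then have b: "r - 1 \<le> r * ln r" using r by (simp add: right_diff_distrib)
  show ?thesis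
  proof (cases "1 \<le> r")
    case True
    then have l: "0 \<le> ln r" by simp
    have "ennreal r * ennreal (ln r) + 1 = ennreal (r * ln r) + ennreal 1"
      using r l by (simp add: ennreal_mult)
    also have "\<dots> = ennreal (r * ln r + 1)" using r l by (intro ennreal_plus[symmetric]) auto
    finally have "ennreal r * ennreal (ln r) + 1 = ennreal (r * ln r + 1)" .
    moreover have "ennreal (- ln r) = 0" using l by (simp add: ennreal_neg)
    ultimately show ?thesis using b by (simp add: ennreal_leI)
  next
    case False
    then have l: "ln r \<le> 0" using r by simp
    have "ennreal r + ennreal r * ennreal (- ln r) = ennreal r + ennreal (r * (- ln r))"
      using r l by (subst ennreal_mult) auto
    also have "\<dots> = ennreal (r + r * (- ln r))"
      using r l by (intro ennreal_plus[symmetric] mult_nonneg_nonneg) auto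
    finally have "ennreal r + ennreal r * ennreal (- ln r) = ennreal (r + r * (- ln r))" .
    moreover have "ennreal (ln r) = 0" using l by (simp add: ennreal_neg)
    moreover have "r + r * (- ln r) \<le> 1" using b by simp
    ultimately show ?thesis by (simp add: ennreal_le_1)
  qed
qed simp

text \<open>Integrating \<open>ln_mult_bound\<close> over \<open>Q\<close> gives 1 + b \<le> a + 1,
  where \<open>a\<close> and \<open>b\<close> are the integrals of the positive and the negative
  part of the log-density; the finite 1 cancels.\<close>

lemma KL_nonneg:
  assumes P: "prob_space P" and Q: "prob_space Q" and sets: "sets P = sets Q"
  shows "0 \<le> KL P Q"
proof (cases "absolutely_continuous Q P")
  case True
  interpret P: prob_space P by fact
  interpret Q: prob_space Q by fact
  define h where "h = RN_deriv Q P"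
  have hm [measurable]: "h \<in> borel_measurable Q" unfolding h_def by simp
  have D: "P = density Q h" unfolding h_def using Q.density_RN_deriv[OF True sets] by simp
  define l where "l x = ln (enn2real (h x))" for x
  have lm [measurable]: "l \<in> borel_measurable Q" unfolding l_def by measurable
  have fin: "AE x in Q. h x \<noteq> \<infinity>"
    unfolding h_def by (rule Q.RN_deriv_finite[OF P.sigma_finite_measure_axioms True sets])
  define a where "a = (\<integral>\<^sup>+x. ennreal (l x) \<partial>P)"
  define b where "b = (\<integral>\<^sup>+x. ennreal (- l x) \<partial>P)"
  have a: "a = (\<integral>\<^sup>+x. h x * ennreal (l x) \<partial>Q)" unfolding a_def D by (simp add: nn_integral_density)
  have b: "b = (\<integral>\<^sup>+x. h x * ennreal (- l x) \<partial>Q)" unfolding b_def D by (simp add: nn_integral_density)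
  have h1: "(\<integral>\<^sup>+x. h x \<partial>Q) = 1"
  proof -
    have "(\<integral>\<^sup>+x. 1 \<partial>P) = (\<integral>\<^sup>+x. h x * 1 \<partial>Q)" unfolding D by (rule nn_integral_density) auto
    then show ?thesis using P.emeasure_space_1 by simp
  qed
  have "1 + b = (\<integral>\<^sup>+x. h x + h x * ennreal (- l x) \<partial>Q)"
    unfolding b h1[symmetric] by (intro nn_integral_add[symmetric]) auto
  also have "\<dots> \<le> (\<integral>\<^sup>+x. h x * ennreal (l x) + 1 \<partial>Q)"
  proof (rule nn_integral_mono_AE)
    show "AE x in Q. h x + h x * ennreal (- l x) \<le> h x * ennreal (l x) + 1"
      using fin
    proof eventually_elim
      case (elim x)
      then obtain r where "h x = ennreal r" "0 \<le> r" by (cases "h x") auto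
      then show ?case using ln_mult_bound[of r] by (simp add: l_def)
    qed
  qed
  also have "\<dots> = a + 1" unfolding a using Q.emeasure_space_1 by (subst nn_integral_add) auto
  also have "a + 1 = 1 + a" by (rule add.commute)
  finally have "b \<le> a" by (subst (asm) ennreal_add_left_cancel_le) auto
  then have "enn2ereal b \<le> enn2ereal a" by (simp add: less_eq_ennreal.rep_eq)
  then have "0 \<le> enn2ereal a - enn2ereal b" by (rule ereal_diff_positive)
  then show ?thesis
    using True unfolding KL_def ext_integral_def a_def b_def l_def h_def by simp
qed (simp add: KL_def)

lemma KL_density_le:
  assumes Q: "prob_space Q" and D: "D \<in> borel_measurable Q" "\<And>x. 0 \<le> D x" "\<And>x. x \<in> space Q \<Longrightarrow> D x \<le> C" and C: "1 \<le> C"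
    and P: "prob_space (density Q (\<lambda>x. ennreal (D x)))"
  shows "KL (density Q (\<lambda>x. ennreal (D x))) Q \<le> ereal (ln C)"
proof -
  let ?P = "density Q (\<lambda>x. ennreal (D x))"
  interpret P: prob_space ?P by fact
  interpret Q: prob_space Q by fact
  have Dm [measurable]: "(\<lambda>x. ennreal (D x)) \<in> borel_measurable Q" using D(1) by measurable
  have ac: "absolutely_continuous Q ?P" using Dm by (rule absolutely_continuousI_density)
  have "AE x in Q. ennreal (D x) = RN_deriv Q ?P x"
    using Q.RN_deriv_unique[OF Dm refl] .
  then have "AE x in ?P. ennreal (D x) = RN_deriv Q ?P x"
    by (rule absolutely_continuous_AE[OF _ ac, rotated]) simp
  then have "AE x in ?P. ennreal (ln (enn2real (RN_deriv Q ?P x))) \<le> ennreal (ln C)"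
    using AE_space
  proof eventually_elim
    case (elim x)
    have e: "enn2real (RN_deriv Q ?P x) = D x" unfolding elim(1)[symmetric] using D(2) by simp
    have "ln (D x) \<le> ln C"
    proof (cases "D x = 0")
      \<comment> \<open>Here \<open>ln 0 = 0\<close> by convention, and the bound holds because
        \<open>C\<close> is at least 1.\<close>
      case True
      then show ?thesis using C by simp
    next
      case False
      then show ?thesis using D(2)[of x] D(3)[of x] elim(2) C by (subst ln_le_cancel_iff) auto
    qed
    then show ?case unfolding e by (rule ennreal_leI)
  qed
  then have "(\<integral>\<^sup>+x. ennreal (ln (enn2real (RN_deriv Q ?P x))) \<partial>?P) \<le> (\<integral>\<^sup>+x. ennreal (ln C) \<partial>?P)"
    by (rule nn_integral_mono_AE)
  also have "\<dots> = ennreal (ln C)" using P.emeasure_space_1 by simp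
  finally have "enn2ereal (\<integral>\<^sup>+x. ennreal (ln (enn2real (RN_deriv Q ?P x))) \<partial>?P) \<le> ereal (ln C)"
    using C by (simp add: less_eq_ennreal.rep_eq enn2ereal_ennreal)
  \<comment> \<open>The negative part is subtracted and can only lower the value, so the bound on
    the positive part suffices.\<close>
  moreover have "u - enn2ereal v \<le> u" for u :: ereal and v
    by (cases u; cases "enn2ereal v") (auto simp: enn2ereal_nonneg, metis enn2ereal_nonneg ereal_less_eq(5))
  ultimately show ?thesis
    using ac unfolding KL_def ext_integral_def by (auto intro: order_trans)
qed

text \<open>Lower semicontinuity in usable form. \<open>F\<close> is bounded and continuous, so its
  integral passes to weak limits, and Lipschitz, so it is controlled under smoothing. As
  \<open>F\<close> lies below \<open>h\<close>, lower bounds on its integral under another measure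
  carry over to \<open>h\<close>.\<close>

lemma lipschitz_minorant:
  fixes h :: "'a \<times> 'b \<Rightarrow> real"
  assumes dX: "metric_inducing S dX" and dY: "metric_inducing T dY"
    and P: "prob_space P" "sets P = sets (borel_of (prod_topology S T))"
    and h: "continuous_map (prod_topology S T) euclideanreal h" "\<And>z. z \<in> topspace S \<times> topspace T \<Longrightarrow> 0 \<le> h z"
    and int: "integrable P h" and r: "r < (\<integral>z. h z \<partial>P)"
  obtains F :: "'a \<times> 'b \<Rightarrow> real" and k :: real where "0 \<le> k" "continuous_map (prod_topology S T) euclideanreal F"
    "bounded (F ` topspace (prod_topology S T))"
    "\<And>z. z \<in> topspace S \<times> topspace T \<Longrightarrow> F z \<le> h z"
    "\<And>x y x' y'. x \<in> topspace S \<Longrightarrow> x' \<in> topspace S \<Longrightarrow> y \<in> topspace T \<Longrightarrow> y' \<in> topspace T \<Longrightarrow>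
      \<bar>F (x, y) - F (x', y')\<bar> \<le> k * (dX x x' + dY y y')"
    "r < (\<integral>z. F z \<partial>P)"
proof -
  interpret P: prob_space P by fact
  have mX: "Metric_space (topspace S) dX" "Metric_space.mtopology (topspace S) dX = S"
    and mY: "Metric_space (topspace T) dY" "Metric_space.mtopology (topspace T) dY = T"
    using dX dY by (auto simp: metric_inducing_def)
  interpret Metric_space12 "topspace S" dX "topspace T" dY
    using mX(1) mY(1) by (simp add: Metric_space12_def)
  have top: "Prod_metric.mtopology = prod_topology S T" using mtopology_prod_metric mX(2) mY(2) by simp
  let ?M = "topspace S \<times> topspace T"
  have spP: "space P = ?M" using sets_eq_imp_space_eq[OF P(2)] by simp
  have lsc: "\<exists>e>0. \<forall>w\<in>?M. prod_dist dX dY z w < e \<longrightarrow> a < h w" if z: "z \<in> ?M" and a: "a < h z" for z a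
  proof -
    have op: "openin Prod_metric.mtopology {w \<in> topspace (prod_topology S T). h w \<in> {a<..}}"
      unfolding top by (rule openin_continuous_map_preimage[OF h(1)]) simp
    moreover have "z \<in> {w \<in> topspace (prod_topology S T). h w \<in> {a<..}}" using z a by simp
    ultimately obtain e where e: "e > 0" "Prod_metric.mball z e \<subseteq> {w \<in> topspace (prod_topology S T). h w \<in> {a<..}}"
      unfolding Prod_metric.openin_mtopology by blast
    have "a < h w" if "w \<in> ?M" "prod_dist dX dY z w < e" for w
    proof -
      have "w \<in> Prod_metric.mball z e" using that z by (simp only: Prod_metric.in_mball)
      then show ?thesis using subsetD[OF e(2)] by blast
    qed
    then show ?thesis using e(1) by blast
  qed
  show ?thesis
  proof (rule lipschitz_approximation_from_below[OF Prod_metric.Metric_space_axioms h(2) lsc])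
    fix f :: "nat \<Rightarrow> 'a \<times> 'b \<Rightarrow> real"
    assume f: "\<And>k z. z \<in> ?M \<Longrightarrow> 0 \<le> f k z" "\<And>k z. z \<in> ?M \<Longrightarrow> f k z \<le> h z" "\<And>k z. z \<in> ?M \<Longrightarrow> f k z \<le> real k"
      "\<And>k z w. z \<in> ?M \<Longrightarrow> w \<in> ?M \<Longrightarrow> \<bar>f k z - f k w\<bar> \<le> real k * prod_dist dX dY z w"
      "\<And>z. z \<in> ?M \<Longrightarrow> (\<lambda>k. f k z) \<longlonglongrightarrow> h z"
    have fc: "continuous_map (prod_topology S T) euclideanreal (f k)" for k
      using lipschitz_imp_continuous_map[OF Prod_metric.Metric_space_axioms f(4)] unfolding top .
    have fb: "bounded (f k ` topspace (prod_topology S T))" for k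
      unfolding bounded_iff using f(1,3) by (intro exI[of _ "real k"]) auto
    have "(\<lambda>k. \<integral>z. f k z \<partial>P) \<longlonglongrightarrow> (\<integral>z. h z \<partial>P)"
    proof (rule integral_dominated_convergence[where w=h])
      show "h \<in> borel_measurable P" using int by simp
      show "f k \<in> borel_measurable P" for k
        using bdd_meas_measurable[OF continuous_map_bdd_meas[OF P(2) fc fb]] .
      show "AE z in P. (\<lambda>k. f k z) \<longlonglongrightarrow> h z" using f(5) spP by (intro AE_I2) auto
      show "AE z in P. norm (f k z) \<le> h z" for k
      proof (rule AE_I2)
        fix z assume "z \<in> space P"
        then have "z \<in> ?M" using spP by simp
        from f(1,2)[OF this, of k] show "norm (f k z) \<le> h z" by simp
      qed
    qed (rule int)
    from order_tendstoD(1)[OF this r] obtain k where k: "r < (\<integral>z. f k z \<partial>P)"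
      by (auto simp: eventually_sequentially)
    show ?thesis
    proof (rule that[of "real k" "f k"])
      show "\<bar>f k (x, y) - f k (x', y')\<bar> \<le> real k * (dX x x' + dY y y')"
        if "x \<in> topspace S" "x' \<in> topspace S" "y \<in> topspace T" "y' \<in> topspace T" for x y x' y'
      proof -
        \<comment> \<open>The product metric is Euclidean, and a sum of distances dominates the root
          of the sum of their squares.\<close>
        have "prod_dist dX dY (x, y) (x', y') \<le> dX x x' + dY y y'"
          unfolding prod_dist_def by (simp add: sqrt_sum_squares_le_sum)
        then have "real k * prod_dist dX dY (x, y) (x', y') \<le> real k * (dX x x' + dY y y')"
          by (intro mult_left_mono) auto
        then show ?thesis using f(4)[of "(x, y)" "(x', y')" k] that by force
      qed
    qed (use fc fb f(2) k in auto)
  qed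
qed

text \<open>From a b - a' b' = (a - a') b + a' (b - b'). Each term is estimated through one
  marginal, so the bound is uniform over all couplings of \<open>M\<close> and
  \<open>M'\<close>.\<close>

lemma bilinear_error_bound:
  assumes Q: "Q \<in> couplings S T M M'" and a: "bdd_meas M a" "bdd_meas M a'" and b: "bdd_meas M' b" "bdd_meas M' b'"
    and K: "\<And>y. y \<in> space M' \<Longrightarrow> \<bar>b y\<bar> \<le> K" and L: "\<And>x. x \<in> space M \<Longrightarrow> \<bar>a' x\<bar> \<le> L"
  shows "\<bar>(\<integral>w. a (fst w) * b (snd w) \<partial>Q) - (\<integral>w. a' (fst w) * b' (snd w) \<partial>Q)\<bar>
    \<le> K * (\<integral>x. \<bar>a x - a' x\<bar> \<partial>M) + L * (\<integral>y. \<bar>b y - b' y\<bar> \<partial>M')"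
proof -
  interpret Q: prob_space Q by (rule couplings_prob_space[OF Q])
  note m = couplings_measurable[OF Q]
  note int = bdd_meas_integrable[OF Q.finite_measure_axioms]
  have sp: "fst w \<in> space M" "snd w \<in> space M'" if "w \<in> space Q" for w
    using measurable_space[OF m(1) that] measurable_space[OF m(2) that] .
  have aQ: "bdd_meas Q (\<lambda>w. a (fst w))" "bdd_meas Q (\<lambda>w. a' (fst w))"
    and bQ: "bdd_meas Q (\<lambda>w. b (snd w))" "bdd_meas Q (\<lambda>w. b' (snd w))"
    using bdd_meas_comp[OF a(1) m(1)] bdd_meas_comp[OF a(2) m(1)] bdd_meas_comp[OF b(1) m(2)] bdd_meas_comp[OF b(2) m(2)] .
  have da: "(\<lambda>x. \<bar>a x - a' x\<bar>) \<in> borel_measurable M" and db: "(\<lambda>y. \<bar>b y - b' y\<bar>) \<in> borel_measurable M'"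
    using bdd_meas_measurable[OF bdd_meas_diff[OF a]] bdd_meas_measurable[OF bdd_meas_diff[OF b]] by auto
  have ia: "integrable Q (\<lambda>w. \<bar>a (fst w) - a' (fst w)\<bar>)" and ib: "integrable Q (\<lambda>w. \<bar>b (snd w) - b' (snd w)\<bar>)"
    using int[OF bdd_meas_diff[OF aQ]] int[OF bdd_meas_diff[OF bQ]] by auto
  have "\<bar>(\<integral>w. a (fst w) * b (snd w) \<partial>Q) - (\<integral>w. a' (fst w) * b' (snd w) \<partial>Q)\<bar> =
      \<bar>\<integral>w. a (fst w) * b (snd w) - a' (fst w) * b' (snd w) \<partial>Q\<bar>"
    using int[OF bdd_meas_mult[OF aQ(1) bQ(1)]] int[OF bdd_meas_mult[OF aQ(2) bQ(2)]] by simp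
  also have "\<dots> \<le> (\<integral>w. \<bar>a (fst w) * b (snd w) - a' (fst w) * b' (snd w)\<bar> \<partial>Q)"
    by (rule integral_abs_bound)
  also have "\<dots> \<le> (\<integral>w. K * \<bar>a (fst w) - a' (fst w)\<bar> + L * \<bar>b (snd w) - b' (snd w)\<bar> \<partial>Q)"
  proof (rule integral_mono)
    show "integrable Q (\<lambda>w. \<bar>a (fst w) * b (snd w) - a' (fst w) * b' (snd w)\<bar>)"
      using int[OF bdd_meas_diff[OF bdd_meas_mult[OF aQ(1) bQ(1)] bdd_meas_mult[OF aQ(2) bQ(2)]]] by simp
    show "integrable Q (\<lambda>w. K * \<bar>a (fst w) - a' (fst w)\<bar> + L * \<bar>b (snd w) - b' (snd w)\<bar>)"
      using ia ib by simp
    fix w assume w: "w \<in> space Q"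
    have "a (fst w) * b (snd w) - a' (fst w) * b' (snd w) =
        (a (fst w) - a' (fst w)) * b (snd w) + a' (fst w) * (b (snd w) - b' (snd w))" by (simp add: algebra_simps)
    also have "\<bar>\<dots>\<bar> \<le> \<bar>a (fst w) - a' (fst w)\<bar> * \<bar>b (snd w)\<bar> + \<bar>a' (fst w)\<bar> * \<bar>b (snd w) - b' (snd w)\<bar>"
      unfolding abs_mult[symmetric] by (rule abs_triangle_ineq)
    also have "\<dots> \<le> \<bar>a (fst w) - a' (fst w)\<bar> * K + L * \<bar>b (snd w) - b' (snd w)\<bar>"
      using K[OF sp(2)[OF w]] L[OF sp(1)[OF w]] by (intro add_mono mult_left_mono mult_right_mono) auto
    finally show "\<bar>a (fst w) * b (snd w) - a' (fst w) * b' (snd w)\<bar> \<le>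
        K * \<bar>a (fst w) - a' (fst w)\<bar> + L * \<bar>b (snd w) - b' (snd w)\<bar>" by (simp add: mult.commute)
  qed
  also have "\<dots> = K * (\<integral>w. \<bar>a (fst w) - a' (fst w)\<bar> \<partial>Q) + L * (\<integral>w. \<bar>b (snd w) - b' (snd w)\<bar> \<partial>Q)"
    using ia ib by simp
  also have "\<dots> = K * (\<integral>x. \<bar>a x - a' x\<bar> \<partial>M) + L * (\<integral>y. \<bar>b y - b' y\<bar> \<partial>M')"
    using couplings_integral_fst(1)[OF Q da] couplings_integral_snd(1)[OF Q db] by simp
  finally show ?thesis .
qed

text \<open>Weak limits of couplings see all bounded measurable product integrands, not only continuous ones,
  because the marginals are fixed.\<close>

lemma weak_limit_product_integral:
  assumes S: "metrizable_space S" and T: "metrizable_space T"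
    and Ps: "\<And>n. Ps n \<in> couplings S T M M'" and P: "P \<in> couplings S T M M'"
    and weak: "weakly_converges (prod_topology S T) Ps P"
    and a: "bdd_meas M a" and b: "bdd_meas M' b"
    and zero: "\<And>n. (\<integral>w. a (fst w) * b (snd w) \<partial>Ps n) = 0"
  shows "(\<integral>w. a (fst w) * b (snd w) \<partial>P) = 0"
proof -
  interpret M: prob_space M by (rule couplings_marginal_prob[OF P])
  interpret M': prob_space M' by (rule couplings_marginal_prob[OF P])
  note sM = couplings_marginal_sets[OF P]
  obtain K where K: "K \<ge> 0" "\<And>y. y \<in> space M' \<Longrightarrow> \<bar>b y\<bar> \<le> K" using bdd_meas_bound[OF b] by blast
  have le: "\<bar>\<integral>w. a (fst w) * b (snd w) \<partial>P\<bar> \<le> e" if e: "e > 0" for e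
  proof -
    \<comment> \<open>Multiplied by \<open>K\<close>, this error becomes at most e / 4; the added 1
      allows \<open>K\<close> to be 0.\<close>
    have e1: "e / (4 * (K + 1)) > 0" using e K by simp
    obtain a' where a': "continuous_map S euclideanreal a'" "bounded (a' ` topspace S)"
      "(\<integral>x. \<bar>a x - a' x\<bar> \<partial>M) < e / (4 * (K + 1))"
      using integrable_L1_approximable[OF S M.finite_measure_axioms sM(1) bdd_meas_integrable[OF M.finite_measure_axioms a]] e1
      unfolding L1_approximable_def by blast
    have a'M: "bdd_meas M a'" by (rule continuous_map_bdd_meas[OF sM(1) a'(1,2)])
    \<comment> \<open>The function \<open>b'\<close> has to be chosen after \<open>a'\<close>, since
      its accuracy depends on the bound \<open>L\<close> of \<open>a'\<close>.\<close>
    obtain L where L: "L \<ge> 0" "\<And>x. x \<in> space M \<Longrightarrow> \<bar>a' x\<bar> \<le> L" using bdd_meas_bound[OF a'M] by blast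
    have e2: "e / (4 * (L + 1)) > 0" using e L by simp
    obtain b' where b': "continuous_map T euclideanreal b'" "bounded (b' ` topspace T)"
      "(\<integral>y. \<bar>b y - b' y\<bar> \<partial>M') < e / (4 * (L + 1))"
      using integrable_L1_approximable[OF T M'.finite_measure_axioms sM(2) bdd_meas_integrable[OF M'.finite_measure_axioms b]] e2
      unfolding L1_approximable_def by blast
    have b'M: "bdd_meas M' b'" by (rule continuous_map_bdd_meas[OF sM(2) b'(1,2)])
    have err: "\<bar>(\<integral>w. a (fst w) * b (snd w) \<partial>Q) - (\<integral>w. a' (fst w) * b' (snd w) \<partial>Q)\<bar> \<le> e / 2"
      if Q: "Q \<in> couplings S T M M'" for Q
    proof -
      have "K * (\<integral>x. \<bar>a x - a' x\<bar> \<partial>M) \<le> (K + 1) * (e / (4 * (K + 1)))"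
        using K(1) a'(3) by (intro mult_mono) auto
      also have "(K + 1) * (e / (4 * (K + 1))) = e / 4" using K(1) by (simp add: field_simps)
      finally have 1: "K * (\<integral>x. \<bar>a x - a' x\<bar> \<partial>M) \<le> e / 4" .
      have "L * (\<integral>x. \<bar>b x - b' x\<bar> \<partial>M') \<le> (L + 1) * (e / (4 * (L + 1)))"
        using L(1) b'(3) by (intro mult_mono) auto
      also have "(L + 1) * (e / (4 * (L + 1))) = e / 4" using L(1) by (simp add: field_simps)
      finally have "L * (\<integral>x. \<bar>b x - b' x\<bar> \<partial>M') \<le> e / 4" .
      with 1 bilinear_error_bound[OF Q a a'M b b'M K(2) L(2)] show ?thesis by simp
    qed
    have cont: "continuous_map (prod_topology S T) euclideanreal (\<lambda>w. a' (fst w) * b' (snd w))"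
      using continuous_map_compose[OF continuous_map_fst a'(1)] continuous_map_compose[OF continuous_map_snd b'(1)]
      by (intro continuous_map_real_mult) (auto simp: o_def)
    have "bounded ((\<lambda>w. a' (fst w)) ` topspace (prod_topology S T))" "bounded ((\<lambda>w. b' (snd w)) ` topspace (prod_topology S T))"
      using a'(2) b'(2) by (auto simp: bounded_iff)
    then have bnd: "bounded ((\<lambda>w. a' (fst w) * b' (snd w)) ` topspace (prod_topology S T))"
      by (rule bounded_image_mult)
    have lim: "(\<lambda>n. \<integral>w. a' (fst w) * b' (snd w) \<partial>Ps n) \<longlonglongrightarrow> (\<integral>w. a' (fst w) * b' (snd w) \<partial>P)"
      using weak cont bnd unfolding weakly_converges_def by blast
    \<comment> \<open>The error e / 2 is spent twice: here along the sequence, and once more at the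
      limit.\<close>
    have "\<bar>\<integral>w. a' (fst w) * b' (snd w) \<partial>Ps n\<bar> \<le> e / 2" for n
      using err[OF Ps[of n]] zero[of n] by simp
    then have "\<bar>\<integral>w. a' (fst w) * b' (snd w) \<partial>P\<bar> \<le> e / 2"
      using tendsto_rabs[OF lim] by (intro LIMSEQ_le_const2[OF tendsto_rabs[OF lim]]) auto
    then show ?thesis using err[OF P] by linarith
  qed
  show ?thesis
  proof (rule ccontr)
    assume "(\<integral>w. a (fst w) * b (snd w) \<partial>P) \<noteq> 0"
    then have "\<bar>\<integral>w. a (fst w) * b (snd w) \<partial>P\<bar> / 2 > 0" by simp
    from le[OF this] this show False by linarith
  qed
qed

text \<open>A bounded continuous function of one coordinate has constant integral along the
  sequence, so the limit keeps the marginals.\<close>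

lemma weak_limit_couplings:
  assumes S: "metrizable_space S" and T: "metrizable_space T"
    and Ps: "\<And>n. Ps n \<in> couplings S T M M'" and P: "P \<in> prob_measures (prod_topology S T)"
    and weak: "weakly_converges (prod_topology S T) Ps P"
  shows "P \<in> couplings S T M M'"
proof -
  have pP: "prob_space P" and sP: "sets P = sets (borel_of (prod_topology S T))" using P by (auto simp: prob_measures_def)
  note m = measurable_prod_topology[OF sP]
  note sM = couplings_marginal_sets[OF Ps[of 0]] and pM = couplings_marginal_prob[OF Ps[of 0]]
  have 1: "distr P (borel_of S) fst = M"
  proof (rule measure_eqI_continuous[OF S prob_space.prob_space_distr[OF pP m(1)] _ pM(1) sM(1)])
    fix g assume g: "continuous_map S euclideanreal g" "bounded (g ` topspace S)"
    have gm: "g \<in> borel_measurable (borel_of S)" "g \<in> borel_measurable M"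
      using continuous_map_borel_measurable[OF g(1)] measurable_cong_sets[OF sM(1) refl, of borel] by auto
    have "continuous_map (prod_topology S T) euclideanreal (\<lambda>w. g (fst w))"
      using continuous_map_compose[OF continuous_map_fst g(1)] by (simp add: o_def)
    moreover have "bounded ((\<lambda>w. g (fst w)) ` topspace (prod_topology S T))"
      using g(2) by (auto simp: bounded_iff)
    ultimately have "(\<lambda>n. \<integral>w. g (fst w) \<partial>Ps n) \<longlonglongrightarrow> (\<integral>w. g (fst w) \<partial>P)"
      using weak unfolding weakly_converges_def by blast
    then have "(\<lambda>n. \<integral>x. g x \<partial>M) \<longlonglongrightarrow> (\<integral>w. g (fst w) \<partial>P)"
      using couplings_integral_fst(1)[OF Ps gm(2)] by simp
    then have "(\<integral>w. g (fst w) \<partial>P) = (\<integral>x. g x \<partial>M)" by (simp add: LIMSEQ_const_iff)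
    then show "integral\<^sup>L (distr P (borel_of S) fst) g = integral\<^sup>L M g"
      using integral_distr[OF m(1) gm(1)] by simp
  qed simp
  have 2: "distr P (borel_of T) snd = M'"
  proof (rule measure_eqI_continuous[OF T prob_space.prob_space_distr[OF pP m(2)] _ pM(2) sM(2)])
    fix g assume g: "continuous_map T euclideanreal g" "bounded (g ` topspace T)"
    have gm: "g \<in> borel_measurable (borel_of T)" "g \<in> borel_measurable M'"
      using continuous_map_borel_measurable[OF g(1)] measurable_cong_sets[OF sM(2) refl, of borel] by auto
    have "continuous_map (prod_topology S T) euclideanreal (\<lambda>w. g (snd w))"
      using continuous_map_compose[OF continuous_map_snd g(1)] by (simp add: o_def)
    moreover have "bounded ((\<lambda>w. g (snd w)) ` topspace (prod_topology S T))"
      using g(2) by (auto simp: bounded_iff)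
    ultimately have "(\<lambda>n. \<integral>w. g (snd w) \<partial>Ps n) \<longlonglongrightarrow> (\<integral>w. g (snd w) \<partial>P)"
      using weak unfolding weakly_converges_def by blast
    then have "(\<lambda>n. \<integral>x. g x \<partial>M') \<longlonglongrightarrow> (\<integral>w. g (snd w) \<partial>P)"
      using couplings_integral_snd(1)[OF Ps gm(2)] by simp
    then have "(\<integral>w. g (snd w) \<partial>P) = (\<integral>x. g x \<partial>M')" by (simp add: LIMSEQ_const_iff)
    then show "integral\<^sup>L (distr P (borel_of T) snd) g = integral\<^sup>L M' g"
      using integral_distr[OF m(2) gm(1)] by simp
  qed simp
  show ?thesis using P 1 2 by (simp add: couplings_def)
qed

lemma weak_limit_version_couplings:
  assumes X: "\<And>t. t \<in> {1..N} \<Longrightarrow> polish (X t)" and Y: "\<And>t. t \<in> {1..N} \<Longrightarrow> polish (Y t)"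
    and Ps: "\<And>n. Ps n \<in> version_couplings v N X Y M M'"
    and P: "P \<in> prob_measures (prod_topology (path_space N X) (path_space N Y))"
    and weak: "weakly_converges (prod_topology (path_space N X) (path_space N Y)) Ps P"
  shows "P \<in> version_couplings v N X Y M M'"
proof -
  note S = path_space_metrizable[OF X] and T = path_space_metrizable[OF Y]
  have Pc: "Ps n \<in> couplings (path_space N X) (path_space N Y) M M'" for n
    using Ps[of n] by (simp add: version_couplings_def)
  have Q: "P \<in> couplings (path_space N X) (path_space N Y) M M'"
    by (rule weak_limit_couplings[OF S T Pc P weak])
  note sM = couplings_marginal_sets[OF Q]
  note dQ = couplings_distr[OF Q] and dP = couplings_distr[OF Pc]
  have past: "bdd_meas M a" if "bdd_meas (past X N t) a" "t \<in> {1..<N}" for a t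
    using subalgebra_bdd_meas[OF subalgebra_past[OF sM(1)] that(1)] that(2) by simp
  have past': "bdd_meas M' b" if "bdd_meas (past Y N t) b" "t \<in> {1..<N}" for b t
    using subalgebra_bdd_meas[OF subalgebra_past[OF sM(2)] that(1)] that(2) by simp
  note bc = bdd_meas_cong_sets[OF sM(1)] bdd_meas_cong_sets[OF sM(2)]
  show ?thesis
  proof (rule version_couplings_transfer[OF X Y Q, of "range Ps"])
    fix t assume t: "t \<in> {1..<N}"
    assume na: "\<And>P'. P' \<in> range Ps \<Longrightarrow> nonanticipative X Y N P' fst snd t"
    show "nonanticipative X Y N P fst snd t"
      unfolding nonanticipative_def dQ
    proof (intro allI impI)
      fix a b assume a: "bdd_meas (borel_of (path_space N X)) a" "orthogonal_to M (past X N t) a"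
        and b: "bdd_meas (past Y N t) b"
      show "(\<integral>w. a (fst w) * b (snd w) \<partial>P) = 0"
      proof (rule weak_limit_product_integral[OF S T Pc Q weak])
        show "bdd_meas M a" using a(1) bc(1) by blast
        show "bdd_meas M' b" using past'[OF b t] .
        show "(\<integral>w. a (fst w) * b (snd w) \<partial>Ps n) = 0" for n
          using na[of "Ps n"] a b dP(1)[of n] unfolding nonanticipative_def by auto
      qed
    qed
  next
    fix t assume t: "t \<in> {1..<N}"
    assume na: "\<And>P'. P' \<in> range Ps \<Longrightarrow> nonanticipative Y X N P' snd fst t"
    show "nonanticipative Y X N P snd fst t"
      unfolding nonanticipative_def dQ
    proof (intro allI impI)
      fix b a assume b: "bdd_meas (borel_of (path_space N Y)) b" "orthogonal_to M' (past Y N t) b"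
        and a: "bdd_meas (past X N t) a"
      have "(\<integral>w. a (fst w) * b (snd w) \<partial>P) = 0"
      proof (rule weak_limit_product_integral[OF S T Pc Q weak])
        show "bdd_meas M' b" using b(1) bc(2) by blast
        show "bdd_meas M a" using past[OF a t] .
        show "(\<integral>w. a (fst w) * b (snd w) \<partial>Ps n) = 0" for n
          using na[of "Ps n"] a b dP(2)[of n] unfolding nonanticipative_def by (auto simp: mult.commute)
      qed
      then show "(\<integral>w. b (snd w) * a (fst w) \<partial>P) = 0" by (simp add: mult.commute)
    qed
  qed (use Ps in auto)
qed

section \<open>Convergence of the entropic problems\<close>

lemma continuous_map_dist:
  assumes "metric_inducing S d" "a \<in> topspace S"
  shows "continuous_map S euclideanreal (d a)"
proof -
  have m: "Metric_space (topspace S) d" "Metric_space.mtopology (topspace S) d = S"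
    using assms by (auto simp: metric_inducing_def)
  interpret Metric_space "topspace S" d by fact
  have "\<bar>d a x - d a y\<bar> \<le> 1 * d x y" if "x \<in> topspace S" "y \<in> topspace S" for x y
    using triangle[of a x y] triangle[of a y x] that assms(2) by (auto simp: commute abs_le_iff)
  from lipschitz_imp_continuous_map[OF m(1) this] show ?thesis using m(2) by simp
qed

lemma metric_inducing_nonneg: "metric_inducing S d \<Longrightarrow> 0 \<le> d x y"
  using Metric_space.nonneg[of "topspace S" d x y] by (simp add: metric_inducing_def)

lemma continuous_map_dist_powr:
  assumes "metric_inducing S d" "a \<in> topspace S" "p > 0"
  shows "continuous_map S euclideanreal (\<lambda>x. d a x powr p)"
proof -
  \<comment> \<open>The absolute value makes the power continuous on the whole line; it disappears
    again because distances are nonnegative.\<close>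
  have "continuous_on UNIV (\<lambda>r::real. \<bar>r\<bar> powr p)"
    using assms(3) by (intro continuous_on_powr' continuous_intros) auto
  then have "continuous_map euclideanreal euclideanreal (\<lambda>r. \<bar>r\<bar> powr p)" by simp
  from continuous_map_compose[OF continuous_map_dist[OF assms(1,2)] this]
  show ?thesis using metric_inducing_nonneg[OF assms(1)] by (simp add: o_def)
qed

text \<open>\<open>prob_measures_p\<close> grants the moment at some base point only. It is moved to
  an arbitrary point by (r + s)^p \<le> 2^p (r^p + s^p), since it is used at every partition point
  and at the base point of the growth condition.\<close>

lemma moment_integrable:
  assumes d: "metric_inducing S d" and M: "M \<in> prob_measures_p S d p" and p: "p > 0" and a: "a \<in> topspace S"
  shows "integrable M (\<lambda>x. d a x powr p)"
proof -
  have sM: "sets M = sets (borel_of S)" using M by (auto simp: prob_measures_p_def prob_measures_def)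
  have pM: "prob_space M" using M by (auto simp: prob_measures_p_def prob_measures_def)
  interpret prob_space M by fact
  interpret Metric_space "topspace S" d using d by (simp add: metric_inducing_def)
  have spM: "space M = topspace S" using sets_eq_imp_space_eq[OF sM] by simp
  have meas: "(\<lambda>x. d b x powr p) \<in> borel_measurable M" if "b \<in> topspace S" for b
    using continuous_map_borel_measurable[OF continuous_map_dist_powr[OF d that p]]
      measurable_cong_sets[OF sM refl, of borel] by blast
  obtain b where b: "b \<in> topspace S" "(\<integral>\<^sup>+x. ennreal (d b x powr p) \<partial>M) < \<infinity>"
    using M unfolding prob_measures_p_def by blast
  have ib: "integrable M (\<lambda>x. d b x powr p)"
    using meas[OF b(1)] b(2) by (simp add: integrable_iff_bounded)
  show ?thesis
  proof (rule Bochner_Integration.integrable_bound)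
    show "integrable M (\<lambda>x. 2 powr p * (d a b powr p + d b x powr p))" using ib by simp
    show "AE x in M. norm (d a x powr p) \<le> norm (2 powr p * (d a b powr p + d b x powr p))"
    proof (rule AE_I2)
      fix x assume "x \<in> space M"
      then have "d a x \<le> d a b + d b x" using triangle[of a b x] a b spM by simp
      also have "\<dots> \<le> 2 * max (d a b) (d b x)" by simp
      finally have "d a x powr p \<le> (2 * max (d a b) (d b x)) powr p" using p by (intro powr_mono2) auto
      also have "\<dots> = 2 powr p * max (d a b) (d b x) powr p" by (simp add: powr_mult)
      also have "\<dots> \<le> 2 powr p * (d a b powr p + d b x powr p)"
        by (intro mult_left_mono) (auto simp: max_def)
      finally show "norm (d a x powr p) \<le> norm (2 powr p * (d a b powr p + d b x powr p))" by simp
    qed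
  qed (rule meas[OF a])
qed

text \<open>Turns p-th moments into first moments at a free scale \<open>s\<close>: for r > s write
  r = r^(1-p) r^p and use that 1 - p is not positive. Once the p-th moment is at most s^p, the first
  moment is at most 2 s.\<close>

lemma le_add_powr:
  fixes r s p :: real
  assumes "0 < s" "0 \<le> r" "1 \<le> p"
  shows "r \<le> s + s powr (1 - p) * r powr p"
proof (cases "r \<le> s")
  case True
  moreover have "0 \<le> s powr (1 - p) * r powr p" by simp
  ultimately show ?thesis by linarith
next
  case False
  have "r = r powr (1 - p) * r powr p" using False assms by (simp add: powr_add[symmetric])
  also have "\<dots> \<le> s powr (1 - p) * r powr p"
    using False assms by (intro mult_right_mono powr_mono2') auto
  finally show ?thesis using assms by linarith
qed

text \<open>The infimum may fail to be attained, but a strict bound on it already provides a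
  coupling. The bound is raised from the distance to its p-th power.\<close>

lemma W_bc_less:
  assumes W: "W_bc N X d p M' M < ennreal s" and s: "0 < s" and p: "1 \<le> p"
  obtains G where "G \<in> version_couplings Bicausal N X X M' M"
    "(\<integral>\<^sup>+w. ennreal (d (fst w) (snd w) powr p) \<partial>G) < ennreal (s powr p)"
proof -
  define K where "K = (INF P\<in>version_couplings Bicausal N X X M' M. \<integral>\<^sup>+w. ennreal (d (fst w) (snd w) powr p) \<partial>P)"
  have W': "(if K = \<infinity> then \<infinity> else ennreal (enn2real K powr (1 / p))) < ennreal s"
    using W unfolding W_bc_def Let_def K_def .
  then have fin: "K \<noteq> \<infinity>" by (auto split: if_splits)
  then have "enn2real K powr (1 / p) < s" using W' s by (auto simp: ennreal_less_iff)
  have "enn2real K < s powr p"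
  proof (rule ccontr)
    assume "\<not> enn2real K < s powr p"
    then have "(s powr p) powr (1 / p) \<le> enn2real K powr (1 / p)" using p by (intro powr_mono2) auto
    moreover have "(s powr p) powr (1 / p) = s" using p s by (simp add: powr_powr)
    ultimately show False using \<open>enn2real K powr (1 / p) < s\<close> by simp
  qed
  then have "ennreal (enn2real K) < ennreal (s powr p)" using s by (intro ennreal_lessI) auto
  then have "K < ennreal (s powr p)" using fin by (simp add: less_top)
  then show thesis unfolding K_def INF_less_iff using that by blast
qed

text \<open>This is all that the rest of the proof extracts from the approximating measures: a
  partition adapted to the filtration whose mean displacement is as small as desired.\<close>

lemma adapted_partition_exists:
  fixes d :: "(nat \<Rightarrow> 'a) \<Rightarrow> (nat \<Rightarrow> 'a) \<Rightarrow> real"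
  assumes X: "\<And>t. t \<in> {1..N} \<Longrightarrow> polish (X t)" and d: "metric_inducing (path_space N X) d" and p: "1 \<le> p"
    and M: "M \<in> prob_measures_p (path_space N X) d p"
    and Ms: "\<And>n. Ms n \<in> prob_measures (path_space N X) \<and> finitely_supported (Ms n)"
    and conv: "(\<lambda>n. W_bc N X d p (Ms n) M) \<longlonglongrightarrow> 0" and e: "0 < e"
  obtains I f where "adapted_partition X N M I f" "I \<subseteq> topspace (path_space N X)"
    "\<And>i. i \<in> I \<Longrightarrow> integrable M (d i)" "(\<Sum>i\<in>I. \<integral>x. f i x * d i x \<partial>M) \<le> e"
proof -
  let ?S = "path_space N X"
  \<comment> \<open>Half of \<open>e\<close>, because the final estimate is s + s^(1-p) s^p = 2
    s.\<close>
  define s where "s = e / 2"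
  have s: "0 < s" using e by (simp add: s_def)
  have M': "M \<in> prob_measures ?S" using M by (simp add: prob_measures_p_def)
  then have pM: "prob_space M" and sM: "sets M = sets (borel_of ?S)" by (auto simp: prob_measures_def)
  interpret prob_space M by fact
  have spM: "space M = topspace ?S" using sets_eq_imp_space_eq[OF sM] by simp
  have "\<forall>\<^sub>F n in sequentially. W_bc N X d p (Ms n) M < ennreal s"
    by (rule order_tendstoD(2)[OF conv]) (use s in simp)
  then obtain n where "W_bc N X d p (Ms n) M < ennreal s" by (auto simp: eventually_sequentially)
  then obtain G where G: "G \<in> version_couplings Bicausal N X X (Ms n) M"
    "(\<integral>\<^sup>+w. ennreal (d (fst w) (snd w) powr p) \<partial>G) < ennreal (s powr p)"
    using W_bc_less s p by blast
  obtain I f where If: "adapted_partition X N M I f" "I \<subseteq> topspace ?S"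
    "(\<Sum>i\<in>I. \<integral>\<^sup>+x. ennreal (f i x) * ennreal (d i x powr p) \<partial>M) \<le> (\<integral>\<^sup>+w. ennreal (d (fst w) (snd w) powr p) \<partial>G)"
    using adapted_partition_of_coupling[OF X d _ _ M' G(1), where p=p] Ms[of n] by blast
  note part = partition_bdd_meas[OF pM If(1)] partition_nonneg[OF pM If(1)] partition_sum[OF pM If(1)]
  have ip: "integrable M (\<lambda>x. d i x powr p)" if "i \<in> I" for i
    using moment_integrable[OF d M _ subsetD[OF If(2) that]] p by simp
  have le: "d i x \<le> s + s powr (1 - p) * d i x powr p" for i x
    by (rule le_add_powr[OF s metric_inducing_nonneg[OF d] p])
  have id: "integrable M (d i)" if i: "i \<in> I" for i
  proof (rule Bochner_Integration.integrable_bound)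
    show "integrable M (\<lambda>x. s + s powr (1 - p) * d i x powr p)" using ip[OF i] by simp
    show "d i \<in> borel_measurable M"
      using continuous_map_borel_measurable[OF continuous_map_dist[OF d subsetD[OF If(2) i]]]
        measurable_cong_sets[OF sM refl, of borel] by blast
    show "AE x in M. norm (d i x) \<le> norm (s + s powr (1 - p) * d i x powr p)"
      using le[of i] metric_inducing_nonneg[OF d, of i]
      by (intro AE_I2) (auto intro: order_trans[OF _ abs_ge_self])
  qed
  have fip: "integrable M (\<lambda>x. f i x * d i x powr p)" if "i \<in> I" for i
    by (rule integrable_bdd_meas_mult[OF part(1)[OF that] ip[OF that]])
  have fid: "integrable M (\<lambda>x. f i x * d i x)" if "i \<in> I" for i
    by (rule integrable_bdd_meas_mult[OF part(1)[OF that] id[OF that]])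
  note fi = bdd_meas_integrable[OF finite_measure_axioms part(1)]
  have "ennreal (\<Sum>i\<in>I. \<integral>x. f i x * d i x powr p \<partial>M) = (\<Sum>i\<in>I. ennreal (\<integral>x. f i x * d i x powr p \<partial>M))"
    using part(2) by (intro sum_ennreal[symmetric] integral_nonneg_AE AE_I2) auto
  also have "\<dots> = (\<Sum>i\<in>I. \<integral>\<^sup>+x. ennreal (f i x) * ennreal (d i x powr p) \<partial>M)"
  proof (intro sum.cong refl)
    fix i assume i: "i \<in> I"
    have "(\<integral>\<^sup>+x. ennreal (f i x) * ennreal (d i x powr p) \<partial>M) = (\<integral>\<^sup>+x. ennreal (f i x * d i x powr p) \<partial>M)"
      using part(2)[OF i] by (intro nn_integral_cong) (simp add: ennreal_mult)
    also have "\<dots> = ennreal (\<integral>x. f i x * d i x powr p \<partial>M)"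
      using part(2)[OF i] by (intro nn_integral_eq_integral fip[OF i] AE_I2) auto
    finally show "ennreal (\<integral>x. f i x * d i x powr p \<partial>M) = (\<integral>\<^sup>+x. ennreal (f i x) * ennreal (d i x powr p) \<partial>M)" ..
  qed
  also have "\<dots> < ennreal (s powr p)" using If(3) G(2) by (rule le_less_trans)
  finally have small: "(\<Sum>i\<in>I. \<integral>x. f i x * d i x powr p \<partial>M) < s powr p"
    using part(2) by (subst (asm) ennreal_less_iff) (auto intro!: sum_nonneg integral_nonneg_AE AE_I2)
  have mass: "(\<Sum>i\<in>I. \<integral>x. f i x \<partial>M) = 1"
  proof -
    have "(\<Sum>i\<in>I. \<integral>x. f i x \<partial>M) = (\<integral>x. (\<Sum>i\<in>I. f i x) \<partial>M)"
      by (intro Bochner_Integration.integral_sum[symmetric] fi)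
    also have "\<dots> = (\<integral>x. 1 \<partial>M)"
    proof (rule integral_cong_AE)
      show "(\<lambda>x. \<Sum>i\<in>I. f i x) \<in> borel_measurable M"
        using bdd_meas_measurable[OF part(1)] by (intro borel_measurable_sum)
    qed (use part(4) in auto)
    finally show ?thesis using prob_space by simp
  qed
  have "(\<Sum>i\<in>I. \<integral>x. f i x * d i x \<partial>M) \<le>
      (\<Sum>i\<in>I. s * (\<integral>x. f i x \<partial>M) + s powr (1 - p) * (\<integral>x. f i x * d i x powr p \<partial>M))"
  proof (intro sum_mono)
    fix i assume i: "i \<in> I"
    have "(\<integral>x. f i x * d i x \<partial>M) \<le> (\<integral>x. s * f i x + s powr (1 - p) * (f i x * d i x powr p) \<partial>M)"
    proof (rule integral_mono[OF fid[OF i]])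
      show "integrable M (\<lambda>x. s * f i x + s powr (1 - p) * (f i x * d i x powr p))"
        using fi[OF i] fip[OF i] by simp
      fix x
      have "f i x * d i x \<le> f i x * (s + s powr (1 - p) * d i x powr p)"
        using part(2)[OF i] le by (intro mult_left_mono) auto
      then show "f i x * d i x \<le> s * f i x + s powr (1 - p) * (f i x * d i x powr p)"
        by (simp add: algebra_simps)
    qed
    also have "\<dots> = s * (\<integral>x. f i x \<partial>M) + s powr (1 - p) * (\<integral>x. f i x * d i x powr p \<partial>M)"
      using fi[OF i] fip[OF i] by simp
    finally show "(\<integral>x. f i x * d i x \<partial>M) \<le> s * (\<integral>x. f i x \<partial>M) + s powr (1 - p) * (\<integral>x. f i x * d i x powr p \<partial>M)" .
  qed
  also have "\<dots> = s * (\<Sum>i\<in>I. \<integral>x. f i x \<partial>M) + s powr (1 - p) * (\<Sum>i\<in>I. \<integral>x. f i x * d i x powr p \<partial>M)"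
    by (simp add: sum.distrib sum_distrib_left)
  also have "\<dots> \<le> s * 1 + s powr (1 - p) * s powr p"
    unfolding mass using small by (intro add_left_mono mult_left_mono) auto
  also have "s powr (1 - p) * s powr p = s" using s by (simp add: powr_add[symmetric])
  finally have "(\<Sum>i\<in>I. \<integral>x. f i x * d i x \<partial>M) \<le> e" by (simp add: s_def)
  with If(1,2) id show thesis by (rule that)
qed

section \<open>Comparison of the regularised and the unregularised problem\<close>

context
  fixes v :: version and N :: nat and p :: real
    and X :: "nat \<Rightarrow> 'a topology" and Y :: "nat \<Rightarrow> 'b topology"
    and dX :: "(nat \<Rightarrow> 'a) \<Rightarrow> (nat \<Rightarrow> 'a) \<Rightarrow> real"
    and dY :: "(nat \<Rightarrow> 'b) \<Rightarrow> (nat \<Rightarrow> 'b) \<Rightarrow> real"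
    and M :: "(nat \<Rightarrow> 'a) measure" and M' :: "(nat \<Rightarrow> 'b) measure"
    and c :: "(nat \<Rightarrow> 'a) \<times> (nat \<Rightarrow> 'b) \<Rightarrow> real"
  assumes X: "\<And>t. t \<in> {1..N} \<Longrightarrow> polish (X t)" and Y: "\<And>t. t \<in> {1..N} \<Longrightarrow> polish (Y t)"
    and dX: "metric_inducing (path_space N X) dX" and dY: "metric_inducing (path_space N Y) dY"
    and p: "p \<ge> 1"
    and M: "M \<in> prob_measures_p (path_space N X) dX p" and M': "M' \<in> prob_measures_p (path_space N Y) dY p"
    and c: "continuous_map (prod_topology (path_space N X) (path_space N Y)) euclideanreal c"
    and growth: "growth_order (path_space N X) (path_space N Y) dX dY p c"
begin

abbreviation "version_set \<equiv> version_couplings v N X Y M M'"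

lemma version_set_couplings: "P \<in> version_set \<Longrightarrow> P \<in> couplings (path_space N X) (path_space N Y) M M'"
  by (simp add: version_couplings_def)

text \<open>All couplings give the same integral to the dominating function \<open>w\<close>, so lower semicontinuity
  for the nonnegative functions \<open>w + c\<close> and \<open>w - c\<close> controls \<open>c\<close> from both sides.\<close>

lemma dominating_function:
  obtains w and R :: real where
    "continuous_map (prod_topology (path_space N X) (path_space N Y)) euclideanreal w"
    "\<And>z. z \<in> topspace (path_space N X) \<times> topspace (path_space N Y) \<Longrightarrow> \<bar>c z\<bar> \<le> w z"
    "\<And>P. P \<in> version_set \<Longrightarrow> integrable P w" "\<And>P. P \<in> version_set \<Longrightarrow> (\<integral>z. w z \<partial>P) = R"
    "\<And>P. P \<in> version_set \<Longrightarrow> integrable P c"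
proof -
  let ?S = "path_space N X" and ?T = "path_space N Y"
  obtain a b where a: "a \<in> topspace ?S" and b: "b \<in> topspace ?T"
    and bnd: "bounded ((\<lambda>(x, y). c (x, y) / (1 + dX a x powr p + dY b y powr p)) ` (topspace ?S \<times> topspace ?T))"
    using growth unfolding growth_order_def by blast
  obtain C where C: "\<And>x y. x \<in> topspace ?S \<Longrightarrow> y \<in> topspace ?T \<Longrightarrow> \<bar>c (x, y) / (1 + dX a x powr p + dY b y powr p)\<bar> \<le> C"
  proof -
    obtain C where "\<forall>r\<in>(\<lambda>(x, y). c (x, y) / (1 + dX a x powr p + dY b y powr p)) ` (topspace ?S \<times> topspace ?T). \<bar>r\<bar> \<le> C"
      using bnd unfolding bounded_iff by auto
    then have "\<bar>c (x, y) / (1 + dX a x powr p + dY b y powr p)\<bar> \<le> C" if "x \<in> topspace ?S" "y \<in> topspace ?T" for x y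
      using that by fast
    then show thesis by (rule that)
  qed
  define w where "w z = C * (1 + (dX a (fst z) powr p + dY b (snd z) powr p))" for z
  have p0: "p > 0" using p by simp
  note cX = continuous_map_dist_powr[OF dX a p0] and cY = continuous_map_dist_powr[OF dY b p0]
  have wc: "continuous_map (prod_topology ?S ?T) euclideanreal w"
    unfolding w_def
    using continuous_map_compose[OF continuous_map_fst cX] continuous_map_compose[OF continuous_map_snd cY]
    by (intro continuous_map_real_mult continuous_map_add) (auto simp: o_def)
  have cw: "\<bar>c z\<bar> \<le> w z" if z: "z \<in> topspace ?S \<times> topspace ?T" for z
  proof -
    have pos: "0 < 1 + dX a (fst z) powr p + dY b (snd z) powr p" by (simp add: add_pos_nonneg)
    have "\<bar>c (fst z, snd z) / (1 + dX a (fst z) powr p + dY b (snd z) powr p)\<bar> \<le> C"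
      using z by (intro C) auto
    then have "\<bar>c z\<bar> / (1 + dX a (fst z) powr p + dY b (snd z) powr p) \<le> C" using pos by (simp add: abs_divide)
    then have "\<bar>c z\<bar> \<le> C * (1 + dX a (fst z) powr p + dY b (snd z) powr p)" using pos by (simp add: pos_divide_le_eq)
    then show ?thesis by (simp add: w_def add.assoc)
  qed
  have iX: "integrable M (\<lambda>x. dX a x powr p)" and iY: "integrable M' (\<lambda>y. dY b y powr p)"
    using moment_integrable[OF dX M p0 a] moment_integrable[OF dY M' p0 b] .
  have wi: "integrable P w" "(\<integral>z. w z \<partial>P) = C * (1 + ((\<integral>x. dX a x powr p \<partial>M) + (\<integral>y. dY b y powr p \<partial>M')))"
    if P: "P \<in> version_set" for P
  proof -
    note Pc = version_set_couplings[OF P]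
    interpret P: prob_space P by (rule couplings_prob_space[OF Pc])
    have i: "integrable P (\<lambda>z. dX a (fst z) powr p)" "integrable P (\<lambda>z. dY b (snd z) powr p)"
      using couplings_integral_fst(2)[OF Pc borel_measurable_integrable[OF iX]] iX
        couplings_integral_snd(2)[OF Pc borel_measurable_integrable[OF iY]] iY by auto
    show "integrable P w" unfolding w_def using i by simp
    show "(\<integral>z. w z \<partial>P) = C * (1 + ((\<integral>x. dX a x powr p \<partial>M) + (\<integral>y. dY b y powr p \<partial>M')))"
      unfolding w_def using i P.prob_space
        couplings_integral_fst(1)[OF Pc borel_measurable_integrable[OF iX]]
        couplings_integral_snd(1)[OF Pc borel_measurable_integrable[OF iY]] by simp
  qed
  have ci: "integrable P c" if P: "P \<in> version_set" for P
  proof (rule Bochner_Integration.integrable_bound[OF wi(1)[OF P]])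
    note Pc = version_set_couplings[OF P]
    show "c \<in> borel_measurable P"
      using continuous_map_borel_measurable[OF c] measurable_cong_sets[OF couplings_sets[OF Pc] refl, of borel] by blast
    show "AE z in P. norm (c z) \<le> norm (w z)"
    proof (rule AE_I2)
      fix z assume "z \<in> space P"
      then have "\<bar>c z\<bar> \<le> w z" using couplings_space[OF Pc] by (intro cw) simp
      then show "norm (c z) \<le> norm (w z)" by simp
    qed
  qed
  show thesis using that[OF wc cw wi ci] .
qed

lemma transport_cost_eq:
  assumes "P \<in> version_set"
  shows "integrable P c" "transport_cost c P = ereal (\<integral>z. c z \<partial>P)"
proof -
  show "integrable P c" using dominating_function assms by metis
  then show "transport_cost c P = ereal (\<integral>z. c z \<partial>P)" unfolding transport_cost_def by (rule ext_integral_eq)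
qed

lemma version_set_sets:
  assumes "P \<in> version_set"
  shows "sets P = sets (M \<Otimes>\<^sub>M M')"
  using sets_pair_measure_path_space[OF X Y version_set_couplings[OF assms]] couplings_sets[OF version_set_couplings[OF assms]] by simp

lemma transport_cost_le_entropic_cost:
  assumes P: "P \<in> version_set" and e: "0 < e"
  shows "transport_cost c P \<le> entropic_cost e M M' c P"
proof -
  note Pc = version_set_couplings[OF P]
  interpret M: prob_space M by (rule couplings_marginal_prob[OF Pc])
  interpret M': prob_space M' by (rule couplings_marginal_prob[OF Pc])
  interpret pair_prob_space M M' ..
  have "0 \<le> KL P (M \<Otimes>\<^sub>M M')"
    by (rule KL_nonneg[OF couplings_prob_space[OF Pc] prob_space_axioms version_set_sets[OF P]])
  then have "0 \<le> ereal e * KL P (M \<Otimes>\<^sub>M M')" using e by simp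
  then show ?thesis unfolding transport_cost_def entropic_cost_def by (rule ereal_le_add_self)
qed

lemma V_le_E: "0 < e \<Longrightarrow> V v N X Y M M' c \<le> E v e N X Y M M' c"
  unfolding V_def E_def by (intro INF_mono) (use transport_cost_le_entropic_cost in blast)

text \<open>A near-optimal coupling may have infinite entropy. Smoothing it yields \<open>Q\<close>
  of finite entropy whose cost is still below \<open>s\<close>; the size of \<open>C\<close> is
  immaterial, as \<open>Q\<close> stays fixed while \<epsilon> tends to 0.\<close>

lemma bounded_density_approximation:
  assumes Ms: "\<And>n. Ms n \<in> prob_measures (path_space N X) \<and> finitely_supported (Ms n)"
    and Ms': "\<And>n. Ms' n \<in> prob_measures (path_space N Y) \<and> finitely_supported (Ms' n)"
    and conv: "(\<lambda>n. W_bc N X dX p (Ms n) M) \<longlonglongrightarrow> 0" "(\<lambda>n. W_bc N Y dY p (Ms' n) M') \<longlonglongrightarrow> 0"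
    and P: "P \<in> version_set" and s: "(\<integral>z. c z \<partial>P) < s"
  obtains Q C where "Q \<in> version_set" "(\<integral>z. c z \<partial>Q) < s" "KL Q (M \<Otimes>\<^sub>M M') \<le> ereal C" "0 \<le> C"
proof -
  let ?S = "path_space N X" and ?T = "path_space N Y"
  note Pc = version_set_couplings[OF P]
  interpret M: prob_space M by (rule couplings_marginal_prob[OF Pc])
  interpret M': prob_space M' by (rule couplings_marginal_prob[OF Pc])
  interpret MM: pair_prob_space M M' ..
  obtain w R where w: "continuous_map (prod_topology ?S ?T) euclideanreal w"
    "\<And>z. z \<in> topspace ?S \<times> topspace ?T \<Longrightarrow> \<bar>c z\<bar> \<le> w z"
    "\<And>P. P \<in> version_set \<Longrightarrow> integrable P w" "\<And>P. P \<in> version_set \<Longrightarrow> (\<integral>z. w z \<partial>P) = R"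
    "\<And>P. P \<in> version_set \<Longrightarrow> integrable P c"
    by (rule dominating_function) (assumption | rule that)+
  \<comment> \<open>With w - c, a lower bound on the integral of \<open>h\<close> is an upper bound
    on the cost, since \<open>w\<close> has the same integral \<open>R\<close> under all admissible
    couplings.\<close>
  define h where "h z = w z - c z" for z
  have hc: "continuous_map (prod_topology ?S ?T) euclideanreal h"
    unfolding h_def by (rule continuous_map_diff[OF w(1) c])
  have h0: "0 \<le> h z" if "z \<in> topspace ?S \<times> topspace ?T" for z using w(2)[OF that] by (simp add: h_def)
  have hi: "integrable Q h" "(\<integral>z. h z \<partial>Q) = R - (\<integral>z. c z \<partial>Q)" if "Q \<in> version_set" for Q
    unfolding h_def using w(3,4,5)[OF that] by auto
  have hP: "R - s < (\<integral>z. h z \<partial>P)" using hi(2)[OF P] s by simp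
  obtain F k where k: "0 \<le> k" and F: "continuous_map (prod_topology ?S ?T) euclideanreal F"
    "bounded (F ` topspace (prod_topology ?S ?T))" "\<And>z. z \<in> topspace ?S \<times> topspace ?T \<Longrightarrow> F z \<le> h z"
    "\<And>x y x' y'. x \<in> topspace ?S \<Longrightarrow> x' \<in> topspace ?S \<Longrightarrow> y \<in> topspace ?T \<Longrightarrow> y' \<in> topspace ?T \<Longrightarrow>
      \<bar>F (x, y) - F (x', y')\<bar> \<le> k * (dX x x' + dY y y')" "R - s < (\<integral>z. F z \<partial>P)"
    by (rule lipschitz_minorant[OF dX dY couplings_prob_space[OF Pc] couplings_sets[OF Pc] hc h0 hi(1)[OF P] hP])
      (assumption | rule that)+
  define gap where "gap = (\<integral>z. F z \<partial>P) - (R - s)"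
  have gap: "0 < gap" using F(5) by (simp add: gap_def)
  \<comment> \<open>The smoothing error is at most 2 k (e + e) = 4 k e, hence at most gap / 2; the
    added 1 covers the case k = 0.\<close>
  define e where "e = gap / (8 * (k + 1))"
  have e: "0 < e" using gap k by (simp add: e_def)
  obtain I f where If: "adapted_partition X N M I f" "I \<subseteq> topspace ?S"
    "\<And>i. i \<in> I \<Longrightarrow> integrable M (dX i)" "(\<Sum>i\<in>I. \<integral>x. f i x * dX i x \<partial>M) \<le> e"
    by (rule adapted_partition_exists[OF X dX p M Ms conv(1) e]) (assumption | rule that)+
  obtain J g where Jg: "adapted_partition Y N M' J g" "J \<subseteq> topspace ?T"
    "\<And>j. j \<in> J \<Longrightarrow> integrable M' (dY j)" "(\<Sum>j\<in>J. \<integral>y. g j y * dY j y \<partial>M') \<le> e"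
    by (rule adapted_partition_exists[OF Y dY p M' Ms' conv(2) e]) (assumption | rule that)+
  define Q where "Q = smooth_coupling M M' P I f J g"
  define D where "D = smooth_density M M' P I f J g"
  have QD: "Q = density (M \<Otimes>\<^sub>M M') (\<lambda>z. ennreal (D z))"
    unfolding Q_def D_def by (rule smooth_coupling_def[OF X Y Pc If(1) Jg(1)])
  have Db: "bdd_meas (M \<Otimes>\<^sub>M M') D"
    unfolding D_def by (rule smooth_density_bdd_meas[OF X Y Pc If(1) Jg(1)])
  have D0: "0 \<le> D z" for z
    unfolding D_def by (rule smooth_density_nonneg[OF X Y Pc If(1) Jg(1)])
  have adm: "admissible v N X Y P" using P unfolding version_couplings_def by blast
  have Qpi: "Q \<in> version_set"
    unfolding Q_def by (rule smooth_coupling_version[OF X Y Pc If(1) Jg(1) adm])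
  note Qc = version_set_couplings[OF Qpi]
  have Fb: "bdd_meas (M \<Otimes>\<^sub>M M') F" by (rule continuous_map_bdd_meas[OF sets_pair_measure_path_space[OF X Y Pc] F(1,2)])
  have spMM: "space (M \<Otimes>\<^sub>M M') = topspace ?S \<times> topspace ?T"
    using sets_eq_imp_space_eq[OF sets_pair_measure_path_space[OF X Y Pc]] by simp
  have "\<bar>(\<integral>z. F z \<partial>P) - (\<integral>z. F z \<partial>Q)\<bar> \<le>
    2 * k * ((\<Sum>i\<in>I. \<integral>x. f i x * dX i x \<partial>M) + (\<Sum>j\<in>J. \<integral>y. g j y * dY j y \<partial>M'))"
    unfolding Q_def
  proof (rule smooth_coupling_lipschitz[OF X Y Pc If(1) Jg(1) Fb _ If(3) Jg(3), where G="\<lambda>i j. F (i, j)"])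
    fix i j z assume "i \<in> I" "j \<in> J" "z \<in> space (M \<Otimes>\<^sub>M M')"
    then have "\<bar>F (i, j) - F (fst z, snd z)\<bar> \<le> k * (dX i (fst z) + dY j (snd z))"
      using If(2) Jg(2) spMM by (intro F(4)) auto
    then show "\<bar>F z - F (i, j)\<bar> \<le> k * (dX i (fst z) + dY j (snd z))" by (simp add: abs_minus_commute)
  qed
  also have "\<dots> \<le> 2 * k * (e + e)" using If(4) Jg(4) k by (intro mult_left_mono add_mono) auto
  also have "\<dots> < gap"
  proof -
    have "8 * ((k + 1) * e) = gap" using k by (simp add: e_def field_simps)
    moreover have "k * e \<le> (k + 1) * e" using e by simp
    moreover have "2 * k * (e + e) = 4 * (k * e)" by simp
    ultimately show ?thesis using gap by linarith
  qed
  finally have "(\<integral>z. F z \<partial>P) - gap < (\<integral>z. F z \<partial>Q)" by simp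
  then have "R - s < (\<integral>z. F z \<partial>Q)" by (simp add: gap_def)
  also have "\<dots> \<le> (\<integral>z. h z \<partial>Q)"
  proof (rule integral_mono[OF _ hi(1)[OF Qpi]])
    show "integrable Q F"
      using bdd_meas_integrable[OF _ continuous_map_bdd_meas[OF couplings_sets[OF Qc] F(1,2)]]
        couplings_prob_space[OF Qc] by (simp add: prob_space_def)
    show "F z \<le> h z" if "z \<in> space Q" for z using that couplings_space[OF Qc] by (intro F(3)) simp
  qed
  finally have cost: "(\<integral>z. c z \<partial>Q) < s" using hi(2)[OF Qpi] by simp
  obtain K where K: "K \<ge> 0" "\<And>z. z \<in> space (M \<Otimes>\<^sub>M M') \<Longrightarrow> \<bar>D z\<bar> \<le> K" using bdd_meas_bound[OF Db] by blast
  \<comment> \<open>The bound \<open>K\<close> on the density is raised by 1 because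
    \<open>KL_density_le\<close> asks for a bound of at least 1.\<close>
  have "KL Q (M \<Otimes>\<^sub>M M') \<le> ereal (ln (K + 1))"
    unfolding QD
  proof (rule KL_density_le[OF MM.prob_space_axioms bdd_meas_measurable[OF Db] D0])
    show "D z \<le> K + 1" if "z \<in> space (M \<Otimes>\<^sub>M M')" for z using K(2)[OF that] by simp
    show "prob_space (density (M \<Otimes>\<^sub>M M') (\<lambda>z. ennreal (D z)))"
      unfolding QD[symmetric] by (rule couplings_prob_space[OF Qc])
  qed (use K in simp)
  moreover have "0 \<le> ln (K + 1)" using K(1) by simp
  ultimately show thesis using that[OF Qpi cost] by blast
qed

text \<open>The lower bound is \<open>V_le_E\<close>. For the upper bound, a near-optimal coupling
  is smoothed into one fixed \<open>Q\<close> of finite entropy, and then \<epsilon> is taken small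
  relative to its entropy bound \<open>C\<close>.\<close>

lemma E_tendsto_V:
  assumes Ms: "\<And>n. Ms n \<in> prob_measures (path_space N X) \<and> finitely_supported (Ms n)"
    and Ms': "\<And>n. Ms' n \<in> prob_measures (path_space N Y) \<and> finitely_supported (Ms' n)"
    and conv: "(\<lambda>n. W_bc N X dX p (Ms n) M) \<longlonglongrightarrow> 0" "(\<lambda>n. W_bc N Y dY p (Ms' n) M') \<longlonglongrightarrow> 0"
  shows "((\<lambda>e. E v e N X Y M M' c) \<longlongrightarrow> V v N X Y M M' c) (at_right 0)"
proof (rule order_tendstoI)
  fix l assume "l < V v N X Y M M' c"
  then have "l < E v e N X Y M M' c" if "0 < e" for e using V_le_E[OF that] by (rule less_le_trans)
  then show "\<forall>\<^sub>F e in at_right 0. l < E v e N X Y M M' c"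
    by (intro eventually_at_rightI[of 0 1]) auto
next
  fix u assume "V v N X Y M M' c < u"
  then obtain P where P: "P \<in> version_set" "transport_cost c P < u" unfolding V_def INF_less_iff by blast
  then have "ereal (\<integral>z. c z \<partial>P) < u" using transport_cost_eq(2) by simp
  then obtain s where s: "ereal (\<integral>z. c z \<partial>P) < ereal s" "ereal s < u" using ereal_dense2 by blast
  obtain Q C where Q: "Q \<in> version_set" "(\<integral>z. c z \<partial>Q) < s" "KL Q (M \<Otimes>\<^sub>M M') \<le> ereal C" "0 \<le> C"
    using bounded_density_approximation[OF Ms Ms' conv P(1)] s(1) by auto
  \<comment> \<open>Chosen so that \<open>e < b\<close> makes the entropy term at most the slack
    between \<open>s\<close> and the cost of \<open>Q\<close>; adding 1 to \<open>C\<close> avoids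
    division by 0.\<close>
  define b where "b = (s - (\<integral>z. c z \<partial>Q)) / (C + 1)"
  have b: "0 < b" unfolding b_def using Q by simp
  have "E v e N X Y M M' c < u" if e: "0 < e" "e < b" for e
  proof -
    have "E v e N X Y M M' c \<le> entropic_cost e M M' c Q"
      unfolding E_def by (rule INF_lower[OF Q(1)])
    also have "\<dots> = ereal (\<integral>z. c z \<partial>Q) + ereal e * KL Q (M \<Otimes>\<^sub>M M')"
      unfolding entropic_cost_def ext_integral_eq[OF transport_cost_eq(1)[OF Q(1)]] ..
    also have "\<dots> \<le> ereal (\<integral>z. c z \<partial>Q) + ereal e * ereal C"
      using e Q(3) by (intro add_left_mono ereal_mult_left_mono) auto
    also have "\<dots> = ereal ((\<integral>z. c z \<partial>Q) + e * C)" by simp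
    also have "\<dots> \<le> ereal s"
    proof -
      have "e * C \<le> b * (C + 1)" using e Q(4) by (intro mult_mono) auto
      also have "\<dots> = s - (\<integral>z. c z \<partial>Q)" unfolding b_def using Q(4) by simp
      finally show ?thesis by simp
    qed
    also have "\<dots> < u" by (rule s(2))
    finally show ?thesis .
  qed
  then show "\<forall>\<^sub>F e in at_right 0. E v e N X Y M M' c < u"
    using b by (intro eventually_at_rightI[of 0 b]) auto
qed

text \<open>The transport costs along the sequence lie below the regularised values, which tend to
  the unregularised one; lower semicontinuity of the cost hands this bound to the limit, which is
  itself admissible.\<close>

lemma accumulation_point_V_optimal:
  assumes lim: "((\<lambda>e. E v e N X Y M M' c) \<longlongrightarrow> V v N X Y M M' c) (at_right 0)"
    and P: "weak_accumulation_point_at_0 (prod_topology (path_space N X) (path_space N Y))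
      (\<lambda>e. E_optimizers v e N X Y M M' c) P"
  shows "P \<in> V_optimizers v N X Y M M' c"
proof -
  let ?S = "path_space N X" and ?T = "path_space N Y"
  obtain e :: "nat \<Rightarrow> real" and Ps where P': "P \<in> prob_measures (prod_topology ?S ?T)"
    and e: "\<And>n. 0 < e n" "e \<longlonglongrightarrow> 0" and Ps: "\<And>n. Ps n \<in> E_optimizers v (e n) N X Y M M' c"
    and weak: "weakly_converges (prod_topology ?S ?T) Ps P"
    using P unfolding weak_accumulation_point_at_0_def by blast
  have Pspi: "Ps n \<in> version_set" and opt: "entropic_cost (e n) M M' c (Ps n) = E v (e n) N X Y M M' c" for n
    using Ps[of n] by (auto simp: E_optimizers_def)
  have Ppi: "P \<in> version_set" by (rule weak_limit_version_couplings[OF X Y Pspi P' weak])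
  note Pc = version_set_couplings[OF Ppi]
  obtain w R where w: "continuous_map (prod_topology ?S ?T) euclideanreal w"
    "\<And>z. z \<in> topspace ?S \<times> topspace ?T \<Longrightarrow> \<bar>c z\<bar> \<le> w z"
    "\<And>P. P \<in> version_set \<Longrightarrow> integrable P w" "\<And>P. P \<in> version_set \<Longrightarrow> (\<integral>z. w z \<partial>P) = R"
    "\<And>P. P \<in> version_set \<Longrightarrow> integrable P c"
    by (rule dominating_function) (assumption | rule that)+
  \<comment> \<open>Now w + c: a bounded continuous minorant of it bounds the costs along the
    sequence from below.\<close>
  define h where "h z = w z + c z" for z
  have hc: "continuous_map (prod_topology ?S ?T) euclideanreal h"
    unfolding h_def by (rule continuous_map_add[OF w(1) c])
  have h0: "0 \<le> h z" if "z \<in> topspace ?S \<times> topspace ?T" for z using w(2)[OF that] by (simp add: h_def)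
  have hi: "integrable Q h" "(\<integral>z. h z \<partial>Q) = R + (\<integral>z. c z \<partial>Q)" if "Q \<in> version_set" for Q
    unfolding h_def using w(3,4,5)[OF that] by auto
  have "filterlim e (at_right 0) sequentially"
    using e by (intro tendsto_imp_filterlim_at_right) auto
  then have limE: "(\<lambda>n. E v (e n) N X Y M M' c) \<longlonglongrightarrow> V v N X Y M M' c"
    by (rule filterlim_compose[OF lim])
  have "transport_cost c P \<le> V v N X Y M M' c"
  proof (rule ccontr)
    assume "\<not> transport_cost c P \<le> V v N X Y M M' c"
    then have "V v N X Y M M' c < ereal (\<integral>z. c z \<partial>P)" using transport_cost_eq(2)[OF Ppi] by simp
    then obtain s where s: "V v N X Y M M' c < ereal s" "ereal s < ereal (\<integral>z. c z \<partial>P)" using ereal_dense2 by blast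
    have hP: "R + s < (\<integral>z. h z \<partial>P)" using s(2) hi(2)[OF Ppi] by simp
    obtain F and k :: real where F: "continuous_map (prod_topology ?S ?T) euclideanreal F"
      "bounded (F ` topspace (prod_topology ?S ?T))" "\<And>z. z \<in> topspace ?S \<times> topspace ?T \<Longrightarrow> F z \<le> h z"
      "R + s < (\<integral>z. F z \<partial>P)"
      by (rule lipschitz_minorant[OF dX dY couplings_prob_space[OF Pc] couplings_sets[OF Pc] hc h0 hi(1)[OF Ppi] hP])
        (assumption | rule that)+
    have "(\<lambda>n. \<integral>z. F z \<partial>Ps n) \<longlonglongrightarrow> (\<integral>z. F z \<partial>P)"
      using weak F(1,2) unfolding weakly_converges_def by blast
    then have "\<forall>\<^sub>F n in sequentially. R + s < (\<integral>z. F z \<partial>Ps n)" using F(4) by (rule order_tendstoD(1))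
    moreover have "\<forall>\<^sub>F n in sequentially. E v (e n) N X Y M M' c < ereal s" using limE s(1) by (rule order_tendstoD(2))
    ultimately have "\<forall>\<^sub>F n in sequentially. R + s < (\<integral>z. F z \<partial>Ps n) \<and> E v (e n) N X Y M M' c < ereal s"
      by eventually_elim simp
    then obtain n where n: "R + s < (\<integral>z. F z \<partial>Ps n)" "E v (e n) N X Y M M' c < ereal s"
      by (auto simp: eventually_sequentially)
    note Qc = version_set_couplings[OF Pspi[of n]]
    have "(\<integral>z. F z \<partial>Ps n) \<le> (\<integral>z. h z \<partial>Ps n)"
    proof (rule integral_mono[OF _ hi(1)[OF Pspi]])
      show "integrable (Ps n) F"
        using bdd_meas_integrable[OF _ continuous_map_bdd_meas[OF couplings_sets[OF Qc] F(1,2)]]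
          couplings_prob_space[OF Qc] by (simp add: prob_space_def)
      show "F z \<le> h z" if "z \<in> space (Ps n)" for z using that couplings_space[OF Qc] by (intro F(3)) simp
    qed
    then have "s < (\<integral>z. c z \<partial>Ps n)" using n(1) hi(2)[OF Pspi[of n]] by simp
    then have "ereal s < transport_cost c (Ps n)" using transport_cost_eq(2)[OF Pspi[of n]] by simp
    also have "\<dots> \<le> E v (e n) N X Y M M' c"
      unfolding opt[symmetric] by (rule transport_cost_le_entropic_cost[OF Pspi e(1)])
    finally show False using n(2) by simp
  qed
  moreover have "V v N X Y M M' c \<le> transport_cost c P" unfolding V_def by (rule INF_lower[OF Ppi])
  ultimately show ?thesis using Ppi by (simp add: V_optimizers_def)
qed

end

theorem theorem4p2:
  fixes v :: version and N :: nat and p :: real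
    and X :: "nat \<Rightarrow> 'a topology" and Y :: "nat \<Rightarrow> 'b topology"
    and dX :: "(nat \<Rightarrow> 'a) \<Rightarrow> (nat \<Rightarrow> 'a) \<Rightarrow> real"
    and dY :: "(nat \<Rightarrow> 'b) \<Rightarrow> (nat \<Rightarrow> 'b) \<Rightarrow> real"
    and \<mu> :: "(nat \<Rightarrow> 'a) measure" and \<nu> :: "(nat \<Rightarrow> 'b) measure"
    and \<mu>s :: "nat \<Rightarrow> (nat \<Rightarrow> 'a) measure" and \<nu>s :: "nat \<Rightarrow> (nat \<Rightarrow> 'b) measure"
    and c :: "(nat \<Rightarrow> 'a) \<times> (nat \<Rightarrow> 'b) \<Rightarrow> real"
  assumes "\<And>t. t \<in> {1..N} \<Longrightarrow> polish (X t)"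
    and "\<And>t. t \<in> {1..N} \<Longrightarrow> polish (Y t)"
    and "metric_inducing (path_space N X) dX"
    and "metric_inducing (path_space N Y) dY"
    and "p \<ge> 1"
    and "\<mu> \<in> prob_measures_p (path_space N X) dX p"
    and "\<nu> \<in> prob_measures_p (path_space N Y) dY p"
    and "continuous_map (prod_topology (path_space N X) (path_space N Y)) euclideanreal c"
    and "growth_order (path_space N X) (path_space N Y) dX dY p c"
    and "\<And>n. \<mu>s n \<in> prob_measures (path_space N X) \<and> finitely_supported (\<mu>s n)"
    and "\<And>n. \<nu>s n \<in> prob_measures (path_space N Y) \<and> finitely_supported (\<nu>s n)"
    and "(\<lambda>n. W_bc N X dX p (\<mu>s n) \<mu>) \<longlonglongrightarrow> 0"
    and "(\<lambda>n. W_bc N Y dY p (\<nu>s n) \<nu>) \<longlonglongrightarrow> 0"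
  shows "((\<lambda>\<epsilon>. E v \<epsilon> N X Y \<mu> \<nu> c) \<longlongrightarrow> V v N X Y \<mu> \<nu> c) (at_right 0)
    \<and> (\<forall>\<pi>. weak_accumulation_point_at_0 (prod_topology (path_space N X) (path_space N Y))
             (\<lambda>\<epsilon>. E_optimizers v \<epsilon> N X Y \<mu> \<nu> c) \<pi>
           \<longrightarrow> \<pi> \<in> V_optimizers v N X Y \<mu> \<nu> c)"
proof (intro conjI allI impI)
  have 10: "\<And>n. \<mu>s n \<in> prob_measures (path_space N X) \<and> finitely_supported (\<mu>s n)"
    and 11: "\<And>n. \<nu>s n \<in> prob_measures (path_space N Y) \<and> finitely_supported (\<nu>s n)"
    using assms(10,11) by auto
  show lim: "((\<lambda>\<epsilon>. E v \<epsilon> N X Y \<mu> \<nu> c) \<longlongrightarrow> V v N X Y \<mu> \<nu> c) (at_right 0)"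
    by (rule E_tendsto_V[OF assms(1-9) 10 11 assms(12,13)])
  show "\<pi> \<in> V_optimizers v N X Y \<mu> \<nu> c"
    if "weak_accumulation_point_at_0 (prod_topology (path_space N X) (path_space N Y))
      (\<lambda>\<epsilon>. E_optimizers v \<epsilon> N X Y \<mu> \<nu> c) \<pi>" for \<pi>
    by (rule accumulation_point_V_optimal[OF assms(1-9) lim that])
qed

end
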